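(* Let $V$ be a complex vector space of finite dimension $n\geqslant 1$ and let $W\subset\mathrm{GL}(V)$ be an irreducible complex reflection group. Consider the commutative diagram of groups $$\begin{array}{ccccc} \langle \pi\rangle & \to & \langle\beta\rangle & \to & Z(W)\\ \downarrow & & \downarrow & & \downarrow\\ P & \to & B & \to & W\\ \downarrow & & \downarrow & & \downarrow\\ \pi_1(\widehat{X},[x]) & \to & \pi_1(\widehat{X}/\widehat{W},\widehat{W}.[x]) & & \widehat{W} \end{array}$$ whose objects and maps are described in the context (there is no map from $\pi_1(\widehat{X}/\widehat{W},\widehat{W}.[x])$ to $\widehat{W}$ in this diagram). The following statements are equivalent: (i) All regular elements of $W$ are central in $W$. (ii) The second column $1\to\langle\beta\rangle\to B\to\pi_1(\widehat{X}/\widehat{W},\widehat{W}.[x])\to 1$ is a short exact sequence. (iii) There is a group morphism $\pi_1(\widehat{X}/\widehat{W},\widehat{W}.[x])\to\widehat{W}$ which completes the diagram into a commutative diagram. Moreover, if these statements hold, then all the rows and all the columns of the completed diagram are short exact sequences.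
   Context: A reflection in $\mathrm{GL}(V)$ is a finite-order linear automorphism whose fixed-point subspace is a hyperplane; a complex reflection group is a finite subgroup of $\mathrm{GL}(V)$ generated by reflections; it is irreducible if it acts irreducibly on $V$. Let $X$ be the complement in $V$ of the union of the reflecting hyperplanes of $W$ (fixed hyperplanes of reflections of $W$). Let $Z(W)$ be the center of $W$; by irreducibility it is the (cyclic) group of scalar matrices in $W$. Let $\widehat{W}=W/Z(W)$ be the image of $W$ in $\mathrm{PGL}(V)$, acting on $\mathbb{P}(V)$. For nonzero $x\in V$, $[x]\in\mathbb{P}(V)$ is the line spanned by $x$, and $\widehat{X}\subset\mathbb{P}(V)$ is the image of $X$, i.e. the set of lines $[x]$ with $x\in X$, $x\neq 0$. Fix a nonzero basepoint $x\in X$. The pure braid group is $P=\pi_1(X,x)$ and the braid group is $B=\pi_1(X/W,W.x)$. The element $\pi\in P$ is the class of the loop $t\mapsto e^{2i\pi t}x$, and $\beta\in B$ is the class of the loop $t\mapsto W.(e^{2i\pi t/|Z(W)|}x)$ in $X/W$, for $t\in[0,1]$; the image of $\pi$ in $B$ is $\beta^{|Z(W)|}$. Maps of the diagram: $P\to B$ is induced by the covering $X\to X/W$, and $B\to W$ is the associated projection onto the group of the covering; $P\to\pi_1(\widehat{X},[x])$, $B\to\pi_1(\widehat{X}/\widehat{W},\widehat{W}.[x])$ and $\pi_1(\widehat{X},[x])\to\pi_1(\widehat{X}/\widehat{W},\widehat{W}.[x])$ are induced by the natural projections of spaces $X\to\widehat X$, $X/W\to\widehat X/\widehat W$, $\widehat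 X\to\widehat X/\widehat W$; $W\to\widehat{W}$ is the quotient map; the maps from the first row to the second are inclusions; the maps in the first row are the restrictions of those in the second row. An element $g\in W$ is regular if there is $\zeta\in\mathbb{C}^*$ such that $g$ has a $\zeta$-eigenvector lying in $X$. *)

theory Defs
  imports
    "HOL-Analysis.Analysis"
    "HOL-Algebra.Group_Action"
    "HOL-Algebra.Generated_Groups"
begin

section \<open>Groups\<close>

definition center :: "('a, 'b) monoid_scheme \<Rightarrow> 'a set" where
  "center G = {z \<in> carrier G. \<forall>g \<in> carrier G. z \<otimes>\<^bsub>G\<^esub> g = g \<otimes>\<^bsub>G\<^esub> z}"

abbreviation restricted_to :: "'a monoid \<Rightarrow> 'a set \<Rightarrow> 'a monoid" where
  "restricted_to G H \<equiv> G\<lparr>carrier := H\<rparr>"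

text \<open>Exactness of \<open>1 \<rightarrow> A \<rightarrow> B \<rightarrow> C \<rightarrow> 1\<close>. The library's \<open>short_exact_sequence\<close> is not
  usable here, because it forces the elements of the three groups to have the same type.\<close>

definition short_exact ::
  "'a monoid \<Rightarrow> 'b monoid \<Rightarrow> 'c monoid \<Rightarrow> ('a \<Rightarrow> 'b) \<Rightarrow> ('b \<Rightarrow> 'c) \<Rightarrow> bool" where
  "short_exact A B C f g \<longleftrightarrow>
     group A \<and> group B \<and> group C \<and> f \<in> mon A B \<and> g \<in> epi B C \<and>
     f ` carrier A = kernel B C g"


section \<open>Quotient spaces and fundamental groups\<close>

definition quotient_topology :: "'a topology \<Rightarrow> ('a \<Rightarrow> 'b) \<Rightarrow> 'b topology" where
  "quotient_topology X f =
     topology (\<lambda>U. U \<subseteq> f ` topspace X \<and> openin X {x \<in> topspace X. f x \<in> U})"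

lemma openin_quotient_topology:
  "openin (quotient_topology X f) U \<longleftrightarrow>
     U \<subseteq> f ` topspace X \<and> openin X {x \<in> topspace X. f x \<in> U}"
proof -
  let ?P = "\<lambda>U. U \<subseteq> f ` topspace X \<and> openin X {x \<in> topspace X. f x \<in> U}"
  have "istopology ?P"
    unfolding istopology_def
  proof (intro conjI allI impI)
    fix S T assume "?P S" "?P T"
    moreover have "{x \<in> topspace X. f x \<in> S \<inter> T} =
        {x \<in> topspace X. f x \<in> S} \<inter> {x \<in> topspace X. f x \<in> T}" by auto
    ultimately show "S \<inter> T \<subseteq> f ` topspace X" "openin X {x \<in> topspace X. f x \<in> S \<inter> T}"
      by auto
  next
    fix K assume K: "\<forall>S\<in>K. ?P S"
    have "{x \<in> topspace X. f x \<in> \<Union>K} = (\<Union>S\<in>K. {x \<in> topspace X. f x \<in> S})" by auto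
    with K show "\<Union>K \<subseteq> f ` topspace X" "openin X {x \<in> topspace X. f x \<in> \<Union>K}"
      by auto
  qed
  then show ?thesis
    by (simp add: quotient_topology_def topology_inverse')
qed

lemma quotient_map_quotient_topology: "quotient_map X (quotient_topology X f) f"
proof -
  have "openin (quotient_topology X f) (f ` topspace X)"
    unfolding openin_quotient_topology
    by (auto intro: openin_subopen[THEN iffD2])
  then have "topspace (quotient_topology X f) = f ` topspace X"
    by (metis openin_quotient_topology openin_subset openin_topspace subset_antisym)
  then show ?thesis
    by (auto simp: quotient_map_def openin_quotient_topology)
qed

definition loops :: "'a topology \<Rightarrow> 'a \<Rightarrow> (real \<Rightarrow> 'a) set" where
  "loops Y y = {p. pathin Y p \<and> p 0 = y \<and> p 1 = y}"

definition loop_homotopic :: "'a topology \<Rightarrow> 'a \<Rightarrow> ((real \<Rightarrow> 'a) \<times> (real \<Rightarrow> 'a)) set" where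
  "loop_homotopic Y y =
     {(p, q). p \<in> loops Y y \<and> q \<in> loops Y y \<and>
        homotopic_with (\<lambda>r. r 0 = y \<and> r 1 = y) (top_of_set {0..1}) Y p q}"

abbreviation loop_class :: "'a topology \<Rightarrow> 'a \<Rightarrow> (real \<Rightarrow> 'a) \<Rightarrow> (real \<Rightarrow> 'a) set" where
  "loop_class Y y p \<equiv> loop_homotopic Y y `` {p}"

text \<open>The library's \<open>joinpaths\<close> requires the points to live in a type of class
  \<open>topological_space\<close>; the points of our quotient spaces are sets of vectors.\<close>

definition join :: "(real \<Rightarrow> 'a) \<Rightarrow> (real \<Rightarrow> 'a) \<Rightarrow> real \<Rightarrow> 'a" where
  "join p q = (\<lambda>t. if t \<le> 1/2 then p (2 * t) else q (2 * t - 1))"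

text \<open>Products are read from left to right: first \<open>p\<close>, then \<open>q\<close>. In operations on classes, the
  unions range over all representatives, which all contribute the same class.\<close>

definition pi1 :: "'a topology \<Rightarrow> 'a \<Rightarrow> (real \<Rightarrow> 'a) set monoid" where
  "pi1 Y y =
     \<lparr>carrier = loops Y y // loop_homotopic Y y,
      mult = (\<lambda>a b. \<Union>p\<in>a. \<Union>q\<in>b. loop_class Y y (join p q)),
      one = loop_class Y y (\<lambda>_. y)\<rparr>"

definition pi1_map ::
  "'b topology \<Rightarrow> 'b \<Rightarrow> ('a \<Rightarrow> 'b) \<Rightarrow> (real \<Rightarrow> 'a) set \<Rightarrow> (real \<Rightarrow> 'b) set" where
  "pi1_map Y y f a = (\<Union>p\<in>a. loop_class Y y (f \<circ> p))"


section \<open>Complex reflection groups\<close>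

definition GL :: "(complex^'n^'n) monoid" where
  "GL = \<lparr>carrier = {A. invertible A}, mult = (**), one = mat 1\<rparr>"

definition fixed_space :: "complex^'n^'n \<Rightarrow> (complex^'n) set" where
  "fixed_space g = {v. g *v v = v}"

definition reflection :: "complex^'n^'n \<Rightarrow> bool" where
  "reflection r \<longleftrightarrow>
     r \<in> carrier GL \<and> (\<exists>k::nat. 0 < k \<and> r [^]\<^bsub>GL\<^esub> k = \<one>\<^bsub>GL\<^esub>) \<and>
     vec.dim (fixed_space r) = CARD('n) - 1"

definition complex_reflection_group :: "(complex^'n^'n) set \<Rightarrow> bool" where
  "complex_reflection_group W \<longleftrightarrow>
     subgroup W GL \<and> finite W \<and> (\<exists>S. (\<forall>r\<in>S. reflection r) \<and> W = generate GL S)"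

definition acts_irreducibly :: "(complex^'n^'n) set \<Rightarrow> bool" where
  "acts_irreducibly W \<longleftrightarrow>
     (\<forall>U. vec.subspace U \<and> (\<forall>g\<in>W. (*v) g ` U \<subseteq> U) \<longrightarrow> U = {0} \<or> U = UNIV)"

definition hyperplane_complement :: "(complex^'n^'n) set \<Rightarrow> (complex^'n) set" where
  "hyperplane_complement W = - (\<Union>r \<in> {r \<in> W. reflection r}. fixed_space r)"

definition regular :: "(complex^'n^'n) set \<Rightarrow> complex^'n^'n \<Rightarrow> bool" where
  "regular W g \<longleftrightarrow>
     g \<in> W \<and>
     (\<exists>\<zeta> v. \<zeta> \<noteq> 0 \<and> v \<noteq> 0 \<and> v \<in> hyperplane_complement W \<and> g *v v = \<zeta> *s v)"

abbreviation W_group :: "(complex^'n^'n) set \<Rightarrow> (complex^'n^'n) monoid" where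
  "W_group W \<equiv> restricted_to GL W"

definition W_center :: "(complex^'n^'n) set \<Rightarrow> (complex^'n^'n) set" where
  "W_center W = center (W_group W)"

abbreviation Z_group :: "(complex^'n^'n) set \<Rightarrow> (complex^'n^'n) monoid" where
  "Z_group W \<equiv> restricted_to GL (W_center W)"

definition hat_W :: "(complex^'n^'n) set \<Rightarrow> (complex^'n^'n) set monoid" where
  "hat_W W = W_group W Mod W_center W"

definition to_hat_W :: "(complex^'n^'n) set \<Rightarrow> complex^'n^'n \<Rightarrow> (complex^'n^'n) set" where
  "to_hat_W W g = W_center W #>\<^bsub>W_group W\<^esub> g"


section \<open>The four spaces\<close>

abbreviation X_top :: "(complex^'n^'n) set \<Rightarrow> (complex^'n) topology" where
  "X_top W \<equiv> top_of_set (hyperplane_complement W)"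

definition W_orbit :: "(complex^'n^'n) set \<Rightarrow> complex^'n \<Rightarrow> (complex^'n) set" where
  "W_orbit W v = orbit (W_group W) (*v) v"

definition X_mod_W :: "(complex^'n^'n) set \<Rightarrow> (complex^'n) set topology" where
  "X_mod_W W = quotient_topology (X_top W) (W_orbit W)"

text \<open>For irreducible \<open>W\<close>, the zero vector lies in the complement of the reflecting hyperplanes only
  if \<open>W\<close> is trivial and the dimension is 1. The projective space is then a single point, namely
  the line \<open>UNIV\<close>, and the value chosen at 0 is the only one that yields a (continuous) map from the
  complement to its image in projective space.\<close>

definition line :: "complex^'n \<Rightarrow> (complex^'n) set" where
  "line v = (if v = 0 then UNIV else vec.span {v})"

definition projective_space :: "(complex^'n) set topology" where
  "projective_space = quotient_topology (top_of_set (- {0})) line"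

definition hat_X :: "(complex^'n^'n) set \<Rightarrow> (complex^'n) set topology" where
  "hat_X W = subtopology projective_space (line ` (hyperplane_complement W - {0}))"

text \<open>The action of a coset of the center on lines: all its elements map a line to the same
  line.\<close>

definition act_on_lines :: "(complex^'n^'n) set \<Rightarrow> (complex^'n) set \<Rightarrow> (complex^'n) set" where
  "act_on_lines C L = (\<Union>g\<in>C. (*v) g ` L)"

definition hat_W_orbit :: "(complex^'n^'n) set \<Rightarrow> (complex^'n) set \<Rightarrow> (complex^'n) set set" where
  "hat_W_orbit W L = orbit (hat_W W) act_on_lines L"

definition hat_X_mod_hat_W :: "(complex^'n^'n) set \<Rightarrow> (complex^'n) set set topology" where
  "hat_X_mod_hat_W W = quotient_topology (hat_X W) (hat_W_orbit W)"

text \<open>The natural map from \<open>W\<close>-orbits of vectors to \<open>hat_W\<close>-orbits of lines. As above, the union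
  is over all representatives, which all contribute the same orbit.\<close>

definition orbit_proj :: "(complex^'n^'n) set \<Rightarrow> (complex^'n) set \<Rightarrow> (complex^'n) set set" where
  "orbit_proj W O' = (\<Union>v\<in>O'. hat_W_orbit W (line v))"


section \<open>The groups and maps of the diagram\<close>

definition pure_braid_group ::
  "(complex^'n^'n) set \<Rightarrow> complex^'n \<Rightarrow> (real \<Rightarrow> complex^'n) set monoid" where
  "pure_braid_group W x = pi1 (X_top W) x"

definition braid_group ::
  "(complex^'n^'n) set \<Rightarrow> complex^'n \<Rightarrow> (real \<Rightarrow> (complex^'n) set) set monoid" where
  "braid_group W x = pi1 (X_mod_W W) (W_orbit W x)"

definition hat_pure_braid_group ::
  "(complex^'n^'n) set \<Rightarrow> complex^'n \<Rightarrow> (real \<Rightarrow> (complex^'n) set) set monoid" where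
  "hat_pure_braid_group W x = pi1 (hat_X W) (line x)"

definition hat_braid_group ::
  "(complex^'n^'n) set \<Rightarrow> complex^'n \<Rightarrow> (real \<Rightarrow> (complex^'n) set set) set monoid" where
  "hat_braid_group W x = pi1 (hat_X_mod_hat_W W) (hat_W_orbit W (line x))"

definition pi_elt :: "(complex^'n^'n) set \<Rightarrow> complex^'n \<Rightarrow> (real \<Rightarrow> complex^'n) set" where
  "pi_elt W x =
     loop_class (X_top W) x (\<lambda>t. exp (2 * \<i> * of_real pi * of_real t) *s x)"

definition beta_elt :: "(complex^'n^'n) set \<Rightarrow> complex^'n \<Rightarrow> (real \<Rightarrow> (complex^'n) set) set" where
  "beta_elt W x =
     loop_class (X_mod_W W) (W_orbit W x)
       (\<lambda>t. W_orbit W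
          (exp (2 * \<i> * of_real pi * of_real t / of_nat (card (W_center W))) *s x))"

definition pi_group ::
  "(complex^'n^'n) set \<Rightarrow> complex^'n \<Rightarrow> (real \<Rightarrow> complex^'n) set monoid" where
  "pi_group W x =
     restricted_to (pure_braid_group W x) (generate (pure_braid_group W x) {pi_elt W x})"

definition beta_group ::
  "(complex^'n^'n) set \<Rightarrow> complex^'n \<Rightarrow> (real \<Rightarrow> (complex^'n) set) set monoid" where
  "beta_group W x =
     restricted_to (braid_group W x) (generate (braid_group W x) {beta_elt W x})"

definition P_to_B where
  "P_to_B W x = pi1_map (X_mod_W W) (W_orbit W x) (W_orbit W)"

text \<open>A braid is lifted to a path in the complement that starts at \<open>x\<close>; it is sent to the unique
  element of \<open>W\<close> that maps \<open>x\<close> to the end point of the lift. With products of loops read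
  from left to right this is a homomorphism, not an anti-homomorphism.\<close>

definition B_to_W ::
  "(complex^'n^'n) set \<Rightarrow> complex^'n \<Rightarrow> (real \<Rightarrow> (complex^'n) set) set \<Rightarrow> complex^'n^'n" where
  "B_to_W W x b =
     (THE g. g \<in> W \<and>
        (\<exists>\<gamma>. pathin (X_top W) \<gamma> \<and> \<gamma> 0 = x \<and> \<gamma> 1 = g *v x \<and> W_orbit W \<circ> \<gamma> \<in> b))"

definition P_to_hat_P where
  "P_to_hat_P W x = pi1_map (hat_X W) (line x) line"

definition B_to_hat_B where
  "B_to_hat_B W x = pi1_map (hat_X_mod_hat_W W) (hat_W_orbit W (line x)) (orbit_proj W)"

definition hat_P_to_hat_B where
  "hat_P_to_hat_B W x = pi1_map (hat_X_mod_hat_W W) (hat_W_orbit W (line x)) (hat_W_orbit W)"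

text \<open>The upper two squares consist of inclusions (the identity functions) and of restrictions of
  the maps in the second row (the same functions), so only the lower two squares need to be
  stated.\<close>

definition completes_diagram ::
  "(complex^'n^'n) set \<Rightarrow> complex^'n \<Rightarrow>
     ((real \<Rightarrow> (complex^'n) set set) set \<Rightarrow> (complex^'n^'n) set) \<Rightarrow> bool" where
  "completes_diagram W x \<phi> \<longleftrightarrow>
     \<phi> \<in> hom (hat_braid_group W x) (hat_W W) \<and>
     (\<forall>p \<in> carrier (pure_braid_group W x).
        hat_P_to_hat_B W x (P_to_hat_P W x p) = B_to_hat_B W x (P_to_B W x p)) \<and>
     (\<forall>b \<in> carrier (braid_group W x). \<phi> (B_to_hat_B W x b) = to_hat_W W (B_to_W W x b))"

definition second_column_exact :: "(complex^'n^'n) set \<Rightarrow> complex^'n \<Rightarrow> bool" where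
  "second_column_exact W x \<longleftrightarrow>
     short_exact (beta_group W x) (braid_group W x) (hat_braid_group W x) id (B_to_hat_B W x)"

definition rows_exact ::
  "(complex^'n^'n) set \<Rightarrow> complex^'n \<Rightarrow>
     ((real \<Rightarrow> (complex^'n) set set) set \<Rightarrow> (complex^'n^'n) set) \<Rightarrow> bool" where
  "rows_exact W x \<phi> \<longleftrightarrow>
     short_exact (pi_group W x) (beta_group W x) (Z_group W) (P_to_B W x) (B_to_W W x) \<and>
     short_exact (pure_braid_group W x) (braid_group W x) (W_group W)
       (P_to_B W x) (B_to_W W x) \<and>
     short_exact (hat_pure_braid_group W x) (hat_braid_group W x) (hat_W W)
       (hat_P_to_hat_B W x) \<phi>"

definition columns_exact :: "(complex^'n^'n) set \<Rightarrow> complex^'n \<Rightarrow> bool" where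
  "columns_exact W x \<longleftrightarrow>
     short_exact (pi_group W x) (pure_braid_group W x) (hat_pure_braid_group W x)
       id (P_to_hat_P W x) \<and>
     second_column_exact W x \<and>
     short_exact (Z_group W) (W_group W) (hat_W W) id (to_hat_W W)"

end

theory Submission
  imports
    Defs
    "HOL-Complex_Analysis.Conformal_Mappings"
    "HOL-Algebra.Multiplicative_Group"
    "Jordan_Normal_Form.Determinant"
begin

text \<open>
  Steinberg's theorem makes the action of \<open>W\<close> on the complement free: over its invariants, the
  polynomial functions are generated by at most \<open>card W\<close> elements (Chevalley's divided difference
  argument), so the determinant of their values along an orbit is a polynomial that vanishes
  exactly at the points with nontrivial stabilizer. Near a bad point of the complement it would have
  an isolated zero on a suitable plane. Hence paths and homotopies lift from the orbit space. A
  linear form vanishing on one reflecting hyperplane trivializes the bundle of nonzero vectors over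
  the projectivized complement, and regular elements are central exactly when the projective group
  acts freely there, so that homotopies lift from its orbit space as well. Conversely, a noncentral
  regular element yields a braid that becomes trivial in the projective orbit space.
\<close>

text \<open>The bound by \<open>card W\<close> is what makes the determinant available: padded by
  zero functions, the values of the generators along an orbit form a square matrix. Two rows agree
  when two orbit points coincide; when all are distinct, interpolating polynomials show that the
  rows are independent. So the points with nontrivial stabilizer form a hypersurface, whereas near a
  point off all reflecting hyperplanes they would form a finite union of subspaces of codimension at
  least 2. The topological obstacle is that the map from the complement to projective space has
  infinite fibres, so lifting results for finite free actions do not apply to it. They do apply to
  the slice, which meets each line of the complement once, and the scalar factor lost there is
  recovered by a complex logarithm. A hyperplane that defines the slice exists unless
  \<open>W\<close> is trivial; then the dimension is 1, both projective spaces are points, and the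
  claims are checked directly.\<close>

no_notation Matrix.vec_index (infixl "$" 100)
hide_const (open) Matrix.vec Matrix.mat

section \<open>Polynomial functions\<close>

text \<open>Homogeneous polynomials are represented as functions, not formally. The index is a
  degree in which the function is homogeneous; the zero function carries every index.\<close>

inductive hpoly :: "nat \<Rightarrow> (complex^'n \<Rightarrow> complex) \<Rightarrow> bool" where
  const: "hpoly 0 (\<lambda>_. c)"
| coord: "hpoly (Suc 0) (\<lambda>v. v $ i)"
| add: "hpoly k p \<Longrightarrow> hpoly k q \<Longrightarrow> hpoly k (\<lambda>v. p v + q v)"
| mult: "hpoly j p \<Longrightarrow> hpoly k q \<Longrightarrow> hpoly (j + k) (\<lambda>v. p v * q v)"

text \<open>Sums of homogeneous functions, so that statements about all polynomials can be proved
  degree by degree.\<close>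

inductive polyfun :: "(complex^'n \<Rightarrow> complex) \<Rightarrow> bool" where
  hpoly: "hpoly k p \<Longrightarrow> polyfun p"
| add: "polyfun p \<Longrightarrow> polyfun q \<Longrightarrow> polyfun (\<lambda>v. p v + q v)"

lemma hpoly_zero: "hpoly k (\<lambda>_::complex^'n. 0)"
proof (induction k)
  case 0
  show ?case by (rule hpoly.const)
next
  case (Suc k)
  from hpoly.mult[OF hpoly.coord Suc] show ?case by simp
qed

lemma hpoly_cmult: "hpoly k p \<Longrightarrow> hpoly k (\<lambda>v. c * p v)"
  using hpoly.mult[OF hpoly.const[of c], of k p] by simp

lemma hpoly_sum: "(\<And>i. i \<in> A \<Longrightarrow> hpoly k (f i)) \<Longrightarrow> hpoly k (\<lambda>v. \<Sum>i\<in>A. f i v)"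
  by (induction A rule: infinite_finite_induct) (auto intro: hpoly_zero hpoly.add)

lemma polyfun_const: "polyfun (\<lambda>_. c)"
  by (rule polyfun.hpoly[OF hpoly.const])

lemma polyfun_coord: "polyfun (\<lambda>v. v $ i)"
  by (rule polyfun.hpoly[OF hpoly.coord])

lemma polyfun_mult:
  assumes "polyfun p" "polyfun q" shows "polyfun (\<lambda>v. p v * q v)"
  using assms
proof (induction p)
  case (hpoly k p)
  note p = hpoly.hyps
  from hpoly.prems show ?case
    by (induction q) (auto simp: distrib_left intro: polyfun.hpoly[OF hpoly.mult[OF p]] polyfun.add)
qed (auto simp: distrib_right intro: polyfun.add)

lemma polyfun_diff: "polyfun p \<Longrightarrow> polyfun q \<Longrightarrow> polyfun (\<lambda>v. p v - q v)"
  using polyfun.add[OF _ polyfun_mult[OF polyfun_const[of "-1"]], of p q] by simp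

lemma polyfun_sum: "(\<And>i. i \<in> A \<Longrightarrow> polyfun (f i)) \<Longrightarrow> polyfun (\<lambda>v. \<Sum>i\<in>A. f i v)"
  by (induction A rule: infinite_finite_induct) (auto intro: polyfun_const polyfun.add)

lemma polyfun_prod: "(\<And>i. i \<in> A \<Longrightarrow> polyfun (f i)) \<Longrightarrow> polyfun (\<lambda>v. \<Prod>i\<in>A. f i v)"
  by (induction A rule: infinite_finite_induct) (auto intro: polyfun_const polyfun_mult)

lemma hpoly_matrix: "hpoly k p \<Longrightarrow> hpoly k (\<lambda>v. p (A *v v))"
proof (induction rule: hpoly.induct)
  case (coord i)
  show ?case
    unfolding matrix_vector_mult_def by (simp, intro hpoly_sum hpoly_cmult hpoly.coord)
qed (auto intro: hpoly.intros)

lemma polyfun_matrix: "polyfun p \<Longrightarrow> polyfun (\<lambda>v. p (A *v v))"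
  by (induction rule: polyfun.induct) (auto intro: polyfun.intros hpoly_matrix)

text \<open>Zeros of polynomial functions are studied through restrictions to complex lines, where
  the univariate theory of \<open>poly\<close> applies.\<close>

lemma hpoly_on_line: "hpoly k p \<Longrightarrow> \<exists>P. \<forall>t. p (u + t *s v) = poly P t"
proof (induction rule: hpoly.induct)
  case (const c)
  show ?case by (rule exI[of _ "[:c:]"]) simp
next
  case (coord i)
  show ?case by (rule exI[of _ "[:u $ i, v $ i:]"]) simp
next
  case (add k p q)
  then show ?case by (metis poly_add)
next
  case (mult j p k q)
  then show ?case by (metis poly_mult)
qed

lemma polyfun_on_line: "polyfun p \<Longrightarrow> \<exists>P. \<forall>t. p (u + t *s v) = poly P t"
proof (induction rule: polyfun.induct)
  case (hpoly k p)
  then show ?case by (rule hpoly_on_line)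
next
  case (add p q)
  then show ?case by (metis poly_add)
qed

lemma continuous_on_hpoly: "hpoly k p \<Longrightarrow> continuous_on S p"
  by (induction rule: hpoly.induct) (auto intro!: continuous_intros)

lemma continuous_on_polyfun: "polyfun p \<Longrightarrow> continuous_on S p"
  by (induction rule: polyfun.induct) (auto intro: continuous_on_add continuous_on_hpoly)

text \<open>On the line through \<open>u\<close> and \<open>v\<close> both functions restrict to
  nonzero univariate polynomials, whose product is nonzero. Thus polynomial functions form an
  integral domain.\<close>

lemma polyfun_nonzero_mult:
  assumes "polyfun p" "polyfun q" "p u \<noteq> 0" "q v \<noteq> 0"
  shows "\<exists>w. p w \<noteq> 0 \<and> q w \<noteq> 0"
proof -
  obtain P where P: "\<And>t. p (u + t *s (v - u)) = poly P t"
    using polyfun_on_line[OF assms(1)] by blast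
  obtain Q where Q: "\<And>t. q (u + t *s (v - u)) = poly Q t"
    using polyfun_on_line[OF assms(2)] by blast
  have "poly P 0 \<noteq> 0" "poly Q 1 \<noteq> 0"
    using P[of 0] Q[of 1] assms(3,4) by auto
  then have "P * Q \<noteq> 0" by auto
  then obtain t where "poly (P * Q) t \<noteq> 0"
    using poly_all_0_iff_0 by blast
  then show ?thesis using P Q by (metis mult_eq_0_iff poly_mult)
qed

text \<open>The product of the functions is nonzero in an integral domain. This is the source of all
  generic choices: points with trivial stabilizer and planes in general position.\<close>

lemma polyfun_avoid:
  assumes "finite A" "\<And>i. i \<in> A \<Longrightarrow> polyfun (f i)" "\<And>i. i \<in> A \<Longrightarrow> \<exists>w. f i w \<noteq> 0"
  shows "\<exists>w. \<forall>i\<in>A. f i w \<noteq> 0"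
  using assms
proof (induction A rule: finite_induct)
  case (insert i A)
  obtain u where u: "\<forall>i\<in>A. f i u \<noteq> 0" using insert by auto
  obtain v where v: "f i v \<noteq> 0" using insert.prems(2)[of i] by blast
  have p: "polyfun (\<lambda>v. \<Prod>i\<in>A. f i v)" by (rule polyfun_prod) (simp add: insert.prems)
  have q: "polyfun (f i)" using insert by simp
  have "(\<Prod>i\<in>A. f i u) \<noteq> 0" using u insert by simp
  from polyfun_nonzero_mult[OF p q this v] show ?case
    using insert.hyps by auto
qed simp

lemma polyfun_mult_eq_0:
  assumes "polyfun p" "polyfun q" "p u \<noteq> 0" "\<And>v. p v * q v = 0"
  shows "q v = 0"
  using polyfun_nonzero_mult[OF assms(1,2,3), of v] assms(4) by auto

text \<open>Each \<open>z\<close> in \<open>F\<close> differs from \<open>y\<close> in some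
  coordinate; \<open>q\<close> is the product of the affine functions of these coordinates that take
  the value 0 at \<open>z\<close> and 1 at \<open>y\<close>.\<close>

lemma polyfun_interpolation:
  assumes "finite F" "y \<notin> F"
  shows "\<exists>q. polyfun q \<and> q y = 1 \<and> (\<forall>z\<in>F. q z = 0)"
proof -
  have "\<exists>i. z $ i \<noteq> y $ i" if "z \<in> F" for z
    using that assms(2) by (metis Finite_Cartesian_Product.vec_eq_iff)
  then obtain i where i: "\<And>z. z \<in> F \<Longrightarrow> z $ i z \<noteq> y $ i z" by metis
  let ?q = "\<lambda>v. \<Prod>z\<in>F. (v $ i z - z $ i z) * (1 / (y $ i z - z $ i z))"
  have "polyfun ?q"
    by (intro polyfun_prod polyfun_mult polyfun_diff polyfun_const polyfun_coord)
  moreover have "?q y = 1"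
    using i by (intro prod.neutral) force
  moreover have "?q z = 0" if "z \<in> F" for z
    using that assms(1) by auto
  ultimately show ?thesis by blast
qed

text \<open>Fraction-free elimination along a pivot coordinate.\<close>

lemma polyfun_linear_dependence:
  fixes u :: "'i \<Rightarrow> 'c \<Rightarrow> complex^'n \<Rightarrow> complex"
  assumes "finite C" "finite I" "card C < card I"
    and "\<And>i c. i \<in> I \<Longrightarrow> c \<in> C \<Longrightarrow> polyfun (u i c)"
  shows "\<exists>a. (\<forall>i\<in>I. polyfun (a i)) \<and> (\<exists>i\<in>I. \<exists>v. a i v \<noteq> 0) \<and>
           (\<forall>c\<in>C. \<forall>v. (\<Sum>i\<in>I. a i v * u i c v) = 0)"
  using assms
proof (induction C arbitrary: I u rule: finite_induct)
  case empty
  then have "I \<noteq> {}" by auto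
  then show ?case
    by (intro exI[of _ "\<lambda>_ _. 1"]) (auto intro: polyfun_const)
next
  case (insert c C)
  show ?case
  proof (cases "\<forall>i\<in>I. \<forall>v. u i c v = 0")
    case True
    have "\<exists>a. (\<forall>i\<in>I. polyfun (a i)) \<and> (\<exists>i\<in>I. \<exists>v. a i v \<noteq> 0) \<and>
           (\<forall>c\<in>C. \<forall>v. (\<Sum>i\<in>I. a i v * u i c v) = 0)"
      using insert by (intro insert.IH) auto
    then obtain a where a: "\<forall>i\<in>I. polyfun (a i)" "\<exists>i\<in>I. \<exists>v. a i v \<noteq> 0"
        "\<forall>c\<in>C. \<forall>v. (\<Sum>i\<in>I. a i v * u i c v) = 0" by blast
    show ?thesis using a True by (intro exI[of _ a]) auto
  next
    case False
    then obtain i0 v0 where i0: "i0 \<in> I" "u i0 c v0 \<noteq> 0" by blast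
    define I' where "I' = I - {i0}"
    have I: "I = insert i0 I'" "i0 \<notin> I'" "finite I'"
      using i0 insert.prems by (auto simp: I'_def)
    \<comment> \<open>Two by two minors: they eliminate the unknown \<open>i0\<close> from the
      remaining equations.\<close>
    define u' where "u' i d v = u i0 c v * u i d v - u i c v * u i0 d v" for i d v
    have pu: "polyfun (u i d)" if "i \<in> I" "d \<in> insert c C" for i d
      using insert.prems(3) that by blast
    have "\<exists>a. (\<forall>i\<in>I'. polyfun (a i)) \<and> (\<exists>i\<in>I'. \<exists>v. a i v \<noteq> 0) \<and>
           (\<forall>c\<in>C. \<forall>v. (\<Sum>i\<in>I'. a i v * u' i c v) = 0)"
    proof (rule insert.IH)
      show "card C < card I'" using insert.prems(2) insert.hyps I by simp
      fix i d assume "i \<in> I'" "d \<in> C"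
      then show "polyfun (u' i d)"
        unfolding u'_def using I by (intro polyfun_diff polyfun_mult pu) auto
    qed (fact I)
    then obtain a where a: "\<And>i. i \<in> I' \<Longrightarrow> polyfun (a i)" "\<exists>i\<in>I'. \<exists>v. a i v \<noteq> 0"
      "\<And>d v. d \<in> C \<Longrightarrow> (\<Sum>i\<in>I'. a i v * u' i d v) = 0" by blast
    \<comment> \<open>The other unknowns are scaled by the pivot \<open>u i0 c\<close>, so that the
      equation for \<open>c\<close> can be solved for the unknown \<open>i0\<close> without
      division.\<close>
    define b where "b i v = (if i = i0 then - (\<Sum>j\<in>I'. a j v * u j c v) else a i v * u i0 c v)" for i v
    have bI': "b i v = a i v * u i0 c v" if "i \<in> I'" for i v
      using that I by (auto simp: b_def)
    have eq: "(\<Sum>i\<in>I. b i v * u i d v) = (\<Sum>i\<in>I'. a i v * u' i d v)" for d v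
    proof -
      have "(\<Sum>i\<in>I. b i v * u i d v) =
          - (\<Sum>j\<in>I'. a j v * u j c v) * u i0 d v + (\<Sum>i\<in>I'. a i v * u i0 c v * u i d v)"
        unfolding I(1) using I by (simp add: b_def[of i0] bI' cong: sum.cong)
      also have "\<dots> = (\<Sum>i\<in>I'. a i v * u' i d v)"
        by (simp add: u'_def algebra_simps sum_subtractf sum_distrib_left sum_distrib_right)
      finally show ?thesis .
    qed
    have pb: "polyfun (b i)" if "i \<in> I" for i
    proof (cases "i = i0")
      case True
      have "polyfun (\<lambda>v. (\<Sum>j\<in>I'. a j v * u j c v))"
        using I by (intro polyfun_sum polyfun_mult a pu) auto
      from polyfun_diff[OF polyfun_const[of 0] this]
      have "polyfun (\<lambda>v. b i0 v)" by (simp add: b_def)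
      then show ?thesis by (simp add: True)
    next
      case False
      then show ?thesis
        unfolding b_def using that I a i0 by (simp add: polyfun_mult pu)
    qed
    have "\<exists>i\<in>I. \<exists>v. b i v \<noteq> 0"
    proof -
      obtain i v where i: "i \<in> I'" "a i v \<noteq> 0" using a(2) by blast
      have "\<exists>w. u i0 c w \<noteq> 0 \<and> a i w \<noteq> 0"
        by (rule polyfun_nonzero_mult[of _ _ v0 v]) (use pu i0 a i in auto)
      then show ?thesis using i I by (metis bI' insertI2 mult_eq_0_iff)
    qed
    moreover have "(\<Sum>i\<in>I. b i v * u i d v) = 0" if "d \<in> insert c C" for d v
    proof (cases "d = c")
      case True
      then show ?thesis unfolding eq by (simp add: u'_def algebra_simps)
    next
      case False
      then show ?thesis unfolding eq using a that by auto
    qed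
    ultimately show ?thesis using pb by blast
  qed
qed

section \<open>Zeros of polynomials on planes\<close>

text \<open>Otherwise, for each small nonzero \<open>s\<close>, the inverse of \<open>D\<close>
  would be holomorphic in \<open>t\<close> on a disc and bounded by its values on the boundary
  circle. That bound is uniform in \<open>s\<close>, so \<open>D\<close> would stay away from 0 at
  \<open>t = 0\<close> as \<open>s\<close> tends to 0, against \<open>D x = 0\<close>.\<close>

lemma polyfun_zero_not_isolated:
  assumes D: "polyfun D" "D x = 0" and \<delta>: "\<delta> > 0"
  shows "\<exists>s t. cmod s < \<delta> \<and> cmod t < \<delta> \<and> (s, t) \<noteq> (0, 0) \<and> D (x + s *s u + t *s v) = 0"
proof (rule ccontr)
  assume "\<not> ?thesis"
  then have nz: "\<And>s t. cmod s < \<delta> \<Longrightarrow> cmod t < \<delta> \<Longrightarrow> (s, t) \<noteq> (0, 0) \<Longrightarrow> D (x + s *s u + t *s v) \<noteq> 0"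
    by blast
  define \<epsilon> where "\<epsilon> = \<delta> / 2"
  have \<epsilon>: "0 < \<epsilon>" "\<epsilon> < \<delta>" using \<delta> by (auto simp: \<epsilon>_def)
  define d where "d s t = D (x + s *s u + t *s v)" for s t
  have contd: "continuous_on S (\<lambda>z. d (fst z) (snd z))" for S
    unfolding d_def
    unfolding vector_scalar_mult_def
    by (rule continuous_on_compose2[OF continuous_on_polyfun[OF D(1), of UNIV]])
       (intro continuous_intros, simp)
  \<comment> \<open>On the circle \<open>t\<close> is nonzero, so \<open>d\<close> has no zero on
    this compact set, even where \<open>s = 0\<close>.\<close>
  let ?K = "cball (0::complex) \<epsilon> \<times> sphere (0::complex) \<epsilon>"
  have K: "compact ?K" by (intro compact_Times compact_cball compact_sphere)
  have K': "?K \<noteq> {}" using \<epsilon> by auto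
  have "continuous_on ?K (\<lambda>z. cmod (d (fst z) (snd z)))"
    by (intro continuous_intros contd)
  from continuous_attains_inf[OF K K' this] obtain z where z: "z \<in> ?K"
      "\<And>y. y \<in> ?K \<Longrightarrow> cmod (d (fst z) (snd z)) \<le> cmod (d (fst y) (snd y))" by metis
  define m where "m = cmod (d (fst z) (snd z))"
  have m: "m > 0" using z(1) nz \<epsilon> by (force simp: m_def d_def)
  have low: "m \<le> cmod (d s 0)" if s: "s \<noteq> 0" "cmod s \<le> \<epsilon>" for s
  proof -
    obtain P where P: "\<And>t. d s t = poly P t"
      using polyfun_on_line[OF D(1), of "x + s *s u" v] by (auto simp: d_def)
    have nzP: "poly P t \<noteq> 0" if "t \<in> cball 0 \<epsilon>" for t
      using nz[of s t] s that \<epsilon> by (auto simp flip: P simp: d_def)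
    have "cmod (inverse (poly P 0)) \<le> inverse m"
    proof (rule maximum_modulus_frontier[where S = "cball 0 \<epsilon>" and f = "\<lambda>t. inverse (poly P t)"])
      show "(\<lambda>t. inverse (poly P t)) holomorphic_on interior (cball 0 \<epsilon>)"
        using nzP by (intro holomorphic_intros) (auto simp: dist_norm)
      show "continuous_on (closure (cball 0 \<epsilon>)) (\<lambda>t. inverse (poly P t))"
        using nzP by (intro continuous_intros) auto
      show "bounded (cball (0::complex) \<epsilon>)" by simp
      show "cmod (inverse (poly P t)) \<le> inverse m" if "t \<in> frontier (cball 0 \<epsilon>)" for t
        using z(2)[of "(s, t)"] that s \<epsilon> m
        by (auto simp: norm_inverse P m_def frontier_cball intro!: le_imp_inverse_le)
    qed (use \<epsilon> in auto)
    moreover have "poly P 0 \<noteq> 0" using nzP[of 0] \<epsilon> by simp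
    ultimately show ?thesis
      using m by (simp add: P norm_inverse)
  qed
  have "continuous_on UNIV (\<lambda>s. (\<lambda>z. d (fst z) (snd z)) (s, 0))"
    by (rule continuous_on_compose2[OF contd[of UNIV]]) (intro continuous_intros, simp)
  then have "continuous_on UNIV (\<lambda>s. cmod (d s 0))"
    by (intro continuous_on_norm) simp
  then have "((\<lambda>s. cmod (d s 0)) \<longlongrightarrow> cmod (d 0 0)) (at 0)"
    by (simp add: continuous_on_def)
  moreover have "\<forall>\<^sub>F s in at 0. m \<le> cmod (d s 0)"
    unfolding eventually_at
    by (rule exI[of _ \<epsilon>]) (use \<epsilon> low in \<open>auto simp: dist_norm\<close>)
  ultimately have "m \<le> cmod (d 0 0)"
    by (intro tendsto_lowerbound) auto
  then show False using m D by (simp add: d_def)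
qed

section \<open>Determinants\<close>

text \<open>The coefficients \<open>c\<close> are the signs of the permutations. In this form the
  determinant is an explicit polynomial in the entries, and its vanishing is a linear relation
  between the rows; the transpose turns the kernel criterion into one for rows.\<close>

lemma determinant_exists:
  fixes N :: nat
  obtains c :: "(nat \<Rightarrow> nat) \<Rightarrow> complex" where
    "\<And>a. (\<Sum>\<pi> | \<pi> permutes {0..<N}. c \<pi> * (\<Prod>i\<in>{0..<N}. a i (\<pi> i))) = 0 \<longleftrightarrow>
       (\<exists>l. (\<exists>i<N. l i \<noteq> 0) \<and> (\<forall>j<N. (\<Sum>i<N. l i * a i j) = 0))"
proof
  fix a :: "nat \<Rightarrow> nat \<Rightarrow> complex"
  let ?A = "Matrix.mat N N (\<lambda>(i, j). a i j)"
  have A: "?A \<in> carrier_mat N N" by simp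
  have "(\<Sum>\<pi> | \<pi> permutes {0..<N}. signof \<pi> * (\<Prod>i\<in>{0..<N}. a i (\<pi> i))) = det ?A"
    unfolding det_def'[OF A]
    by (intro sum.cong refl arg_cong2[where f = "(*)"] prod.cong) (auto dest: permutes_in_image[of _ _ i for i])
  also have "\<dots> = 0 \<longleftrightarrow> det (transpose_mat ?A) = 0"
    by (simp add: det_transpose[OF A])
  also have "\<dots> \<longleftrightarrow> (\<exists>v\<in>carrier_vec N. v \<noteq> 0\<^sub>v N \<and> transpose_mat ?A *\<^sub>v v = 0\<^sub>v N)"
    by (subst det_0_iff_vec_prod_zero) auto
  also have "\<dots> \<longleftrightarrow> (\<exists>l. (\<exists>i<N. l i \<noteq> 0) \<and> (\<forall>j<N. (\<Sum>i<N. l i * a i j) = 0))"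
  proof
    assume "\<exists>v\<in>carrier_vec N. v \<noteq> 0\<^sub>v N \<and> transpose_mat ?A *\<^sub>v v = 0\<^sub>v N"
    then obtain v where v: "v \<in> carrier_vec N" "v \<noteq> 0\<^sub>v N" "transpose_mat ?A *\<^sub>v v = 0\<^sub>v N" by blast
    have "(\<Sum>i<N. vec_index v i * a i j) = 0" if "j < N" for j
      using arg_cong[OF v(3), of "\<lambda>w. vec_index w j"] that v(1)
      by (simp add: scalar_prod_def lessThan_atLeast0 mult.commute)
    moreover have "\<exists>i<N. vec_index v i \<noteq> 0"
      using v(1,2) by (metis carrier_vecD eq_vecI index_zero_vec)
    ultimately show "\<exists>l. (\<exists>i<N. l i \<noteq> 0) \<and> (\<forall>j<N. (\<Sum>i<N. l i * a i j) = 0)" by blast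
  next
    assume "\<exists>l. (\<exists>i<N. l i \<noteq> 0) \<and> (\<forall>j<N. (\<Sum>i<N. l i * a i j) = 0)"
    then obtain l where l: "\<exists>i<N. l i \<noteq> 0" "\<forall>j<N. (\<Sum>i<N. l i * a i j) = 0" by blast
    show "\<exists>v\<in>carrier_vec N. v \<noteq> 0\<^sub>v N \<and> transpose_mat ?A *\<^sub>v v = 0\<^sub>v N"
    proof (intro bexI conjI)
      show "Matrix.vec N l \<in> carrier_vec N" by simp
      show "Matrix.vec N l \<noteq> 0\<^sub>v N" using l(1) by (metis index_vec index_zero_vec(1))
      show "transpose_mat ?A *\<^sub>v Matrix.vec N l = 0\<^sub>v N"
        using l(2) by (intro eq_vecI) (auto simp: scalar_prod_def lessThan_atLeast0 mult.commute)
    qed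
  qed
  finally show "(\<Sum>\<pi> | \<pi> permutes {0..<N}. signof \<pi> * (\<Prod>i\<in>{0..<N}. a i (\<pi> i))) = 0 \<longleftrightarrow>
       (\<exists>l. (\<exists>i<N. l i \<noteq> 0) \<and> (\<forall>j<N. (\<Sum>i<N. l i * a i j) = 0))" .
qed

section \<open>Reflections\<close>

text \<open>\<open>1 - r\<close> kills a hyperplane, so its image is spanned by one vector
  \<open>a\<close>, the image of any \<open>u0\<close> off the hyperplane. The form
  \<open>\<alpha>\<close> is the coefficient of \<open>a\<close>, read off in a coordinate where
  \<open>a\<close> does not vanish; its kernel is the reflecting hyperplane.\<close>

lemma reflection_root:
  fixes r :: "complex^'n^'n"
  assumes "reflection r"
  obtains \<alpha> a where "hpoly (Suc 0) \<alpha>" "\<And>v. v - r *v v = \<alpha> v *s a"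
    "\<And>v. r *v v = v \<longleftrightarrow> \<alpha> v = 0" "\<exists>v. \<alpha> v \<noteq> 0"
    "\<And>c v. \<alpha> (c *s v) = c * \<alpha> v" "\<And>u v. \<alpha> (u + v) = \<alpha> u + \<alpha> v"
proof -
  let ?A = "mat 1 - r"
  let ?K = "fixed_space r"
  have A: "?A *v v = v - r *v v" for v
    by (simp add: matrix_vector_mult_diff_rdistrib)
  have K: "v \<in> ?K \<longleftrightarrow> ?A *v v = 0" for v
    by (auto simp: fixed_space_def A)
  have sK: "vec.subspace ?K"
    unfolding vec.subspace_def by (auto simp: K matrix_vector_right_distrib vec.scale)
  have dimK: "vec.dim ?K = CARD('n) - 1"
    using assms by (simp add: reflection_def)
  have pos: "0 < CARD('n)" by simp
  have "?K \<noteq> UNIV"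
  proof
    assume "?K = UNIV"
    then have "vec.dim ?K = CARD('n)" by (simp only: vec_dim_card)
    with dimK pos show False by linarith
  qed
  then obtain u0 where u0: "u0 \<notin> ?K" by blast
  then have u0': "u0 \<notin> vec.span ?K"
    using sK by (simp only: vec.span_eq_iff[THEN iffD2] not_False_eq_True)
  have spK: "vec.span ?K = ?K"
    using sK by (simp only: vec.span_eq_iff)
  have "vec.dim (insert u0 ?K) = CARD('n)"
    using u0' dimK pos by (simp add: vec.dim_insert)
  then have full: "vec.span (insert u0 ?K) = UNIV"
    by (simp add: vec.dim_eq_full[symmetric] card_cart_basis vec.dimension_def)
  define a where "a = ?A *v u0"
  have "a \<noteq> 0" using u0 K by (simp add: a_def)
  then obtain i where i: "a $ i \<noteq> 0"
    by (metis Finite_Cartesian_Product.vec_eq_iff zero_index)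
  define \<alpha> where "\<alpha> v = inverse (a $ i) * (?A *v v) $ i" for v
  have eq: "?A *v v = \<alpha> v *s a" for v
  proof -
    have "v \<in> vec.span (insert u0 ?K)" using full by simp
    then obtain k where "v - k *s u0 \<in> ?K"
      unfolding vec.span_breakdown_eq spK by blast
    then have "?A *v (v - k *s u0) = 0" by (simp add: K)
    then have "?A *v v = k *s a"
      by (simp add: a_def vec.scale vec.diff)
    then show ?thesis using i by (simp add: \<alpha>_def)
  qed
  show thesis
  proof
    show "hpoly (Suc 0) \<alpha>"
      unfolding \<alpha>_def
      by (intro hpoly_cmult hpoly_matrix[OF hpoly.coord, of ?A i])
    show "v - r *v v = \<alpha> v *s a" for v using eq[of v] by (simp add: A)
    then show "r *v v = v \<longleftrightarrow> \<alpha> v = 0" for v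
      using \<open>a \<noteq> 0\<close> by (metis eq_iff_diff_eq_0 vec.scale_eq_0_iff)
    show "\<exists>v. \<alpha> v \<noteq> 0"
      using eq[of u0] u0 K by (metis vec.scale_zero_left)
    show "\<alpha> (c *s v) = c * \<alpha> v" for c v by (simp add: \<alpha>_def vec.scale)
    show "\<alpha> (u + v) = \<alpha> u + \<alpha> v" for u v
      by (simp add: \<alpha>_def matrix_vector_right_distrib distrib_left)
  qed
qed

text \<open>If the nonzero map \<open>1 - g\<close> had its image in the line of \<open>w\<close>, a
  single vector \<open>u0\<close> would complement the fixed space, which would then be a
  hyperplane.\<close>

lemma fixed_space_codim:
  fixes g :: "complex^'n^'n"
  assumes "g \<noteq> mat 1" "vec.dim (fixed_space g) \<noteq> CARD('n) - 1"
  shows "\<exists>u. \<forall>c. u - g *v u \<noteq> c *s w"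
proof (rule ccontr)
  assume "\<not> ?thesis"
  then have all: "\<exists>c. u - g *v u = c *s w" for u by blast
  let ?A = "mat 1 - g"
  let ?K = "fixed_space g"
  have A: "?A *v v = v - g *v v" for v
    by (simp add: matrix_vector_mult_diff_rdistrib)
  have K: "v \<in> ?K \<longleftrightarrow> ?A *v v = 0" for v
    by (auto simp: fixed_space_def A)
  have sK: "vec.subspace ?K"
    unfolding vec.subspace_def by (auto simp: K matrix_vector_right_distrib vec.scale)
  have "\<exists>u0. ?A *v u0 \<noteq> 0"
    using assms(1) by (metis (no_types) A eq_iff_diff_eq_0 matrix_eq matrix_vector_mul_lid)
  then obtain u0 where u0: "?A *v u0 \<noteq> 0" by blast
  obtain c0 where c0: "?A *v u0 = c0 *s w" using all[of u0] A by auto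
  then have "c0 \<noteq> 0" using u0 by auto
  have "v \<in> vec.span (insert u0 ?K)" for v
  proof -
    obtain c where c: "?A *v v = c *s w" using all[of v] A by auto
    have "?A *v (v - (c / c0) *s u0) = 0"
      using c c0 \<open>c0 \<noteq> 0\<close> by (simp add: vec.diff vec.scale)
    then show ?thesis
      unfolding vec.span_breakdown_eq by (metis K vec.span_base)
  qed
  then have "vec.span (insert u0 ?K) = UNIV" by blast
  then have "vec.dim (insert u0 ?K) = CARD('n)"
    by (metis vec.dim_span vec_dim_card)
  moreover have "u0 \<notin> vec.span ?K" using u0 by (subst vec.span_eq_iff[THEN iffD2, OF sK]) (simp add: K)
  ultimately have "vec.dim ?K + 1 = CARD('n)" by (simp add: vec.dim_insert)
  then show False using assms(2) by simp
qed

section \<open>Invariants of a finite reflection group\<close>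

locale finite_matrix_group =
  fixes W :: "(complex^'n^'n) set"
  assumes fin: "finite W"
    and one: "mat 1 \<in> W"
    and mult: "g \<in> W \<Longrightarrow> h \<in> W \<Longrightarrow> g ** h \<in> W"
    and inv: "g \<in> W \<Longrightarrow> \<exists>h\<in>W. h ** g = mat 1 \<and> g ** h = mat 1"

text \<open>Generation by reflections is stated as an induction principle with one reflection
  multiplied on the right at each step; words and inverses of generators do not appear.\<close>

locale finite_reflection_group = finite_matrix_group W for W :: "(complex^'n^'n) set" +
  assumes refl_induct: "\<And>g P. g \<in> W \<Longrightarrow> P (mat 1) \<Longrightarrow>
      (\<And>g r. g \<in> W \<Longrightarrow> P g \<Longrightarrow> r \<in> W \<Longrightarrow> reflection r \<Longrightarrow> P (g ** r)) \<Longrightarrow> P g"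
    and reflectionI: "g \<in> W \<Longrightarrow> vec.dim (fixed_space g) = CARD('n) - 1 \<Longrightarrow> reflection g"

section \<open>Invariant polynomials and the ideal generated by those of positive degree\<close>

context finite_matrix_group
begin

lemma bij_mult_right:
  assumes "g \<in> W" shows "bij_betw (\<lambda>h. h ** g) W W"
proof -
  obtain g' where g': "g' \<in> W" "g' ** g = mat 1" "g ** g' = mat 1" using inv[OF assms] by blast
  show ?thesis
    by (rule bij_betwI[where g = "\<lambda>h. h ** g'"])
       (use g' assms in \<open>auto intro: mult simp flip: matrix_mul_assoc\<close>)
qed

lemma sum_mult_right: "g \<in> W \<Longrightarrow> (\<Sum>h\<in>W. F (h ** g)) = (\<Sum>h\<in>W. F h)"
  using sum.reindex_bij_betw[OF bij_mult_right] by blast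

definition invar :: "(complex^'n \<Rightarrow> complex) \<Rightarrow> bool" where
  "invar p \<longleftrightarrow> polyfun p \<and> (\<forall>g\<in>W. \<forall>v. p (g *v v) = p v)"

lemma invar_polyfun: "invar p \<Longrightarrow> polyfun p"
  by (simp add: invar_def)

lemma invar_apply: "invar p \<Longrightarrow> g \<in> W \<Longrightarrow> p (g *v v) = p v"
  by (simp add: invar_def)

lemma invar_add: "invar p \<Longrightarrow> invar q \<Longrightarrow> invar (\<lambda>v. p v + q v)"
  by (simp add: invar_def polyfun.add)

lemma invar_mult: "invar p \<Longrightarrow> invar q \<Longrightarrow> invar (\<lambda>v. p v * q v)"
  by (simp add: invar_def polyfun_mult)

lemma invar_const: "invar (\<lambda>_. c)"
  by (simp add: invar_def polyfun_const)

lemma invar_orbit_sum: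
  assumes "polyfun p" shows "invar (\<lambda>v. \<Sum>h\<in>W. p (h *v v))"
  unfolding invar_def
proof (intro conjI ballI allI)
  show "polyfun (\<lambda>v. \<Sum>h\<in>W. p (h *v v))" by (intro polyfun_sum polyfun_matrix assms)
  show "(\<Sum>h\<in>W. p (h *v (g *v v))) = (\<Sum>h\<in>W. p (h *v v))" if "g \<in> W" for g v
    using sum_mult_right[OF that, of "\<lambda>h. p (h *v v)"] by (simp add: matrix_vector_mul_assoc)
qed

text \<open>The degree \<open>k\<close> part of the ideal generated by the invariants of positive degree.\<close>

inductive inI :: "nat \<Rightarrow> (complex^'n \<Rightarrow> complex) \<Rightarrow> bool" where
  zero: "inI k (\<lambda>_. 0)"
| gen: "invar g \<Longrightarrow> hpoly a g \<Longrightarrow> 1 \<le> a \<Longrightarrow> hpoly b q \<Longrightarrow> inI (a + b) (\<lambda>v. g v * q v)"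
| add: "inI k p \<Longrightarrow> inI k q \<Longrightarrow> inI k (\<lambda>v. p v + q v)"

lemma inI_hpoly_mult: "inI k f \<Longrightarrow> hpoly j h \<Longrightarrow> inI (j + k) (\<lambda>v. h v * f v)"
proof (induction rule: inI.induct)
  case (zero k)
  then show ?case using inI.zero by simp
next
  case (gen g a b q)
  from inI.gen[OF gen(1,2,3) hpoly.mult[OF gen.prems gen(4)]]
  show ?case by (simp only: add.left_commute mult.left_commute)
next
  case (add k p q)
  from inI.add[OF add.IH(1)[OF add.prems] add.IH(2)[OF add.prems]]
  show ?case by (simp only: distrib_left)
qed

lemma inI_cmult: "inI k f \<Longrightarrow> inI k (\<lambda>v. c * f v)"
  using inI_hpoly_mult[OF _ hpoly.const[of c], of k f] by simp

lemma inI_sum: "(\<And>i. i \<in> A \<Longrightarrow> inI k (f i)) \<Longrightarrow> inI k (\<lambda>v. \<Sum>i\<in>A. f i v)"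
  by (induction A rule: infinite_finite_induct) (auto intro: inI.zero inI.add)

lemma inI_matrix: "inI k f \<Longrightarrow> A \<in> W \<Longrightarrow> inI k (\<lambda>v. f (A *v v))"
proof (induction rule: inI.induct)
  case (gen g a b q)
  from inI.gen[OF gen(1,2,3) hpoly_matrix[OF gen(4), of A]] gen.prems
  show ?case by (simp add: invar_apply[OF gen(1)])
qed (auto intro: inI.zero inI.add)

lemma inI_invar: "invar f \<Longrightarrow> hpoly k f \<Longrightarrow> 1 \<le> k \<Longrightarrow> inI k f"
  using inI.gen[of f k 0 "\<lambda>_. 1", OF _ _ _ hpoly.const] by simp

end

text \<open>The difference vanishes on the reflecting hyperplane, hence is divisible by the root
  \<open>\<alpha>\<close>; the quotient is built by a twisted Leibniz rule and has degree one less.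
  The clause for \<open>k = 0\<close> compensates for the truncated subtraction in
  \<open>k - 1\<close>: constants have divided difference 0.\<close>

lemma hpoly_divided_difference:
  fixes r :: "complex^'n^'n"
  assumes r: "\<And>v. v - r *v v = \<alpha> v *s a" and p: "hpoly k p"
  shows "\<exists>q. (\<forall>v. p v - p (r *v v) = \<alpha> v * q v) \<and> (\<forall>v. k = 0 \<longrightarrow> q v = 0) \<and> hpoly (k - 1) q"
  using p
proof (induction rule: hpoly.induct)
  case (const c)
  show ?case by (intro exI[of _ "\<lambda>_. 0"]) (simp add: hpoly_zero)
next
  case (coord i)
  have "v $ i - (r *v v) $ i = \<alpha> v * a $ i" for v
    using arg_cong[OF r[of v], of "\<lambda>w. w $ i"] by simp
  then show ?case by (intro exI[of _ "\<lambda>_. a $ i"]) (simp add: hpoly.const)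
next
  case (add k p q)
  then obtain p' q' where p':
    "\<And>v. p v - p (r *v v) = \<alpha> v * p' v" "\<And>v. k = 0 \<longrightarrow> p' v = 0" "hpoly (k - 1) p'" and q':
    "\<And>v. q v - q (r *v v) = \<alpha> v * q' v" "\<And>v. k = 0 \<longrightarrow> q' v = 0" "hpoly (k - 1) q'" by blast
  have "p v + q v - (p (r *v v) + q (r *v v)) = \<alpha> v * (p' v + q' v)" for v
    by (simp only: add_diff_add p'(1) q'(1) distrib_left)
  then show ?case
    using p'(2) q'(2) hpoly.add[OF p'(3) q'(3)] by (intro exI[of _ "\<lambda>v. p' v + q' v"]) simp
next
  case (mult j p k q)
  then obtain p' q' where p':
    "\<And>v. p v - p (r *v v) = \<alpha> v * p' v" "\<And>v. j = 0 \<longrightarrow> p' v = 0" "hpoly (j - 1) p'" and q':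
    "\<And>v. q v - q (r *v v) = \<alpha> v * q' v" "\<And>v. k = 0 \<longrightarrow> q' v = 0" "hpoly (k - 1) q'" by blast
  have "hpoly (j + k - 1) (\<lambda>v. p' v * q v)"
  proof (cases "j = 0")
    case True
    then show ?thesis using p'(2) hpoly_zero by simp
  next
    case False
    then have "j + k - 1 = j - 1 + k" by simp
    then show ?thesis using hpoly.mult[OF p'(3) mult(2)] by metis
  qed
  moreover have "hpoly (j + k - 1) (\<lambda>v. p (r *v v) * q' v)"
  proof (cases "k = 0")
    case True
    then show ?thesis using q'(2) hpoly_zero by simp
  next
    case False
    then have "j + k - 1 = j + (k - 1)" by simp
    then show ?thesis using hpoly.mult[OF hpoly_matrix[OF mult(1)] q'(3)] by metis
  qed
  moreover have "p v * q v - p (r *v v) * q (r *v v) = \<alpha> v * (p' v * q v + p (r *v v) * q' v)" for v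
  proof -
    have "p v * q v - p (r *v v) * q (r *v v) =
        (p v - p (r *v v)) * q v + p (r *v v) * (q v - q (r *v v))" by (simp add: algebra_simps)
    then show ?thesis by (simp only: p'(1) q'(1) distrib_left ac_simps)
  qed
  ultimately show ?case
    using p'(2) q'(2)
    by (intro exI[of _ "\<lambda>v. p' v * q v + p (r *v v) * q' v"]) (simp add: hpoly.add)
qed

section \<open>Generators of the polynomials over the invariants\<close>

context finite_reflection_group
begin

text \<open>Chevalley's argument. Evaluating the coefficients of the terms of top degree at a point
  yields numbers that annihilate all iterated divided differences of top order.\<close>

lemma relation_top_degree:
  assumes "finite J" "\<And>j. j \<in> J \<Longrightarrow> hpoly (e j) (p j)" "\<And>j. j \<in> J \<Longrightarrow> e j \<le> k"
    and "\<And>j. j \<in> J \<Longrightarrow> invar (g j)" "\<And>v. (\<Sum>j\<in>J. g j v * p j v) = 0"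
  shows "inI k (\<lambda>v. \<Sum>j | j \<in> J \<and> e j = k. g j y * p j v)"
  using assms
proof (induction k arbitrary: J e p)
  case 0
  have "{j. j \<in> J \<and> e j = 0} = J" using 0(3) by auto
  moreover have "\<exists>c. p j = (\<lambda>_. c)" if "j \<in> J" for j
  proof -
    have "hpoly 0 f \<Longrightarrow> \<exists>c. f = (\<lambda>_. c)" for f :: "complex^'n \<Rightarrow> complex"
      by (induction "0::nat" f rule: hpoly.induct) auto
    then show ?thesis using 0(2)[OF that] 0(3)[OF that] by simp
  qed
  then have const: "p j v = p j y" if "j \<in> J" for j v using that by fastforce
  have "(\<Sum>j\<in>J. g j y * p j v) = (\<Sum>j\<in>J. g j y * p j y)" for v
    by (intro sum.cong refl) (metis const)
  then have "(\<Sum>j\<in>J. g j y * p j v) = 0" for v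
    by (simp only: 0(5))
  ultimately show ?case using inI.zero by simp
next
  case (Suc k)
  let ?f = "\<lambda>v. \<Sum>j | j \<in> J \<and> e j = Suc k. g j y * p j v"
  have hf: "hpoly (Suc k) ?f"
    using Suc.prems(2) by (intro hpoly_sum hpoly_cmult) force
  have refl: "inI (Suc k) (\<lambda>v. ?f v - ?f (r *v v))" if r: "r \<in> W" "reflection r" for r
  proof -
    obtain \<alpha> a where \<alpha>: "hpoly (Suc 0) \<alpha>" "\<And>v. v - r *v v = \<alpha> v *s a" "\<exists>v. \<alpha> v \<noteq> 0"
      using reflection_root[OF r(2)] by metis
    have "\<forall>j\<in>J. \<exists>q. (\<forall>v. p j v - p j (r *v v) = \<alpha> v * q v) \<and> (\<forall>v. e j = 0 \<longrightarrow> q v = 0) \<and> hpoly (e j - 1) q"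
      using hpoly_divided_difference[OF \<alpha>(2)] Suc.prems(2) by blast
    then obtain q where q: "\<And>j v. j \<in> J \<Longrightarrow> p j v - p j (r *v v) = \<alpha> v * q j v"
      "\<And>j v. j \<in> J \<Longrightarrow> e j = 0 \<Longrightarrow> q j v = 0" "\<And>j. j \<in> J \<Longrightarrow> hpoly (e j - 1) (q j)" by metis
    \<comment> \<open>The invariant coefficients pass through the difference operator, so the
      relation between the \<open>p j\<close> yields one between their divided differences,
      multiplied by \<open>\<alpha>\<close>. Cancelling \<open>\<alpha>\<close> gives a relation in
      lower degrees.\<close>
    have "\<alpha> v * (\<Sum>j\<in>J. g j v * q j v) = 0" for v
    proof -
      have "\<alpha> v * (\<Sum>j\<in>J. g j v * q j v) = (\<Sum>j\<in>J. g j v * (p j v - p j (r *v v)))"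
        by (simp add: sum_distrib_left q(1) mult.left_commute cong: sum.cong)
      also have "\<dots> = (\<Sum>j\<in>J. g j v * p j v) - (\<Sum>j\<in>J. g j (r *v v) * p j (r *v v))"
        by (simp add: right_diff_distrib sum_subtractf invar_apply[OF Suc.prems(4) r(1)] cong: sum.cong)
      also have "\<dots> = 0" by (simp only: Suc.prems(5)) simp
      finally show ?thesis .
    qed
    moreover have "polyfun (\<lambda>v. \<Sum>j\<in>J. g j v * q j v)"
      using q(3) Suc.prems(4) by (intro polyfun_sum polyfun_mult) (auto intro: polyfun.hpoly invar_polyfun)
    ultimately have rel: "(\<Sum>j\<in>J. g j v * q j v) = 0" for v
      using polyfun_mult_eq_0[OF polyfun.hpoly[OF \<alpha>(1)]] \<alpha>(3) by blast
    \<comment> \<open>Terms of degree 0 have divided difference 0 and are dropped; on the others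
      \<open>e j - 1\<close> is a genuine decrement.\<close>
    let ?J = "{j \<in> J. 1 \<le> e j}"
    have "inI k (\<lambda>v. \<Sum>j | j \<in> ?J \<and> e j - 1 = k. g j y * q j v)"
    proof (rule Suc.IH)
      fix v
      have "(\<Sum>j\<in>?J. g j v * q j v) = (\<Sum>j\<in>J. g j v * q j v)"
        using Suc.prems(1) q(2) by (intro sum.mono_neutral_left) (auto simp: not_less_eq_eq)
      then show "(\<Sum>j\<in>?J. g j v * q j v) = 0" using rel by simp
    qed (use Suc.prems q in \<open>auto simp: le_diff_conv\<close>)
    from inI_hpoly_mult[OF this \<alpha>(1)]
    have "inI (Suc k) (\<lambda>v. \<alpha> v * (\<Sum>j | j \<in> ?J \<and> e j - 1 = k. g j y * q j v))" by simp
    moreover have "{j. j \<in> ?J \<and> e j - 1 = k} = {j. j \<in> J \<and> e j = Suc k}" by auto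
    moreover have "\<alpha> v * (\<Sum>j | j \<in> J \<and> e j = Suc k. g j y * q j v) = ?f v - ?f (r *v v)" for v
      unfolding sum_subtractf[symmetric] sum_distrib_left
    proof (intro sum.cong refl)
      fix j assume "j \<in> {j. j \<in> J \<and> e j = Suc k}"
      then have "g j y * (p j v - p j (r *v v)) = g j y * (\<alpha> v * q j v)" using q(1) by simp
      then show "\<alpha> v * (g j y * q j v) = g j y * p j v - g j y * p j (r *v v)"
        by (simp add: right_diff_distrib mult.left_commute)
    qed
    ultimately show ?thesis by simp
  qed
  \<comment> \<open>The difference for \<open>w ** r\<close> is the difference for \<open>w\<close>,
    taken at \<open>r *v v\<close>, plus the difference for \<open>r\<close>; the ideal is stable
    under \<open>W\<close>.\<close>
  have all: "inI (Suc k) (\<lambda>v. ?f v - ?f (w *v v))" if "w \<in> W" for w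
    using that
  proof (rule refl_induct)
    show "inI (Suc k) (\<lambda>v. ?f v - ?f (mat 1 *v v))" using inI.zero by simp
    fix w r assume w: "w \<in> W" "inI (Suc k) (\<lambda>v. ?f v - ?f (w *v v))" and r: "r \<in> W" "reflection r"
    from inI.add[OF inI_matrix[OF w(2) r(1)] refl[OF r]]
    show "inI (Suc k) (\<lambda>v. ?f v - ?f ((w ** r) *v v))"
      by (simp add: matrix_vector_mul_assoc)
  qed
  let ?n = "of_nat (card W) :: complex"
  have n: "?n \<noteq> 0" using fin one by auto
  \<comment> \<open>The orbit sum is an invariant of positive degree, so it lies in the ideal.
    Adding all differences from \<open>all\<close> leaves \<open>card W\<close> times
    \<open>?f\<close>.\<close>
  have "inI (Suc k) (\<lambda>v. \<Sum>w\<in>W. ?f (w *v v))"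
  proof (rule inI_invar)
    show "invar (\<lambda>v. \<Sum>w\<in>W. ?f (w *v v))"
      using invar_orbit_sum[OF polyfun.hpoly[OF hf]] .
    show "hpoly (Suc k) (\<lambda>v. \<Sum>w\<in>W. ?f (w *v v))"
      by (rule hpoly_sum) (rule hpoly_matrix[OF hf])
  qed simp
  from inI.add[OF inI_sum[of W "Suc k" "\<lambda>w v. ?f v - ?f (w *v v)", OF all] this]
  have "inI (Suc k) (\<lambda>v. (\<Sum>w\<in>W. ?f v - ?f (w *v v)) + (\<Sum>w\<in>W. ?f (w *v v)))" .
  then have "inI (Suc k) (\<lambda>v. ?n * ?f v)" by (simp add: sum_subtractf)
  from inI_cmult[OF this, of "1 / ?n"] show ?case using n by simp
qed

text \<open>The classes of the \<open>p j\<close> are linearly independent in the coinvariant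
  algebra, that is, modulo the ideal of \<open>inI\<close>. As the ideal is graded, each degree is
  tested separately.\<close>

definition indep :: "nat \<Rightarrow> (nat \<Rightarrow> nat) \<Rightarrow> (nat \<Rightarrow> complex^'n \<Rightarrow> complex) \<Rightarrow> bool" where
  "indep m e p \<longleftrightarrow> (\<forall>j<m. hpoly (e j) (p j)) \<and>
     (\<forall>k b. inI k (\<lambda>v. \<Sum>j | j < m \<and> e j = k. b j * p j v) \<longrightarrow> (\<forall>j<m. e j = k \<longrightarrow> b j = 0))"

lemma not_indepE:
  assumes "\<not> indep m e p" "\<And>j. j < m \<Longrightarrow> hpoly (e j) (p j)"
  obtains k b i where "inI k (\<lambda>v. \<Sum>j | j < m \<and> e j = k. b j * p j v)"
    "i < m" "e i = k" "b i \<noteq> 0"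
proof (rule ccontr)
  assume no: "\<not> thesis"
  have "indep m e p"
    unfolding indep_def
  proof (intro conjI allI impI)
    fix k b i
    assume "inI k (\<lambda>v. \<Sum>j | j < m \<and> e j = k. b j * p j v)" "i < m" "e i = k"
    then show "b i = 0" using no that[of k b i] by blast
  qed (rule assms(2))
  with assms(1) show False ..
qed

text \<open>Among the indices with nonzero coefficient function, keep those of top degree and
  evaluate their coefficients at a point \<open>y\<close> where one of them is nonzero. By
  \<open>relation_top_degree\<close> this is a relation modulo the ideal with constant coefficients,
  and \<open>indep\<close> forces these to be 0.\<close>

lemma indep_over_invariants:
  assumes ind: "indep m e p" and g: "\<And>j. j < m \<Longrightarrow> invar (g j)"
    and rel: "\<And>v. (\<Sum>j<m. g j v * p j v) = 0" and "j < m"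
  shows "g j v = 0"
proof (rule ccontr)
  assume "g j v \<noteq> 0"
  define J where "J = {j. j < m \<and> (\<exists>v. g j v \<noteq> 0)}"
  have J: "finite J" "j \<in> J" using \<open>g j v \<noteq> 0\<close> \<open>j < m\<close> by (auto simp: J_def)
  define k where "k = Max (e ` J)"
  have "k \<in> e ` J" unfolding k_def using J by (intro Max_in) auto
  then obtain i where i: "i \<in> J" "e i = k" by blast
  then obtain y where y: "g i y \<noteq> 0" by (auto simp: J_def)
  define b where "b j = (if j \<in> J then g j y else 0)" for j
  have "inI k (\<lambda>v. \<Sum>j | j \<in> J \<and> e j = k. g j y * p j v)"
  proof (rule relation_top_degree)
    show "e j \<le> k" if "j \<in> J" for j
      unfolding k_def using that J by (intro Max_ge) auto
    show "(\<Sum>j\<in>J. g j v * p j v) = 0" for v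
    proof -
      have "(\<Sum>j\<in>J. g j v * p j v) = (\<Sum>j<m. g j v * p j v)"
        by (intro sum.mono_neutral_left) (auto simp: J_def)
      then show ?thesis using rel by simp
    qed
  qed (use J g ind in \<open>auto simp: J_def indep_def\<close>)
  moreover have "(\<Sum>j | j \<in> J \<and> e j = k. g j y * p j v) = (\<Sum>j | j < m \<and> e j = k. b j * p j v)" for v
    by (rule sum.mono_neutral_cong_left) (auto simp: J_def b_def)
  ultimately have "\<forall>j<m. e j = k \<longrightarrow> b j = 0"
    using ind by (simp add: indep_def)
  then have "b i = 0" using i by (auto simp: J_def)
  then show False using i y by (simp add: b_def)
qed

lemma exists_free_point:
  assumes "polyfun a" "a v \<noteq> 0"
  shows "\<exists>y. a y \<noteq> 0 \<and> (\<forall>w\<in>W. w \<noteq> mat 1 \<longrightarrow> w *v y \<noteq> y)"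
proof -
  have "\<exists>i v. (w *v v) $ i - v $ i \<noteq> 0" if "w \<noteq> mat 1" for w :: "complex^'n^'n"
    using that by (metis Finite_Cartesian_Product.vec_eq_iff eq_iff_diff_eq_0 matrix_eq matrix_vector_mul_lid)
  then obtain i where i: "\<And>w::complex^'n^'n. w \<noteq> mat 1 \<Longrightarrow> \<exists>v. (w *v v) $ i w - v $ i w \<noteq> 0"
    by metis
  \<comment> \<open>For the identity the difference would be the zero function; \<open>a\<close>
    takes its place, so one generic choice meets both demands.\<close>
  let ?f = "\<lambda>w v. if w = mat 1 then a v else (w *v v) $ i w - v $ i w"
  have "\<exists>y. \<forall>w\<in>W. ?f w y \<noteq> 0"
  proof (rule polyfun_avoid[OF fin])
    show "polyfun (?f w)" if "w \<in> W" for w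
      using assms(1) polyfun_diff[OF polyfun_matrix[OF polyfun_coord] polyfun_coord]
      by (cases "w = mat 1") auto
    show "\<exists>v. ?f w v \<noteq> 0" if "w \<in> W" for w
      using assms(2) i[of w] by (cases "w = mat 1") auto
  qed
  then obtain y where "\<forall>w\<in>W. ?f w y \<noteq> 0" by blast
  then have "a y \<noteq> 0" "\<forall>w\<in>W. w \<noteq> mat 1 \<longrightarrow> w *v y \<noteq> y"
    using one by (auto split: if_splits)
  then show ?thesis by blast
qed

text \<open>With more than \<open>card W\<close> functions there is a relation, with polynomial
  coefficients, that holds simultaneously at all translates. Multiplied by a function
  \<open>q\<close> that singles out one point of a free orbit and summed over the orbit, it gets
  invariant coefficients and remains nontrivial at \<open>y\<close>.\<close>

lemma indep_bound:
  assumes ind: "indep m e p" shows "m \<le> card W"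
proof (rule ccontr)
  assume "\<not> m \<le> card W"
  then have "card W < card {..<m}" by simp
  moreover have hp: "hpoly (e j) (p j)" if "j < m" for j using ind that by (simp add: indep_def)
  ultimately have "\<exists>a. (\<forall>i\<in>{..<m}. polyfun (a i)) \<and> (\<exists>i\<in>{..<m}. \<exists>v. a i v \<noteq> 0) \<and>
           (\<forall>w\<in>W. \<forall>v. (\<Sum>i<m. a i v * p i (w *v v)) = 0)"
    by (intro polyfun_linear_dependence[OF fin, of "{..<m}" "\<lambda>i w v. p i (w *v v)"])
       (auto intro: polyfun_matrix polyfun.hpoly)
  then obtain a i v where a: "\<And>i. i < m \<Longrightarrow> polyfun (a i)" and i: "i < m" "a i v \<noteq> 0"
      and rel: "\<And>w v. w \<in> W \<Longrightarrow> (\<Sum>i<m. a i v * p i (w *v v)) = 0" by blast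
  obtain y where y: "a i y \<noteq> 0" "\<And>w. w \<in> W \<Longrightarrow> w \<noteq> mat 1 \<Longrightarrow> w *v y \<noteq> y"
    using exists_free_point[OF a[OF i(1)] i(2)] by blast
  have "y \<notin> (\<lambda>w. w *v y) ` (W - {mat 1})"
  proof
    assume "y \<in> (\<lambda>w. w *v y) ` (W - {mat 1})"
    then obtain w where "w \<in> W" "w \<noteq> mat 1" "w *v y = y" by force
    with y(2) show False by blast
  qed
  from polyfun_interpolation[OF finite_imageI[OF finite_Diff[OF fin]] this]
  obtain q where q: "polyfun q" "q y = 1" "\<And>w. w \<in> W \<Longrightarrow> w \<noteq> mat 1 \<Longrightarrow> q (w *v y) = 0" by auto
  define c where "c j v = (\<Sum>h\<in>W. q (h *v v) * a j (h *v v))" for j v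
  have "c i y = 0"
  proof (rule indep_over_invariants[OF ind _ _ i(1)])
    show "invar (c j)" if "j < m" for j
      unfolding c_def using polyfun_mult[OF q(1) a[OF that]] by (rule invar_orbit_sum)
    show "(\<Sum>j<m. c j v * p j v) = 0" for v
    proof -
      have "(\<Sum>j<m. c j v * p j v) = (\<Sum>h\<in>W. q (h *v v) * (\<Sum>j<m. a j (h *v v) * p j v))"
        unfolding c_def sum_distrib_left sum_distrib_right
        by (subst sum.swap) (simp add: mult.assoc)
      also have "\<dots> = 0"
      proof (intro sum.neutral ballI)
        \<comment> \<open>Taken at the point \<open>h *v v\<close> and for the inverse of
          \<open>h\<close>, the relation \<open>rel\<close> involves exactly the values
          \<open>p j v\<close>.\<close>
        fix h assume "h \<in> W"
        then obtain h' where h': "h' \<in> W" "h' ** h = mat 1" using inv by blast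
        have "p j (h' *v (h *v v)) = p j v" for j
          by (simp add: matrix_vector_mul_assoc h')
        then show "q (h *v v) * (\<Sum>j<m. a j (h *v v) * p j v) = 0"
          using rel[OF h'(1), of "h *v v"] by simp
      qed
      finally show ?thesis .
    qed
  qed
  moreover have "c i y = q (mat 1 *v y) * a i (mat 1 *v y)"
    unfolding c_def by (subst sum.remove[OF fin one]) (auto intro!: sum.neutral simp: q(3))
  ultimately show False using y(1) q(2) by simp
qed

text \<open>By \<open>indep_bound\<close> there is an independent family of maximal size, and it
  generates, as in the graded Nakayama lemma: modulo the ideal every homogeneous \<open>f\<close> is
  a combination of the \<open>p j\<close>, and elements of the ideal are sums of invariants of
  positive degree times polynomials of smaller degree.\<close>

lemma polyfun_generated:
  obtains m p where "m \<le> card W" "\<And>j. j < m \<Longrightarrow> polyfun (p j)"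
    "\<And>f. polyfun f \<Longrightarrow> \<exists>c. (\<forall>j<m. invar (c j)) \<and> (\<forall>v. f v = (\<Sum>j<m. c j v * p j v))"
proof -
  have "indep 0 (\<lambda>_. 0) (\<lambda>_ _. 0)" by (simp add: indep_def)
  then obtain m where m: "\<exists>e p. indep m e p" and max: "\<And>m'. \<exists>e p. indep m' e p \<Longrightarrow> m' \<le> m"
    using ex_has_greatest_nat[of "\<lambda>m. \<exists>e p. indep m e p" 0 id "card W + 1"] indep_bound
    by (force simp: less_Suc_eq_le)
  then obtain e p where ind: "indep m e p" by blast
  have hp: "hpoly (e j) (p j)" if "j < m" for j using ind that by (simp add: indep_def)
  define gen where "gen f \<longleftrightarrow> (\<exists>c. (\<forall>j<m. invar (c j)) \<and> (\<forall>v. f v = (\<Sum>j<m. c j v * p j v)))" for f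
  have gen_add: "gen (\<lambda>v. f v + f' v)" if f: "gen f" and f': "gen f'" for f f'
  proof -
    obtain c where "\<forall>j<m. invar (c j)" "\<forall>v. f v = (\<Sum>j<m. c j v * p j v)"
      using f unfolding gen_def by blast
    moreover obtain c' where "\<forall>j<m. invar (c' j)" "\<forall>v. f' v = (\<Sum>j<m. c' j v * p j v)"
      using f' unfolding gen_def by blast
    ultimately show ?thesis
      unfolding gen_def
      by (intro exI[of _ "\<lambda>j v. c j v + c' j v"]) (auto simp: sum.distrib distrib_right intro: invar_add)
  qed
  have gen_mult: "gen (\<lambda>v. g v * f v)" if f: "gen f" and g: "invar g" for f g
  proof -
    obtain c where "\<forall>j<m. invar (c j)" "\<forall>v. f v = (\<Sum>j<m. c j v * p j v)"
      using f unfolding gen_def by blast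
    then show ?thesis
      unfolding gen_def using g
      by (intro exI[of _ "\<lambda>j v. g v * c j v"]) (auto simp: sum_distrib_left mult.assoc intro: invar_mult)
  qed
  have gen_0: "gen (\<lambda>_. 0)"
    unfolding gen_def by (intro exI[of _ "\<lambda>_ _. 0"]) (simp add: invar_const)
  have gen_p: "gen (p j)" if "j < m" for j
    unfolding gen_def
  proof (intro exI conjI allI impI)
    fix i v
    show "invar ((\<lambda>i v. if i = j then 1 else 0) i)" by (simp add: invar_const)
    have "(\<Sum>i<m. (if i = j then 1 else 0) * p i v) = (\<Sum>i<m. if i = j then p i v else 0)"
      by (intro sum.cong) auto
    then show "p j v = (\<Sum>i<m. (if i = j then 1 else 0) * p i v)" using that by simp
  qed
  have gen_sum: "gen (\<lambda>v. \<Sum>i\<in>A. f i v)" if "\<And>i. i \<in> A \<Longrightarrow> gen (f i)" for A :: "nat set" and f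
    using that by (induction A rule: infinite_finite_induct) (auto intro: gen_0 gen_add)
  have gen_hpoly: "gen f" if "hpoly k f" for k f
    using that
  proof (induction k arbitrary: f rule: less_induct)
    case (less k)
    have gen_I: "gen h" if "inI k h" for h
      using that less.IH
    proof (induction rule: inI.induct)
      case (gen g a b q)
      then have "gen q" using gen.prems(1)[of b q] by simp
      with gen show ?case by (intro gen_mult) auto
    qed (auto intro: gen_0 gen_add)
    \<comment> \<open>Appending \<open>f\<close> to a maximal family destroys independence, and the
      resulting relation must involve \<open>f\<close>, as it would otherwise be a relation between
      the \<open>p j\<close> alone.\<close>
    let ?e = "e(m := k)" and ?p = "p(m := f)"
    have "\<not> indep (Suc m) ?e ?p" using max[of "Suc m"] by auto
    moreover have "hpoly (?e j) (?p j)" if "j < Suc m" for j using hp less.prems that by auto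
    ultimately obtain k' b i where
      I: "inI k' (\<lambda>v. \<Sum>j | j < Suc m \<and> ?e j = k'. b j * ?p j v)"
      and i: "i < Suc m" "?e i = k'" "b i \<noteq> 0"
      by (rule not_indepE)
    have kk: "k' = k \<and> b m \<noteq> 0"
    proof (rule ccontr)
      assume no: "\<not> (k' = k \<and> b m \<noteq> 0)"
      have "(\<Sum>j | j < Suc m \<and> ?e j = k'. b j * ?p j v) = (\<Sum>j | j < m \<and> e j = k'. b j * p j v)" for v
        using no by (intro sum.mono_neutral_cong_right) (auto simp: less_Suc_eq)
      with I ind have "\<forall>j<m. e j = k' \<longrightarrow> b j = 0" by (simp add: indep_def)
      with i no show False by (auto simp: less_Suc_eq split: if_splits)
    qed
    have "(\<Sum>j | j < Suc m \<and> ?e j = k'. b j * ?p j v) = b m * f v + (\<Sum>j | j < m \<and> e j = k. b j * p j v)" for v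
    proof -
      have "{j. j < Suc m \<and> ?e j = k'} = insert m {j. j < m \<and> e j = k}" using kk by auto
      then show ?thesis by (auto intro!: sum.cong)
    qed
    with I kk have "inI k (\<lambda>v. b m * f v + (\<Sum>j | j < m \<and> e j = k. b j * p j v))" by simp
    then have "gen (\<lambda>v. b m * f v + (\<Sum>j | j < m \<and> e j = k. b j * p j v))" by (rule gen_I)
    moreover have "gen (\<lambda>v. (-1) * (\<Sum>j | j < m \<and> e j = k. b j * p j v))"
      by (intro gen_mult gen_sum gen_p invar_const) auto
    ultimately have "gen (\<lambda>v. b m * f v + (\<Sum>j | j < m \<and> e j = k. b j * p j v)
        + (-1) * (\<Sum>j | j < m \<and> e j = k. b j * p j v))" by (rule gen_add)
    then have "gen (\<lambda>v. b m * f v)" by simp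
    from gen_mult[OF this invar_const[of "1 / b m"]] show ?case using kk by simp
  qed
  have "gen f" if "polyfun f" for f
    using that by (induction rule: polyfun.induct) (auto intro: gen_hpoly gen_add)
  with hp show thesis
    by (intro that[of m p]) (auto simp: gen_def intro: polyfun.hpoly indep_bound[OF ind])
qed

end

section \<open>Points off the hyperplanes have trivial stabilizer\<close>

context finite_reflection_group
begin

text \<open>The polynomial is the determinant of the values of generators over the invariants along an
  orbit.\<close>

lemma discriminant_exists:
  obtains D where "polyfun D" "\<And>y. D y = 0 \<longleftrightarrow> (\<exists>g\<in>W. g \<noteq> mat 1 \<and> g *v y = y)"
proof -
  obtain m p where m: "m \<le> card W" and p: "\<And>j. j < m \<Longrightarrow> polyfun (p j)"
    and gen: "\<And>f. polyfun f \<Longrightarrow> \<exists>c. (\<forall>j<m. invar (c j)) \<and> (\<forall>v. f v = (\<Sum>j<m. c j v * p j v))"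
    by (rule polyfun_generated) (rule that)
  define N where "N = card W"
  obtain w where w: "bij_betw w {0..<N} W"
    using ex_bij_betw_nat_finite[OF fin] N_def by blast
  have wW: "w i \<in> W" if "i < N" for i using w that by (auto simp: bij_betw_def)
  have w_inj: "w i = w j \<Longrightarrow> i = j" if "i < N" "j < N" for i j
    using w that by (auto simp: bij_betw_def inj_on_def)
  have w_surj: "\<exists>i<N. w i = g" if "g \<in> W" for g
    using w that by (auto simp: bij_betw_def image_iff)
  \<comment> \<open>Zero functions pad the family to \<open>N\<close> columns, so that the matrix is
    square whatever \<open>m\<close> is.\<close>
  define P where "P j = (if j < m then p j else (\<lambda>_. 0))" for j
  have P: "polyfun (P j)" for j using p by (simp add: P_def polyfun_const)
  obtain c where c: "\<And>a. (\<Sum>\<pi> | \<pi> permutes {0..<N}. c \<pi> * (\<Prod>i\<in>{0..<N}. a i (\<pi> i))) = 0 \<longleftrightarrow>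
       (\<exists>l. (\<exists>i<N. l i \<noteq> 0) \<and> (\<forall>j<N. (\<Sum>i<N. l i * a i j) = (0::complex)))"
    by (rule determinant_exists) (rule that)
  define D where "D y = (\<Sum>\<pi> | \<pi> permutes {0..<N}. c \<pi> * (\<Prod>i\<in>{0..<N}. P (\<pi> i) (w i *v y)))" for y
  have D0: "D y = 0 \<longleftrightarrow> (\<exists>l. (\<exists>i<N. l i \<noteq> 0) \<and> (\<forall>j<N. (\<Sum>i<N. l i * P j (w i *v y)) = 0))" for y
    unfolding D_def using c[of "\<lambda>i j. P j (w i *v y)"] by simp
  show thesis
  proof
    show "polyfun D"
      unfolding D_def by (intro polyfun_sum polyfun_mult polyfun_const polyfun_prod polyfun_matrix P)
    fix y
    show "D y = 0 \<longleftrightarrow> (\<exists>g\<in>W. g \<noteq> mat 1 \<and> g *v y = y)"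
    proof
      assume "\<exists>g\<in>W. g \<noteq> mat 1 \<and> g *v y = y"
      then obtain g where g: "g \<in> W" "g \<noteq> mat 1" "g *v y = y" by blast
      obtain i1 where i1: "i1 < N" "w i1 = mat 1" using w_surj[OF one] by blast
      obtain i2 where i2: "i2 < N" "w i2 = g" using w_surj[OF g(1)] by blast
      have ne: "i1 \<noteq> i2" using i1 i2 g by auto
      \<comment> \<open>Since \<open>g\<close> fixes \<open>y\<close>, the rows of the identity and
        of \<open>g\<close> are equal; \<open>l\<close> takes their difference.\<close>
      define l where "l i = (if i = i1 then 1 else if i = i2 then -1 else (0::complex))" for i
      have "(\<Sum>i<N. l i * P j (w i *v y)) = 0" for j
      proof -
        have "(\<Sum>i<N. l i * P j (w i *v y)) = (\<Sum>i\<in>{i1, i2}. l i * P j (w i *v y))"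
          using i1 i2 by (intro sum.mono_neutral_right) (auto simp: l_def)
        then show ?thesis using ne i1 i2 g by (simp add: l_def)
      qed
      moreover have "l i1 \<noteq> 0" by (simp add: l_def)
      ultimately show "D y = 0" unfolding D0 using i1 by blast
    next
      assume "D y = 0"
      then obtain l i0 where l: "i0 < N" "l i0 \<noteq> 0" "\<And>j. j < N \<Longrightarrow> (\<Sum>i<N. l i * P j (w i *v y)) = 0"
        unfolding D0 by blast
      show "\<exists>g\<in>W. g \<noteq> mat 1 \<and> g *v y = y"
      proof (rule ccontr)
        assume "\<not> ?thesis"
        then have free: "\<And>g. g \<in> W \<Longrightarrow> g *v y = y \<Longrightarrow> g = mat 1" by blast
        let ?F = "(\<lambda>i. w i *v y) ` ({0..<N} - {i0})"
        have "w i0 *v y \<notin> ?F"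
        proof
          assume "w i0 *v y \<in> ?F"
          then obtain i where i: "i < N" "i \<noteq> i0" "w i0 *v y = w i *v y"
            by (elim imageE) auto
          obtain g where g: "g \<in> W" "g ** w i0 = mat 1" "w i0 ** g = mat 1"
            using inv[OF wW[OF l(1)]] by blast
          have "(g ** w i) *v y = g *v (w i0 *v y)"
            by (simp add: i(3) matrix_vector_mul_assoc)
          then have "(g ** w i) *v y = y" by (simp add: matrix_vector_mul_assoc g)
          then have "g ** w i = mat 1" using free mult g wW i by blast
          then have "w i0 ** (g ** w i) = w i0" by simp
          then have "w i = w i0" by (simp add: matrix_mul_assoc g)
          then show False using w_inj i l by blast
        qed
        \<comment> \<open>\<open>f\<close> is a combination of the generators with coefficients
          constant along the orbit, so the relation \<open>l\<close> between the rows also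
          annihilates the values of \<open>f\<close>. These single out \<open>l i0\<close>.\<close>
        from polyfun_interpolation[OF _ this] obtain f where
          f: "polyfun f" "f (w i0 *v y) = 1" "\<And>i. i < N \<Longrightarrow> i \<noteq> i0 \<Longrightarrow> f (w i *v y) = 0" by auto
        obtain b where b: "\<And>j. j < m \<Longrightarrow> invar (b j)" "\<And>v. f v = (\<Sum>j<m. b j v * p j v)"
          using gen[OF f(1)] by blast
        have fw: "f (w i *v y) = (\<Sum>j<m. b j y * P j (w i *v y))" if "i < N" for i
          unfolding b(2) by (intro sum.cong refl) (simp add: P_def invar_apply[OF b(1) wW[OF that]])
        have "l i0 = (\<Sum>i<N. l i * f (w i *v y))"
          using l(1) by (subst sum.remove[of _ i0]) (auto simp: f)
        also have "\<dots> = (\<Sum>i<N. \<Sum>j<m. b j y * (l i * P j (w i *v y)))"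
          by (intro sum.cong refl) (simp add: fw sum_distrib_left mult.left_commute)
        also have "\<dots> = (\<Sum>j<m. b j y * (\<Sum>i<N. l i * P j (w i *v y)))"
          by (subst sum.swap) (simp add: sum_distrib_left)
        also have "\<dots> = 0" using l(3) m by (simp add: N_def)
        finally show False using l(2) by simp
      qed
    qed
  qed
qed

text \<open>Near \<open>x\<close> only elements of the stabilizer \<open>H\<close> can fix points.
  They are not reflections, so their fixed spaces have codimension at least 2, and a plane through
  \<open>x\<close> with generic directions \<open>u\<close> and \<open>v\<close> meets all of them
  in \<open>x\<close> alone.\<close>

theorem stabilizer_trivial:
  assumes x: "\<And>r. r \<in> W \<Longrightarrow> reflection r \<Longrightarrow> r *v x \<noteq> x" and h: "h \<in> W" "h *v x = x"
  shows "h = mat 1"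
proof (rule ccontr)
  assume "h \<noteq> mat 1"
  obtain D where D: "polyfun D" "\<And>y. D y = 0 \<longleftrightarrow> (\<exists>g\<in>W. g \<noteq> mat 1 \<and> g *v y = y)"
    by (rule discriminant_exists) (rule that)
  have "D x = 0" using D h \<open>h \<noteq> mat 1\<close> by blast
  define H where "H = {g \<in> W. g \<noteq> mat 1 \<and> g *v x = x}"
  have finH: "finite H" using fin by (simp add: H_def)
  have "\<exists>i v. v $ i - (g *v v) $ i \<noteq> 0" if "g \<in> H" for g
  proof (rule ccontr)
    assume "\<not> ?thesis"
    then have "g *v v = mat 1 *v v" for v by (simp add: Finite_Cartesian_Product.vec_eq_iff)
    then show False using that unfolding H_def matrix_eq by blast
  qed
  then obtain i where i: "\<And>g. g \<in> H \<Longrightarrow> \<exists>v. v $ i g - (g *v v) $ i g \<noteq> 0" by metis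
  have "\<exists>v. \<forall>g\<in>H. v $ i g - (g *v v) $ i g \<noteq> 0"
    using i by (intro polyfun_avoid[OF finH] polyfun_diff polyfun_coord
        polyfun_matrix[OF polyfun_coord]) auto
  then obtain v where v: "\<And>g. g \<in> H \<Longrightarrow> v $ i g - (g *v v) $ i g \<noteq> 0" by blast
  define b where "b g = v - g *v v" for g
  have b: "b g $ i g \<noteq> 0" if "g \<in> H" for g using v[OF that] by (simp add: b_def)
  \<comment> \<open>The expression is a two by two minor of \<open>u - g u\<close> and
    \<open>v - g v\<close>. If it is nonzero, these vectors are independent and \<open>g\<close>
    fixes no nontrivial combination of \<open>u\<close> and \<open>v\<close>. It is polynomial in
    \<open>u\<close>, so one \<open>u\<close> serves all of \<open>H\<close>.\<close>
  have "\<exists>j u. (u - g *v u) $ j * b g $ i g - (u - g *v u) $ i g * b g $ j \<noteq> 0" if g: "g \<in> H" for g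
  proof -
    have "vec.dim (fixed_space g) \<noteq> CARD('n) - 1"
      using reflectionI[of g] x g by (auto simp: H_def)
    then obtain u where u: "\<And>c. u - g *v u \<noteq> c *s b g"
      using fixed_space_codim[of g "b g"] g by (auto simp: H_def)
    define c where "c = (u - g *v u) $ i g / b g $ i g"
    obtain j where "(u - g *v u) $ j \<noteq> c * b g $ j"
      using u[of c] by (auto simp: Finite_Cartesian_Product.vec_eq_iff)
    then show ?thesis
      using b[OF g] by (intro exI[of _ j] exI[of _ u]) (auto simp: c_def field_simps)
  qed
  then obtain j where j: "\<And>g. g \<in> H \<Longrightarrow>
      \<exists>u. (u - g *v u) $ j g * b g $ i g - (u - g *v u) $ i g * b g $ j g \<noteq> 0" by metis
  have "\<exists>u. \<forall>g\<in>H. (u - g *v u) $ j g * b g $ i g - (u - g *v u) $ i g * b g $ j g \<noteq> 0"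
  proof (rule polyfun_avoid[OF finH _ j])
    have *: "polyfun (\<lambda>u. (u - g *v u) $ k)" for g k
      using polyfun_diff[OF polyfun_coord polyfun_matrix[OF polyfun_coord]] by simp
    show "polyfun (\<lambda>u. (u - g *v u) $ j g * b g $ i g - (u - g *v u) $ i g * b g $ j g)" for g
      by (intro polyfun_diff polyfun_mult polyfun_const *)
  qed
  then obtain u where u: "\<And>g. g \<in> H \<Longrightarrow>
      (u - g *v u) $ j g * b g $ i g - (u - g *v u) $ i g * b g $ j g \<noteq> 0" by blast
  define z where "z q = x + fst q *s u + snd q *s v" for q
  have contz: "continuous_on UNIV z"
    unfolding z_def vector_scalar_mult_def by (intro continuous_intros)
  \<comment> \<open>A neighbourhood of \<open>x\<close> on which elements outside the stabilizer of
    \<open>x\<close> have no fixed point; it is open because \<open>W\<close> is finite.\<close>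
  define G where "G = {y. \<forall>g \<in> {g \<in> W. g *v x \<noteq> x}. g *v y \<noteq> y}"
  have G: "G = (\<Inter>g \<in> {g \<in> W. g *v x \<noteq> x}. {y. g *v y \<noteq> y})" by (auto simp: G_def)
  have "open G"
    unfolding G using fin
    by (intro open_INT ballI open_Collect_neq continuous_intros) auto
  then have "open (z -` G)" using contz by (simp add: open_vimage)
  moreover have "(0, 0) \<in> z -` G" by (simp add: z_def G_def)
  ultimately obtain \<delta> where \<delta>: "\<delta> > 0" "ball (0, 0) \<delta> \<subseteq> z -` G"
    using openE by blast
  have "\<delta> / 2 > 0" using \<delta> by simp
  from polyfun_zero_not_isolated[OF D(1) \<open>D x = 0\<close> this, of u v]
  obtain s t where st: "cmod s < \<delta> / 2" "cmod t < \<delta> / 2" "(s, t) \<noteq> (0, 0)" "D (z (s, t)) = 0"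
    by (auto simp: z_def)
  have "norm (s, t) < \<delta>" using norm_Pair_le[of s t] st by linarith
  then have "(s, t) \<in> ball (0, 0) \<delta>" by (simp only: mem_ball_0 flip: zero_prod_def)
  with \<delta> have inG: "z (s, t) \<in> G" by blast
  obtain g where g: "g \<in> W" "g \<noteq> mat 1" "g *v z (s, t) = z (s, t)" using D(2) st(4) by blast
  then have "g *v x = x" using inG by (auto simp: G_def)
  with g have gH: "g \<in> H" by (simp add: H_def)
  have eq: "s *s (u - g *v u) + t *s b g = 0"
    using g(3) \<open>g *v x = x\<close>
    by (simp add: z_def b_def matrix_vector_right_distrib vec.scale vec.scale_right_diff_distrib algebra_simps)
  have eqk: "s * (u - g *v u) $ k = - (t * b g $ k)" for k
    using arg_cong[OF eq, of "\<lambda>w. w $ k"] by (simp add: eq_neg_iff_add_eq_0 algebra_simps)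
  have "s * ((u - g *v u) $ j g * b g $ i g - (u - g *v u) $ i g * b g $ j g) =
      (s * (u - g *v u) $ j g) * b g $ i g - (s * (u - g *v u) $ i g) * b g $ j g"
    by (simp add: algebra_simps)
  also have "\<dots> = 0" unfolding eqk by simp
  finally have "s = 0" using u[OF gH] by simp
  then have "t = 0" using eqk[of "i g"] b[OF gH] by simp
  with \<open>s = 0\<close> st(3) show False by simp
qed

end

section \<open>The fundamental group of an abstract topological space\<close>

lemma loop_homotopicI:
  assumes h: "continuous_map (top_of_set ({0..1::real} \<times> {0..1})) Y h"
    and "\<And>t. t \<in> {0..1} \<Longrightarrow> h (0, t) = p t" "\<And>t. t \<in> {0..1} \<Longrightarrow> h (1, t) = q t"
    and "\<And>s. s \<in> {0..1} \<Longrightarrow> h (s, 0) = y" "\<And>s. s \<in> {0..1} \<Longrightarrow> h (s, 1) = y"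
  shows "(p, q) \<in> loop_homotopic Y y"
proof -
  have path: "pathin Y r" if "s \<in> {0..1}" "\<And>t. t \<in> {0..1} \<Longrightarrow> h (s, t) = r t" for s r
    unfolding pathin_def
  proof (rule continuous_map_eq[of _ _ "h \<circ> (\<lambda>t. (s, t))"])
    show "continuous_map (top_of_set {0..1}) Y (h \<circ> (\<lambda>t. (s, t)))"
      by (rule continuous_map_compose[OF _ h]) (use that in \<open>auto intro!: continuous_intros\<close>)
  qed (use that in auto)
  have "pathin Y p" "pathin Y q"
    using path[of 0 p] path[of 1 q] assms by auto
  moreover have "p 0 = y" "p 1 = y" "q 0 = y" "q 1 = y"
    using assms(2)[of 0] assms(2)[of 1] assms(3)[of 0] assms(3)[of 1]
      assms(4)[of 0] assms(5)[of 0] assms(4)[of 1] assms(5)[of 1] by auto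
  moreover have "homotopic_with (\<lambda>r. r 0 = y \<and> r 1 = y) (top_of_set {0..1}) Y p q"
    using assms
    by (subst homotopic_with) (auto simp flip: subtopology_Times intro!: exI[of _ h])
  ultimately show ?thesis by (simp add: loop_homotopic_def loops_def)
qed

lemma loop_homotopicE:
  assumes "(p, q) \<in> loop_homotopic Y y"
  obtains h where "continuous_map (top_of_set ({0..1::real} \<times> {0..1})) Y h"
    "\<And>t. h (0, t) = p t" "\<And>t. h (1, t) = q t"
    "\<And>s. s \<in> {0..1} \<Longrightarrow> h (s, 0) = y" "\<And>s. s \<in> {0..1} \<Longrightarrow> h (s, 1) = y"
proof -
  from assms obtain h where "continuous_map (top_of_set ({0..1::real} \<times> {0..1})) Y h"
    "\<forall>t. h (0, t) = p t" "\<forall>t. h (1, t) = q t" "\<forall>s\<in>{0..1}. h (s, 0) = y \<and> h (s, 1) = y"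
    unfolding loop_homotopic_def homotopic_with_def by (auto simp flip: subtopology_Times)
  then show thesis by (intro that[of h]) auto
qed

lemma equiv_loop_homotopic: "equiv (loops Y y) (loop_homotopic Y y)"
proof (rule equivI)
  show "loop_homotopic Y y \<subseteq> loops Y y \<times> loops Y y" by (auto simp: loop_homotopic_def)
  show "refl_on (loops Y y) (loop_homotopic Y y)"
    by (auto simp: refl_on_def loop_homotopic_def loops_def pathin_def)
  show "sym (loop_homotopic Y y)"
    by (auto simp: sym_def loop_homotopic_def intro: homotopic_with_symD)
  show "trans (loop_homotopic Y y)"
    by (auto simp: trans_def loop_homotopic_def intro: homotopic_with_trans)
qed

lemma loop_class_eq:
  "p \<in> loops Y y \<Longrightarrow> q \<in> loops Y y \<Longrightarrow>
    loop_class Y y p = loop_class Y y q \<longleftrightarrow> (p, q) \<in> loop_homotopic Y y"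
  using eq_equiv_class_iff[OF equiv_loop_homotopic] by metis

lemma loop_class_eqI: "(p, q) \<in> loop_homotopic Y y \<Longrightarrow> loop_class Y y p = loop_class Y y q"
  using equiv_class_eq[OF equiv_loop_homotopic] by metis

lemma loop_homotopic_loops:
  "(p, q) \<in> loop_homotopic Y y \<Longrightarrow> p \<in> loops Y y" "(p, q) \<in> loop_homotopic Y y \<Longrightarrow> q \<in> loops Y y"
  by (auto simp: loop_homotopic_def)

lemma loop_homotopic_refl: "p \<in> loops Y y \<Longrightarrow> (p, p) \<in> loop_homotopic Y y"
  by (auto simp: loop_homotopic_def loops_def pathin_def)

text \<open>Loops are functions on all of \<open>real\<close>, so loops that agree on
  \<open>{0..1}\<close> may differ as functions; their classes coincide.\<close>

lemma loop_homotopic_cong: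
  assumes "p \<in> loops Y y" "\<And>t. t \<in> {0..1} \<Longrightarrow> q t = p t"
  shows "(p, q) \<in> loop_homotopic Y y"
proof -
  from loop_homotopic_refl[OF assms(1)] obtain h where
    h: "continuous_map (top_of_set ({0..1::real} \<times> {0..1})) Y h"
    "\<And>t. h (0, t) = p t" "\<And>t. h (1, t) = p t"
    "\<And>s. s \<in> {0..1} \<Longrightarrow> h (s, 0) = y" "\<And>s. s \<in> {0..1} \<Longrightarrow> h (s, 1) = y"
    by (rule loop_homotopicE) (rule that)
  show ?thesis by (rule loop_homotopicI[OF h(1)]) (use h assms in auto)
qed

lemma in_carrier_pi1: "a \<in> carrier (pi1 Y y) \<longleftrightarrow> (\<exists>p\<in>loops Y y. a = loop_class Y y p)"
  by (auto simp: pi1_def quotient_def)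

lemma loop_class_carrier [intro]: "p \<in> loops Y y \<Longrightarrow> loop_class Y y p \<in> carrier (pi1 Y y)"
  by (auto simp: in_carrier_pi1)

lemma one_pi1: "\<one>\<^bsub>pi1 Y y\<^esub> = loop_class Y y (\<lambda>_. y)"
  by (simp add: pi1_def)

lemma loops_const: "y \<in> topspace Y \<Longrightarrow> (\<lambda>_. y) \<in> loops Y y"
  by (simp add: loops_def)

lemma self_in_loop_class: "p \<in> loops Y y \<Longrightarrow> p \<in> loop_class Y y p"
  by (simp add: loop_homotopic_refl)

text \<open>The first coordinate is a parameter in \<open>A\<close>. With \<open>A\<close> the unit
  interval this concatenates homotopies; with a parameter that is ignored it concatenates
  paths.\<close>

lemma continuous_map_square_join:
  assumes f: "continuous_map (top_of_set (A \<times> {0..1})) Y f"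
    and g: "continuous_map (top_of_set (A \<times> {0..1})) Y g"
    and eq: "\<And>s. s \<in> A \<Longrightarrow> f (s, 1) = g (s, 0::real)"
  shows "continuous_map (top_of_set (A \<times> {0..1})) Y
    (\<lambda>z. if snd z \<le> 1/2 then f (fst z, 2 * snd z) else g (fst z, 2 * snd z - 1))"
proof -
  let ?S = "A \<times> {0..1::real}"
  let ?T = "\<lambda>b. if b then {z \<in> ?S. snd z \<le> 1/2} else {z \<in> ?S. snd z \<ge> 1/2}"
  let ?F = "\<lambda>b z. if b then f (fst z, 2 * snd z) else g (fst z, 2 * snd z - 1)"
  show ?thesis
  proof (rule pasting_lemma_closed[of "UNIV :: bool set" _ ?T _ ?F])
    fix b :: bool
    show "closedin (top_of_set ?S) (?T b)"
    proof (cases b)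
      case True
      have "{z \<in> ?S. snd z \<le> 1/2} = ?S \<inter> {z. snd z \<le> 1/2}" by auto
      moreover have "closed {z::'a \<times> real. snd z \<le> 1/2}"
        by (intro closed_Collect_le continuous_intros)
      ultimately show ?thesis using True by (auto simp: closedin_closed)
    next
      case False
      have "{z \<in> ?S. snd z \<ge> 1/2} = ?S \<inter> {z. snd z \<ge> 1/2}" by auto
      moreover have "closed {z::'a \<times> real. snd z \<ge> 1/2}"
        by (intro closed_Collect_le continuous_intros)
      ultimately show ?thesis using False by (auto simp: closedin_closed)
    qed
    have "continuous_map (top_of_set (?T True)) Y (f \<circ> (\<lambda>z. (fst z, 2 * snd z)))"
      by (rule continuous_map_compose[OF _ f]) (auto intro!: continuous_intros)
    moreover have "continuous_map (top_of_set (?T False)) Y (g \<circ> (\<lambda>z. (fst z, 2 * snd z - 1)))"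
      by (rule continuous_map_compose[OF _ g]) (auto intro!: continuous_intros)
    moreover have "?S \<inter> ?T b = ?T b" by auto
    ultimately show "continuous_map (subtopology (top_of_set ?S) (?T b)) Y (?F b)"
      by (cases b) (simp_all add: subtopology_subtopology o_def)
  next
    fix b c z assume "z \<in> topspace (top_of_set ?S) \<inter> ?T b \<inter> ?T c"
    then show "?F b z = ?F c z"
    proof (cases "b = c")
      case False
      then have "snd z = 1/2" "fst z \<in> A"
        using \<open>z \<in> topspace (top_of_set ?S) \<inter> ?T b \<inter> ?T c\<close> by (auto split: if_splits)
      then have "2 * snd z = 1" by simp
      then show ?thesis
        using eq[OF \<open>fst z \<in> A\<close>] False
        by (cases b; cases c) (simp_all only: if_True if_False diff_self simp_thms)
    qed auto
  next
    fix z assume "z \<in> topspace (top_of_set ?S)"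
    then show "\<exists>b. b \<in> UNIV \<and> z \<in> ?T b \<and>
        (if snd z \<le> 1/2 then f (fst z, 2 * snd z) else g (fst z, 2 * snd z - 1)) = ?F b z"
      by (intro exI[of _ "snd z \<le> 1/2"]) auto
  qed simp
qed

lemma pathin_join:
  assumes "pathin Y p" "pathin Y q" "p 1 = q 0" shows "pathin Y (join p q)"
proof -
  have snd: "continuous_map (top_of_set (UNIV \<times> {0..1})) (top_of_set {0..1}) (snd :: real \<times> real \<Rightarrow> real)"
    by (auto intro!: continuous_on_snd continuous_on_id)
  have "continuous_map (top_of_set (UNIV \<times> {0..1})) Y (\<lambda>z::real \<times> real. p (snd z))"
    using continuous_map_compose[OF snd assms(1)[unfolded pathin_def]] by (simp only: o_def)
  moreover have "continuous_map (top_of_set (UNIV \<times> {0..1})) Y (\<lambda>z::real \<times> real. q (snd z))"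
    using continuous_map_compose[OF snd assms(2)[unfolded pathin_def]] by (simp only: o_def)
  ultimately have J: "continuous_map (top_of_set (UNIV \<times> {0..1})) Y
      (\<lambda>z::real \<times> real. if snd z \<le> 1/2 then p (snd (fst z, 2 * snd z)) else q (snd (fst z, 2 * snd z - 1)))"
    by (rule continuous_map_square_join[of UNIV Y "\<lambda>z. p (snd z)" "\<lambda>z. q (snd z)"]) (simp add: assms(3))
  have "continuous_map (top_of_set {0..1}) (top_of_set (UNIV \<times> {0..1})) (\<lambda>t::real. (0::real, t))"
    by (auto intro!: continuous_on_Pair)
  from continuous_map_compose[OF this J] show ?thesis
    unfolding pathin_def join_def by (simp only: o_def fst_conv snd_conv)
qed

lemma join_homotopic:
  assumes "(p, p') \<in> loop_homotopic Y y" "(q, q') \<in> loop_homotopic Y y"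
  shows "(join p q, join p' q') \<in> loop_homotopic Y y"
proof -
  obtain h where h: "continuous_map (top_of_set ({0..1::real} \<times> {0..1})) Y h"
    "\<And>t. h (0, t) = p t" "\<And>t. h (1, t) = p' t"
    "\<And>s. s \<in> {0..1} \<Longrightarrow> h (s, 0) = y" "\<And>s. s \<in> {0..1} \<Longrightarrow> h (s, 1) = y"
    using assms(1) by (rule loop_homotopicE) (rule that)
  obtain k where k: "continuous_map (top_of_set ({0..1::real} \<times> {0..1})) Y k"
    "\<And>t. k (0, t) = q t" "\<And>t. k (1, t) = q' t"
    "\<And>s. s \<in> {0..1} \<Longrightarrow> k (s, 0) = y" "\<And>s. s \<in> {0..1} \<Longrightarrow> k (s, 1) = y"
    using assms(2) by (rule loop_homotopicE) (rule that)
  show ?thesis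
    by (rule loop_homotopicI[OF continuous_map_square_join[OF h(1) k(1)]])
       (simp_all add: join_def h(2,3,4,5) k(2,3,4,5))
qed

lemma join_loops: "p \<in> loops Y y \<Longrightarrow> q \<in> loops Y y \<Longrightarrow> join p q \<in> loops Y y"
  by (rule loop_homotopic_loops(1)[OF join_homotopic[OF loop_homotopic_refl loop_homotopic_refl]])

text \<open>Evaluates the unions in \<open>pi1\<close> and \<open>pi1_map\<close>: all
  representatives contribute the same set.\<close>

lemma UN_loop_class:
  assumes "p \<in> loops Y y" "\<And>q. (p, q) \<in> loop_homotopic Y y \<Longrightarrow> F q = F p"
  shows "(\<Union>q\<in>loop_class Y y p. F q) = F p"
proof (rule SUP_eq_const)
  show "loop_class Y y p \<noteq> {}" using loop_homotopic_refl[OF assms(1)] by blast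
  show "F q = F p" if "q \<in> loop_class Y y p" for q using that assms(2)[of q] by blast
qed

lemma mult_pi1:
  assumes p: "p \<in> loops Y y" and q: "q \<in> loops Y y"
  shows "loop_class Y y p \<otimes>\<^bsub>pi1 Y y\<^esub> loop_class Y y q = loop_class Y y (join p q)"
proof -
  have 1: "(\<Union>q'\<in>loop_class Y y q. loop_class Y y (join p' q')) = loop_class Y y (join p q)"
    if "(p, p') \<in> loop_homotopic Y y" for p'
  proof -
    have "(\<Union>q'\<in>loop_class Y y q. loop_class Y y (join p' q')) = loop_class Y y (join p' q)"
      by (rule UN_loop_class[OF q, of "\<lambda>q'. loop_class Y y (join p' q')"])
         (metis join_homotopic loop_class_eqI loop_homotopic_loops(2) loop_homotopic_refl that)
    also have "\<dots> = loop_class Y y (join p q)"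
      by (metis join_homotopic loop_class_eqI loop_homotopic_refl q that)
    finally show ?thesis .
  qed
  have "(\<Union>p'\<in>loop_class Y y p. \<Union>q'\<in>loop_class Y y q. loop_class Y y (join p' q')) =
      (\<Union>q'\<in>loop_class Y y q. loop_class Y y (join p q'))"
  proof (rule UN_loop_class[OF p, of "\<lambda>p'. \<Union>q'\<in>loop_class Y y q. loop_class Y y (join p' q')"])
    fix p' assume "(p, p') \<in> loop_homotopic Y y"
    from 1[OF this] 1[OF loop_homotopic_refl[OF p]]
    show "(\<Union>q'\<in>loop_class Y y q. loop_class Y y (join p' q')) =
      (\<Union>q'\<in>loop_class Y y q. loop_class Y y (join p q'))" by (rule trans[OF _ sym])
  qed
  also have "\<dots> = loop_class Y y (join p q)" by (rule 1[OF loop_homotopic_refl[OF p]])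
  finally show ?thesis by (simp add: pi1_def)
qed

text \<open>The straight-line homotopy between the two parametrizations.\<close>

lemma homotopic_through_convex:
  fixes a b :: "real \<Rightarrow> 'v::real_normed_vector"
  assumes m: "continuous_map (top_of_set K) Y m" and K: "convex K"
    and a: "continuous_on {0..1} a" "\<And>t. t \<in> {0..1} \<Longrightarrow> a t \<in> K"
    and b: "continuous_on {0..1} b" "\<And>t. t \<in> {0..1} \<Longrightarrow> b t \<in> K"
    and "a 0 = b 0" "a 1 = b 1"
    and p: "\<And>t. t \<in> {0..1} \<Longrightarrow> p t = m (a t)" and q: "\<And>t. t \<in> {0..1} \<Longrightarrow> q t = m (b t)"
    and y: "m (a 0) = y" "m (a 1) = y"
  shows "(p, q) \<in> loop_homotopic Y y"
proof (rule loop_homotopicI)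
  let ?H = "\<lambda>z. (1 - fst z) *\<^sub>R a (snd z) + fst z *\<^sub>R b (snd z)"
  have "continuous_on ({0..1::real} \<times> {0..1}) ?H"
    by (intro continuous_intros continuous_on_compose2[OF a(1)] continuous_on_compose2[OF b(1)]) auto
  moreover have "?H z \<in> K" if "z \<in> {0..1} \<times> {0..1}" for z
    using convexD[OF K a(2) b(2), of "snd z" "snd z" "1 - fst z" "fst z"] that by auto
  ultimately show "continuous_map (top_of_set ({0..1::real} \<times> {0..1})) Y (m \<circ> ?H)"
    by (intro continuous_map_compose[OF _ m]) auto
  have e: "(1 - s) *\<^sub>R w + s *\<^sub>R w = w" for s and w :: 'v
    by (simp flip: scaleR_add_left)
  show "(m \<circ> ?H) (s, 0) = y" "(m \<circ> ?H) (s, 1) = y" for s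
    using assms by (simp_all add: e)
qed (use p q in auto)

text \<open>Each group law compares two piecewise linear parametrizations of one map on
  \<open>{0..1}\<close>, so \<open>homotopic_through_convex\<close> applies throughout.\<close>

lemma group_pi1:
  assumes y: "y \<in> topspace Y" shows "group (pi1 Y y)"
proof (rule groupI)
  show "\<one>\<^bsub>pi1 Y y\<^esub> \<in> carrier (pi1 Y y)" by (auto simp: one_pi1 loops_const y)
next
  fix a b assume "a \<in> carrier (pi1 Y y)" "b \<in> carrier (pi1 Y y)"
  then show "a \<otimes>\<^bsub>pi1 Y y\<^esub> b \<in> carrier (pi1 Y y)"
    by (auto simp: in_carrier_pi1[of _ Y y] mult_pi1 intro: join_loops)
next
  fix a b c assume "a \<in> carrier (pi1 Y y)" "b \<in> carrier (pi1 Y y)" "c \<in> carrier (pi1 Y y)"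
  then obtain p q r where pqr: "p \<in> loops Y y" "q \<in> loops Y y" "r \<in> loops Y y"
    and abc: "a = loop_class Y y p" "b = loop_class Y y q" "c = loop_class Y y r"
    by (auto simp: in_carrier_pi1)
  let ?m = "join (join p q) r"
  \<comment> \<open>Takes the break points 1/2 and 3/4 of \<open>join p (join q r)\<close> to the
    break points 1/4 and 1/2 of \<open>?m\<close>.\<close>
  define f where "f t = (if t \<le> 1/2 then t / 2 else if t \<le> 3/4 then t - 1/4 else 2 * t - 1)" for t :: real
  have "continuous_on {0..1} f"
  proof -
    have "f = (\<lambda>t. max (t / 2) (max (t - 1/4) (2 * t - 1)))" by (auto simp: f_def fun_eq_iff max_def)
    then show ?thesis by (auto intro!: continuous_intros)
  qed
  moreover have "join p (join q r) t = ?m (f t)" for t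
    by (auto simp: f_def join_def field_simps intro!: arg_cong[of _ _ p] arg_cong[of _ _ q] arg_cong[of _ _ r])
  ultimately have "(?m, join p (join q r)) \<in> loop_homotopic Y y"
    using join_loops[OF join_loops[OF pqr(1,2)] pqr(3)] pqr
    by (intro homotopic_through_convex[of "{0..1}" Y ?m "\<lambda>t. t" f])
       (auto simp: f_def loops_def pathin_def intro!: continuous_intros)
  then show "a \<otimes>\<^bsub>pi1 Y y\<^esub> b \<otimes>\<^bsub>pi1 Y y\<^esub> c = a \<otimes>\<^bsub>pi1 Y y\<^esub> (b \<otimes>\<^bsub>pi1 Y y\<^esub> c)"
    using pqr by (simp add: abc mult_pi1 join_loops loop_class_eqI)
next
  fix a assume "a \<in> carrier (pi1 Y y)"
  then obtain p where p: "p \<in> loops Y y" and a: "a = loop_class Y y p" by (auto simp: in_carrier_pi1)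
  have "(join (\<lambda>_. y) p, p) \<in> loop_homotopic Y y"
    using p
    by (intro homotopic_through_convex[of "{0..1}" Y p "\<lambda>t. max 0 (2 * t - 1)" "\<lambda>t. t"])
       (auto simp: join_def loops_def pathin_def intro!: continuous_intros)
  then show "\<one>\<^bsub>pi1 Y y\<^esub> \<otimes>\<^bsub>pi1 Y y\<^esub> a = a"
    by (simp add: a one_pi1 mult_pi1 p loops_const y loop_class_eqI)
next
  fix a assume "a \<in> carrier (pi1 Y y)"
  then obtain p where p: "p \<in> loops Y y" and a: "a = loop_class Y y p" by (auto simp: in_carrier_pi1)
  let ?r = "\<lambda>t. p (1 - t)"
  have "continuous_map (top_of_set {0..1}) Y (p \<circ> (\<lambda>t. 1 - t))"
    using p by (intro continuous_map_compose[of _ "top_of_set {0..1}"])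
       (auto simp: loops_def pathin_def intro!: continuous_intros)
  then have r: "?r \<in> loops Y y" using p by (auto simp: loops_def pathin_def o_def)
  \<comment> \<open>This parametrization runs through \<open>p\<close> backwards and then forwards;
    it is contracted to the end point 1.\<close>
  have "continuous_on {0..1} (\<lambda>t::real. \<bar>1 - 2 * t\<bar>)" by (intro continuous_intros)
  then have "(join ?r p, \<lambda>_. y) \<in> loop_homotopic Y y"
    using p
    by (intro homotopic_through_convex[of "{0..1}" Y p "\<lambda>t. \<bar>1 - 2 * t\<bar>" "\<lambda>t. 1"])
       (auto simp: join_def loops_def pathin_def abs_real_def intro!: continuous_intros)
  then show "\<exists>b\<in>carrier (pi1 Y y). b \<otimes>\<^bsub>pi1 Y y\<^esub> a = \<one>\<^bsub>pi1 Y y\<^esub>"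
    using r p by (intro bexI[of _ "loop_class Y y ?r"]) (auto simp: a one_pi1 mult_pi1 loop_class_eqI)
qed

lemma loops_compose:
  "continuous_map Y Y' f \<Longrightarrow> f y = y' \<Longrightarrow> p \<in> loops Y y \<Longrightarrow> f \<circ> p \<in> loops Y' y'"
  by (auto simp: loops_def intro: pathin_compose)

lemma loop_homotopic_compose:
  assumes f: "continuous_map Y Y' f" "f y = y'" and pq: "(p, q) \<in> loop_homotopic Y y"
  shows "(f \<circ> p, f \<circ> q) \<in> loop_homotopic Y' y'"
proof -
  obtain h where h: "continuous_map (top_of_set ({0..1::real} \<times> {0..1})) Y h"
    "\<And>t. h (0, t) = p t" "\<And>t. h (1, t) = q t"
    "\<And>s. s \<in> {0..1} \<Longrightarrow> h (s, 0) = y" "\<And>s. s \<in> {0..1} \<Longrightarrow> h (s, 1) = y"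
    using pq by (rule loop_homotopicE) (rule that)
  show ?thesis
    by (rule loop_homotopicI[OF continuous_map_compose[OF h(1) f(1)]]) (use h f in auto)
qed

lemma pi1_map_class:
  assumes f: "continuous_map Y Y' f" "f y = y'" and p: "p \<in> loops Y y"
  shows "pi1_map Y' y' f (loop_class Y y p) = loop_class Y' y' (f \<circ> p)"
proof -
  have "loop_class Y' y' (f \<circ> q) = loop_class Y' y' (f \<circ> p)" if "(p, q) \<in> loop_homotopic Y y" for q
    using loop_class_eqI[OF loop_homotopic_compose[OF f that]] by simp
  then show ?thesis
    unfolding pi1_map_def using UN_loop_class[OF p, of "\<lambda>q. loop_class Y' y' (f \<circ> q)"] by blast
qed

lemma pi1_map_hom:
  assumes f: "continuous_map Y Y' f" "f y = y'"
  shows "pi1_map Y' y' f \<in> hom (pi1 Y y) (pi1 Y' y')"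
proof (rule homI)
  fix a assume "a \<in> carrier (pi1 Y y)"
  then show "pi1_map Y' y' f a \<in> carrier (pi1 Y' y')"
    unfolding in_carrier_pi1 by (metis pi1_map_class[OF f] loops_compose[OF f])
next
  fix a b assume "a \<in> carrier (pi1 Y y)" "b \<in> carrier (pi1 Y y)"
  then obtain p q where pq: "p \<in> loops Y y" "q \<in> loops Y y"
    and ab: "a = loop_class Y y p" "b = loop_class Y y q"
    by (auto simp: in_carrier_pi1)
  have "f \<circ> join p q = join (f \<circ> p) (f \<circ> q)" by (auto simp: join_def fun_eq_iff)
  then show "pi1_map Y' y' f (a \<otimes>\<^bsub>pi1 Y y\<^esub> b) = pi1_map Y' y' f a \<otimes>\<^bsub>pi1 Y' y'\<^esub> pi1_map Y' y' f b"
    using pq by (simp add: ab mult_pi1 pi1_map_class[OF f] join_loops loops_compose[OF f])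
qed

lemma pi1_one_point:
  assumes "topspace Y = {y}" shows "carrier (pi1 Y y) = {\<one>\<^bsub>pi1 Y y\<^esub>}"
proof -
  have all: "loop_class Y y p = loop_class Y y (\<lambda>_. y)" if "p \<in> loops Y y" for p
  proof -
    have "p t = y" if "t \<in> {0..1}" for t
      using path_image_subset_topspace[of Y p] \<open>p \<in> loops Y y\<close> that assms by (auto simp: loops_def)
    then have "(p, \<lambda>_. y) \<in> loop_homotopic Y y" using that by (intro loop_homotopic_cong) auto
    then show ?thesis by (rule loop_class_eqI)
  qed
  have const: "(\<lambda>_. y) \<in> loops Y y" using assms by (intro loops_const) simp
  show ?thesis
    unfolding one_pi1
  proof (intro equalityI subsetI)
    fix a assume "a \<in> carrier (pi1 Y y)"
    then obtain p where "p \<in> loops Y y" "a = loop_class Y y p" unfolding in_carrier_pi1 ..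
    then show "a \<in> {loop_class Y y (\<lambda>_. y)}" using all by simp
  next
    fix a assume "a \<in> {loop_class Y y (\<lambda>_. y)}"
    then show "a \<in> carrier (pi1 Y y)" using loop_class_carrier[OF const] by simp
  qed
qed

section \<open>Lifting through quotients by free finite group actions\<close>

text \<open>\<open>\<Phi>\<close> is a set of maps, not a group with an action: later, different
  elements of \<open>W\<close> give the same map of the slice. Freeness therefore compares maps, and
  \<open>fib\<close> says that the fibres are the sets of images under
  \<open>\<Phi>\<close>.\<close>

locale free_quotient =
  fixes E :: "'a::real_normed_vector set" and T :: "'b topology" and q :: "'a \<Rightarrow> 'b"
    and \<Phi> :: "('a \<Rightarrow> 'a) set"
  assumes cont: "continuous_map (top_of_set E) T q"
    and opn: "open_map (top_of_set E) T q"
    and surj: "q ` E = topspace T"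
    and fin\<Phi>: "finite \<Phi>"
    and homeo: "\<phi> \<in> \<Phi> \<Longrightarrow> \<exists>\<psi>. homeomorphism E E \<phi> \<psi>"
    and fib: "e \<in> E \<Longrightarrow> e' \<in> E \<Longrightarrow> q e = q e' \<longleftrightarrow> (\<exists>\<phi>\<in>\<Phi>. e' = \<phi> e)"
    and free: "\<phi> \<in> \<Phi> \<Longrightarrow> \<psi> \<in> \<Phi> \<Longrightarrow> e \<in> E \<Longrightarrow> \<phi> e = \<psi> e \<Longrightarrow> \<phi> = \<psi>"
begin

lemma \<Phi>_closed: "\<phi> \<in> \<Phi> \<Longrightarrow> e \<in> E \<Longrightarrow> \<phi> e \<in> E"
  using homeo by (force simp: homeomorphism_def)

lemma \<Phi>_cont: "\<phi> \<in> \<Phi> \<Longrightarrow> continuous_on E \<phi>"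
  using homeo by (force simp: homeomorphism_def)

lemma \<Phi>_inj: "\<phi> \<in> \<Phi> \<Longrightarrow> e \<in> E \<Longrightarrow> e' \<in> E \<Longrightarrow> \<phi> e = \<phi> e' \<Longrightarrow> e = e'"
  using homeo by (metis homeomorphism_def)

text \<open>By freeness the finitely many points \<open>\<phi> e\<close> are distinct; Hausdorff
  neighbourhoods are pulled back and intersected over all pairs of maps.\<close>

lemma disjoint_translates:
  assumes e: "e \<in> E"
  obtains A where "openin (top_of_set E) A" "e \<in> A"
    "\<And>\<phi> \<psi>. \<phi> \<in> \<Phi> \<Longrightarrow> \<psi> \<in> \<Phi> \<Longrightarrow> \<phi> \<noteq> \<psi> \<Longrightarrow> \<phi> ` A \<inter> \<psi> ` A = {}"
proof -
  have "\<exists>A. openin (top_of_set E) A \<and> e \<in> A \<and> (fst x \<noteq> snd x \<longrightarrow> fst x ` A \<inter> snd x ` A = {})"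
    if x: "x \<in> \<Phi> \<times> \<Phi>" for x
  proof (cases "fst x = snd x")
    case True
    then show ?thesis using e by (intro exI[of _ E]) auto
  next
    case False
    then have "fst x e \<noteq> snd x e" using free x e by auto
    then obtain U V where UV: "open U" "open V" "fst x e \<in> U" "snd x e \<in> V" "U \<inter> V = {}"
      by (meson hausdorff)
    let ?A = "(E \<inter> fst x -` U) \<inter> (E \<inter> snd x -` V)"
    have "openin (top_of_set E) ?A"
      using x UV by (intro openin_Int continuous_openin_preimage_gen \<Phi>_cont) auto
    then show ?thesis using UV e by (intro exI[of _ ?A]) auto
  qed
  then obtain A where A: "\<And>x. x \<in> \<Phi> \<times> \<Phi> \<Longrightarrow> openin (top_of_set E) (A x) \<and> e \<in> A x \<and>
      (fst x \<noteq> snd x \<longrightarrow> fst x ` A x \<inter> snd x ` A x = {})" by metis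
  let ?B = "\<Inter> (A ` (\<Phi> \<times> \<Phi>))"
  have "\<Phi> \<times> \<Phi> \<noteq> {}" using fib[OF e e] by auto
  then have "openin (top_of_set E) ?B"
    using fin\<Phi> A by (intro openin_INT2) auto
  moreover have "e \<in> ?B" using A by blast
  moreover have "\<phi> ` ?B \<inter> \<psi> ` ?B = {}" if "\<phi> \<in> \<Phi>" "\<psi> \<in> \<Phi>" "\<phi> \<noteq> \<psi>" for \<phi> \<psi>
    using A[of "(\<phi>, \<psi>)"] that by (auto 4 4)
  ultimately show thesis using that by blast
qed

text \<open>The library has lifting theorems for covering spaces whose base lies in a type of class
  \<open>topological_space\<close>. They become applicable after pulling \<open>q\<close> back along the map to be lifted.\<close>

lemma pullback_covering:
  fixes H :: "'c::real_normed_vector \<Rightarrow> 'b"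
  assumes H: "continuous_map (top_of_set U) T H"
  shows "covering_space {(z, e). z \<in> U \<and> e \<in> E \<and> H z = q e} fst U"
proof
  let ?C = "{(z, e). z \<in> U \<and> e \<in> E \<and> H z = q e}"
  show "continuous_on ?C fst" by (intro continuous_intros)
  have Htop: "H z \<in> q ` E" if "z \<in> U" for z
    using H that surj by (auto simp: continuous_map_def)
  then show "fst ` ?C = U" by force
  fix z0 assume "z0 \<in> U"
  then obtain e0 where e0: "e0 \<in> E" "H z0 = q e0" using Htop by blast
  obtain A where A: "openin (top_of_set E) A" "e0 \<in> A"
    "\<And>\<phi> \<psi>. \<phi> \<in> \<Phi> \<Longrightarrow> \<psi> \<in> \<Phi> \<Longrightarrow> \<phi> \<noteq> \<psi> \<Longrightarrow> \<phi> ` A \<inter> \<psi> ` A = {}"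
    using disjoint_translates[OF e0(1)] by metis
  have AE: "A \<subseteq> E" using A(1) by (rule openin_imp_subset)
  have inj: "a = a'" if a: "a \<in> A" "a' \<in> A" "q a = q a'" for a a'
  proof -
    have E: "a \<in> E" "a' \<in> E" using a AE by auto
    obtain \<theta> where \<theta>: "\<theta> \<in> \<Phi>" "a' = \<theta> a" using fib[OF E] a by blast
    \<comment> \<open>The map that fixes \<open>a'\<close> stands in for the identity. Its translate
      of \<open>A\<close> and that of \<open>\<theta>\<close> both contain \<open>a'\<close>, so the
      two maps are equal.\<close>
    obtain \<theta>' where \<theta>': "\<theta>' \<in> \<Phi>" "a' = \<theta>' a'" using fib[OF E(2) E(2)] by blast
    have "\<theta> = \<theta>'" using A(3)[OF \<theta>(1) \<theta>'(1)] \<theta> \<theta>' a by blast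
    then have "\<theta> a = \<theta> a'" using \<theta> \<theta>' by simp
    then show ?thesis using \<Phi>_inj[OF \<theta>(1) E] by blast
  qed
  have pre_open: "openin (top_of_set U) {z \<in> U. H z \<in> q ` B}" if "openin (top_of_set E) B" for B
    using openin_continuous_map_preimage[OF H, of "q ` B"] opn that by (simp add: open_map_def)
  define N where "N = {z \<in> U. H z \<in> q ` A}"
  have N: "openin (top_of_set U) N" unfolding N_def by (rule pre_open[OF A(1)])
  \<comment> \<open>Over \<open>N\<close> the pullback splits into the graphs of the maps
    \<open>\<phi>\<close> composed with \<open>\<sigma>\<close>, where \<open>\<sigma>\<close> is
    the lift of \<open>H\<close> with values in \<open>A\<close>.\<close>
  define sheet where "sheet \<phi> = {(z, e). z \<in> N \<and> e \<in> \<phi> ` A \<and> H z = q e}" for \<phi>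
  define \<sigma> where "\<sigma> z = (THE a. a \<in> A \<and> q a = H z)" for z
  have \<sigma>: "\<sigma> z = a" if "a \<in> A" "q a = H z" for a z
    unfolding \<sigma>_def using that inj by (intro the_equality) auto
  have \<sigma>N: "\<sigma> z \<in> A \<and> q (\<sigma> z) = H z" if z: "z \<in> N" for z
  proof -
    obtain a where "a \<in> A" "H z = q a" using z by (auto simp: N_def)
    then show ?thesis using \<sigma>[of a z] by simp
  qed
  have \<sigma>_cont: "continuous_on N \<sigma>"
  proof (subst continuous_on_open_gen[of _ _ A])
    show "\<sigma> \<in> N \<rightarrow> A" using \<sigma>N by blast
    show "\<forall>V. openin (top_of_set A) V \<longrightarrow> openin (top_of_set N) (N \<inter> \<sigma> -` V)"
    proof (intro allI impI)
      fix V assume V: "openin (top_of_set A) V"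
      then have VA: "V \<subseteq> A" by (rule openin_imp_subset)
      have "openin (top_of_set U) {z \<in> U. H z \<in> q ` V}"
        by (rule pre_open[OF openin_trans[OF V A(1)]])
      moreover have "{z \<in> U. H z \<in> q ` V} = N \<inter> \<sigma> -` V"
      proof (intro equalityI subsetI)
        fix z assume "z \<in> {z \<in> U. H z \<in> q ` V}"
        then obtain v where "z \<in> U" "v \<in> V" "H z = q v" by blast
        with VA \<sigma>[of v z] show "z \<in> N \<inter> \<sigma> -` V" by (auto simp: N_def)
      next
        fix z assume "z \<in> N \<inter> \<sigma> -` V"
        with \<sigma>N[of z] have "z \<in> U" "\<sigma> z \<in> V" "H z = q (\<sigma> z)" by (auto simp: N_def)
        then show "z \<in> {z \<in> U. H z \<in> q ` V}" by blast
      qed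
      ultimately show "openin (top_of_set N) (N \<inter> \<sigma> -` V)"
        using N openin_imp_subset by (metis inf_le1 openin_subset_trans)
    qed
  qed
  have sheet_open: "openin (top_of_set ?C) (sheet \<phi>)" if \<phi>: "\<phi> \<in> \<Phi>" for \<phi>
  proof -
    obtain \<psi> where "homeomorphism E E \<phi> \<psi>" using homeo[OF \<phi>] by blast
    then have "openin (top_of_set E) (\<phi> ` A)" using A(1) homeomorphism_imp_open_map by blast
    then have "openin (top_of_set (U \<times> E)) (N \<times> \<phi> ` A)" using N by (intro openin_Times)
    then obtain S where S: "open S" "N \<times> \<phi> ` A = (U \<times> E) \<inter> S" by (auto simp: openin_open)
    have "sheet \<phi> = ?C \<inter> (N \<times> \<phi> ` A)"
      using AE \<Phi>_closed[OF \<phi>] by (auto simp: sheet_def N_def)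
    also have "\<dots> = ?C \<inter> S" unfolding S(2) by auto
    finally show ?thesis using S(1) by (auto simp: openin_open)
  qed
  show "\<exists>O'. z0 \<in> O' \<and> openin (top_of_set U) O' \<and>
          (\<exists>v. \<Union> v = ?C \<inter> fst -` O' \<and> (\<forall>u\<in>v. openin (top_of_set ?C) u) \<and>
             pairwise disjnt v \<and> (\<forall>u\<in>v. \<exists>g. homeomorphism u O' fst g))"
  proof (intro exI conjI)
    show "z0 \<in> N" using \<open>z0 \<in> U\<close> e0 A(2) by (auto simp: N_def)
    show "openin (top_of_set U) N" by (fact N)
    show "\<Union> (sheet ` \<Phi>) = ?C \<inter> fst -` N"
    proof
      show "\<Union> (sheet ` \<Phi>) \<subseteq> ?C \<inter> fst -` N"
        using AE \<Phi>_closed by (auto simp: sheet_def N_def)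
      show "?C \<inter> fst -` N \<subseteq> \<Union> (sheet ` \<Phi>)"
      proof (rule subsetI)
        fix w assume "w \<in> ?C \<inter> fst -` N"
        then obtain z e where ze: "z \<in> U" "e \<in> E" "H z = q e" and z: "z \<in> N" and w: "w = (z, e)"
          by auto
        have "q (\<sigma> z) = q e" using \<sigma>N[OF z] ze by simp
        then obtain \<phi> where "\<phi> \<in> \<Phi>" "e = \<phi> (\<sigma> z)"
          using fib[of "\<sigma> z" e] \<sigma>N[OF z] AE ze by blast
        then show "w \<in> \<Union> (sheet ` \<Phi>)"
          using z ze \<sigma>N[OF z] by (auto simp: sheet_def w)
      qed
    qed
    show "\<forall>u\<in>sheet ` \<Phi>. openin (top_of_set ?C) u" using sheet_open by blast
    show "pairwise disjnt (sheet ` \<Phi>)"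
    proof (rule pairwiseI)
      fix u v assume "u \<in> sheet ` \<Phi>" "v \<in> sheet ` \<Phi>" "u \<noteq> v"
      then obtain \<phi> \<psi> where \<phi>\<psi>: "\<phi> \<in> \<Phi>" "\<psi> \<in> \<Phi>" "\<phi> \<noteq> \<psi>" and uv: "u = sheet \<phi>" "v = sheet \<psi>"
        by (metis imageE)
      show "disjnt u v"
        unfolding disjnt_iff
      proof (intro allI notI)
        fix w assume "w \<in> u \<and> w \<in> v"
        then have "snd w \<in> \<phi> ` A" "snd w \<in> \<psi> ` A"
          unfolding uv sheet_def by (simp_all add: case_prod_unfold)
        then show False using A(3)[OF \<phi>\<psi>] by blast
      qed
    qed
    show "\<forall>u\<in>sheet ` \<Phi>. \<exists>g. homeomorphism u N fst g"
    proof (rule ballI, elim imageE)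
      fix u \<phi> assume u: "u = sheet \<phi>" and \<phi>: "\<phi> \<in> \<Phi>"
      have q\<phi>: "q (\<phi> a) = q a" if "a \<in> A" for a
      proof -
        have "a \<in> E" using that AE by blast
        then have "q a = q (\<phi> a)" using fib[OF _ \<Phi>_closed[OF \<phi>]] \<phi> by blast
        then show ?thesis by simp
      qed
      have "homeomorphism (sheet \<phi>) N fst (\<lambda>z. (z, \<phi> (\<sigma> z)))"
      proof
        show "continuous_on (sheet \<phi>) fst" by (intro continuous_intros)
        show "continuous_on N (\<lambda>z. (z, \<phi> (\<sigma> z)))"
          by (intro continuous_intros continuous_on_compose2[OF \<Phi>_cont[OF \<phi>] \<sigma>_cont])
             (use \<sigma>N AE in blast)
        show "fst ` sheet \<phi> \<subseteq> N" by (auto simp: sheet_def)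
        show "(\<lambda>z. (z, \<phi> (\<sigma> z))) ` N \<subseteq> sheet \<phi>"
        proof (rule image_subsetI)
          fix z assume "z \<in> N"
          with \<sigma>N q\<phi> have "\<phi> (\<sigma> z) \<in> \<phi> ` A" "H z = q (\<phi> (\<sigma> z))" by auto
          with \<open>z \<in> N\<close> show "(z, \<phi> (\<sigma> z)) \<in> sheet \<phi>" by (simp add: sheet_def)
        qed
        show "(fst w, \<phi> (\<sigma> (fst w))) = w" if "w \<in> sheet \<phi>" for w
        proof -
          from that have "\<exists>z a. w = (z, \<phi> a) \<and> a \<in> A \<and> H z = q (\<phi> a)"
            by (auto simp: sheet_def)
          then obtain z a where w: "w = (z, \<phi> a)" "a \<in> A" "H z = q (\<phi> a)" by blast
          then show ?thesis using \<sigma>[of a z] q\<phi> by simp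
        qed
      qed auto
      then show "\<exists>g. homeomorphism u N fst g" unfolding u by blast
    qed
  qed
qed

text \<open>A convex set is simply connected, so the identity of \<open>U\<close> lifts to the
  pulled back covering; the second component of this lift is the desired map.\<close>

lemma lift_exists:
  fixes H :: "'c::real_normed_vector \<Rightarrow> 'b"
  assumes H: "continuous_map (top_of_set U) T H" and U: "convex U" "z0 \<in> U"
    and e0: "e0 \<in> E" "q e0 = H z0"
  obtains h where "continuous_map (top_of_set U) (top_of_set E) h" "h z0 = e0"
    "\<And>z. z \<in> U \<Longrightarrow> q (h z) = H z"
proof -
  let ?C = "{(z, e). z \<in> U \<and> e \<in> E \<and> H z = q e}"
  have "\<exists>g. continuous_on U g \<and> g \<in> U \<rightarrow> ?C \<and> g z0 = (z0, e0) \<and> (\<forall>y\<in>U. fst (g y) = y)"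
  proof (rule covering_space_lift_strong[OF pullback_covering[OF H], of "(z0, e0)" z0 U "\<lambda>z. z"])
    show "(z0, e0) \<in> ?C" "z0 \<in> U" using U e0 by auto
    show "simply_connected U" "locally path_connected U"
      using U(1) by (rule convex_imp_simply_connected, rule convex_imp_locally_path_connected)
    fix g assume "continuous_on U g" "g \<in> U \<rightarrow> ?C" "g z0 = (z0, e0)" "\<And>y. y \<in> U \<Longrightarrow> fst (g y) = y"
    then show "\<exists>g. continuous_on U g \<and> g \<in> U \<rightarrow> ?C \<and> g z0 = (z0, e0) \<and> (\<forall>y\<in>U. fst (g y) = y)"
      by (intro exI[of _ g]) simp
  qed auto
  then obtain g where g: "continuous_on U g" "g \<in> U \<rightarrow> ?C" "g z0 = (z0, e0)" "\<And>y. y \<in> U \<Longrightarrow> fst (g y) = y"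
    by (elim exE conjE) (rule that, assumption+, simp)
  have gC: "snd (g z) \<in> E" "H z = q (snd (g z))" if "z \<in> U" for z
  proof -
    have "(fst (g z), snd (g z)) \<in> ?C" using g(2) that by (simp add: Pi_iff)
    then show "snd (g z) \<in> E" "H z = q (snd (g z))" using g(4)[OF that] by auto
  qed
  show thesis
  proof
    show "continuous_map (top_of_set U) (top_of_set E) (\<lambda>z. snd (g z))"
      using gC(1) by (auto intro!: continuous_on_snd g(1))
    show "snd (g z0) = e0" using g by simp
    show "q (snd (g z)) = H z" if "z \<in> U" for z
      using gC(2)[OF that] by simp
  qed
qed

lemma lift_unique:
  fixes g h :: "'c::real_normed_vector \<Rightarrow> 'a"
  assumes g: "continuous_map (top_of_set U) (top_of_set E) g"
    and h: "continuous_map (top_of_set U) (top_of_set E) h"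
    and eq: "\<And>z. z \<in> U \<Longrightarrow> q (g z) = q (h z)"
    and U: "connected U" "z0 \<in> U" "g z0 = h z0" "z \<in> U"
  shows "g z = h z"
proof -
  have "continuous_map (top_of_set U) T (q \<circ> g)"
    by (rule continuous_map_compose[OF g cont])
  note cov = pullback_covering[OF this]
  have gh: "continuous_on U g" "continuous_on U h" "\<And>z. z \<in> U \<Longrightarrow> g z \<in> E" "\<And>z. z \<in> U \<Longrightarrow> h z \<in> E"
    using g h by auto
  have "(z, g z) = (z, h z)"
    by (rule covering_space_lift_unique[OF cov, where f = "\<lambda>z. z" and T = U and a = z0])
       (use gh eq U in \<open>auto intro!: continuous_intros\<close>)
  then show ?thesis by simp
qed

lemma path_lift:
  assumes p: "pathin T p" and e: "e \<in> E" "q e = p 0"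
  obtains \<gamma> where "pathin (top_of_set E) \<gamma>" "\<gamma> 0 = e" "\<And>t. t \<in> {0..1} \<Longrightarrow> q (\<gamma> t) = p t"
proof -
  have "convex {0..1::real}" "0 \<in> {0..1::real}" by auto
  from lift_exists[OF p[unfolded pathin_def] this e] show thesis
    using that unfolding pathin_def by metis
qed

text \<open>Uniqueness of lifts identifies the four edges of the lifted square. The paths upstairs
  need not be closed, only their images are; the last conclusion is the homotopy invariance of the
  end point, on which the projection from braids to \<open>W\<close> rests.\<close>

lemma homotopy_lift:
  assumes \<gamma>: "pathin (top_of_set E) \<gamma>" and \<gamma>': "pathin (top_of_set E) \<gamma>'" "\<gamma>' 0 = \<gamma> 0"
    and hom: "(p, p') \<in> loop_homotopic T y"
    and p: "\<And>t. t \<in> {0..1} \<Longrightarrow> q (\<gamma> t) = p t" "\<And>t. t \<in> {0..1} \<Longrightarrow> q (\<gamma>' t) = p' t"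
  obtains h where "continuous_map (top_of_set ({0..1::real} \<times> {0..1})) (top_of_set E) h"
    "\<And>t. t \<in> {0..1} \<Longrightarrow> h (0, t) = \<gamma> t" "\<And>t. t \<in> {0..1} \<Longrightarrow> h (1, t) = \<gamma>' t"
    "\<And>s. s \<in> {0..1} \<Longrightarrow> h (s, 0) = \<gamma> 0" "\<And>s. s \<in> {0..1} \<Longrightarrow> h (s, 1) = \<gamma> 1"
    "\<gamma>' 1 = \<gamma> 1"
proof -
  obtain H where H: "continuous_map (top_of_set ({0..1::real} \<times> {0..1})) T H"
    "\<And>t. H (0, t) = p t" "\<And>t. H (1, t) = p' t"
    "\<And>s. s \<in> {0..1} \<Longrightarrow> H (s, 0) = y" "\<And>s. s \<in> {0..1} \<Longrightarrow> H (s, 1) = y"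
    using hom by (rule loop_homotopicE) (rule that)
  have "\<gamma> 0 \<in> E" "\<gamma> 1 \<in> E" using path_start_in_topspace[OF \<gamma>] path_finish_in_topspace[OF \<gamma>] by auto
  have "q (\<gamma> 0) = H (0, 0)" using p(1)[of 0] H by simp
  then obtain h where h: "continuous_map (top_of_set ({0..1} \<times> {0..1})) (top_of_set E) h"
    "h (0, 0) = \<gamma> 0" "\<And>z. z \<in> {0..1} \<times> {0..1} \<Longrightarrow> q (h z) = H z"
    using lift_exists[OF H(1), of "(0, 0)" "\<gamma> 0"] \<open>\<gamma> 0 \<in> E\<close> by (auto simp: convex_Times)
  have vert: "continuous_map (top_of_set {0..1}) (top_of_set E) (\<lambda>t. h (s, t))" if "s \<in> {0..1}" for s
  proof -
    have "continuous_map (top_of_set {0..1}) (top_of_set ({0..1} \<times> {0..1})) (\<lambda>t. (s, t))"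
      using that by (auto intro!: continuous_on_Pair)
    from continuous_map_compose[OF this h(1)] show ?thesis by (simp only: o_def)
  qed
  have hor: "continuous_map (top_of_set {0..1}) (top_of_set E) (\<lambda>s. h (s, t))" if "t \<in> {0..1}" for t
  proof -
    have "continuous_map (top_of_set {0..1}) (top_of_set ({0..1} \<times> {0..1})) (\<lambda>s. (s, t))"
      using that by (auto intro!: continuous_on_Pair)
    from continuous_map_compose[OF this h(1)] show ?thesis by (simp only: o_def)
  qed
  have const: "continuous_map (top_of_set {0..1}) (top_of_set E) (\<lambda>s. e)" if "e \<in> E" for e
    using that by auto
  have c: "connected {0..1::real}" by simp
  have y0: "q (\<gamma> 0) = y" using p(1)[of 0] H(2)[of 0] H(4)[of 0] by simp
  have y1: "q (\<gamma> 1) = y" using p(1)[of 1] H(2)[of 1] H(5)[of 0] by simp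
  have left: "h (0, t) = \<gamma> t" if "t \<in> {0..1}" for t
    by (rule lift_unique[OF vert[of 0] \<gamma>[unfolded pathin_def] _ c, of 0]) (use that h H p in auto)
  have bot: "h (s, 0) = \<gamma> 0" if "s \<in> {0..1}" for s
    by (rule lift_unique[OF hor[of 0] const[OF \<open>\<gamma> 0 \<in> E\<close>] _ c, of 0]) (use that h H y0 in auto)
  have top: "h (s, 1) = \<gamma> 1" if "s \<in> {0..1}" for s
    by (rule lift_unique[OF hor[of 1] const[OF \<open>\<gamma> 1 \<in> E\<close>] _ c, of 0]) (use that h H y1 left in auto)
  have right: "h (1, t) = \<gamma>' t" if "t \<in> {0..1}" for t
    by (rule lift_unique[OF vert[of 1] \<gamma>'(1)[unfolded pathin_def] _ c, of 0]) (use that h H p bot \<gamma>'(2) in auto)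
  have "\<gamma>' 1 = \<gamma> 1" using right[of 1] top[of 1] by simp
  then show thesis using that[OF h(1) left right bot top] by blast
qed

end

section \<open>Irreducible reflection groups\<close>

lemma group_GL: "group (GL :: (complex^'n^'n) monoid)"
proof (rule groupI)
  fix A B :: "complex^'n^'n" assume "A \<in> carrier GL" "B \<in> carrier GL"
  then show "A \<otimes>\<^bsub>GL\<^esub> B \<in> carrier GL" by (simp add: GL_def invertible_mult)
next
  fix A :: "complex^'n^'n" assume "A \<in> carrier GL"
  then obtain B where "A ** B = mat 1" "B ** A = mat 1" by (auto simp: GL_def invertible_def)
  then show "\<exists>B\<in>carrier GL. B \<otimes>\<^bsub>GL\<^esub> A = \<one>\<^bsub>GL\<^esub>"
    by (intro bexI[of _ B]) (auto simp: GL_def invertible_def)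
qed (auto simp: GL_def matrix_mul_assoc invertible_def)

lemma GL_simps [simp]: "A \<otimes>\<^bsub>GL\<^esub> B = A ** B" "\<one>\<^bsub>GL\<^esub> = mat 1"
  by (simp_all add: GL_def)

locale irreducible_reflection_group =
  fixes W :: "(complex^'n^'n) set"
  assumes crg: "complex_reflection_group W"
    and irr: "acts_irreducibly W"
begin

lemma subgroup_W: "subgroup W GL"
  using crg by (simp add: complex_reflection_group_def)

lemma fin_W: "finite W"
  using crg by (simp add: complex_reflection_group_def)

lemma group_W: "group (W_group W)"
  by (rule subgroup.subgroup_is_group[OF subgroup_W group_GL])

lemma finite_order:
  assumes "g \<in> W" shows "g \<in> carrier GL \<and> (\<exists>k::nat. 0 < k \<and> g [^]\<^bsub>GL\<^esub> k = \<one>\<^bsub>GL\<^esub>)"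
proof -
  interpret WG: group "W_group W" by (rule group_W)
  interpret G: group "GL :: (complex^'n^'n) monoid" by (rule group_GL)
  have "g [^]\<^bsub>W_group W\<^esub> order (W_group W) = \<one>\<^bsub>GL\<^esub>"
    using WG.pow_order_eq_1[of g] assms by simp
  moreover have "0 < order (W_group W)"
    using fin_W assms by (auto simp: order_def card_gt_0_iff)
  ultimately show ?thesis
    using subgroup.subset[OF subgroup_W] assms by (auto simp: G.nat_pow_consistent[of g _ W])
qed

end

text \<open>\<open>generate\<close> also contains inverses of the generators. The inverse of a
  reflection has the same fixed space and is again a reflection, so right multiplications by
  reflections reach all of \<open>W\<close>.\<close>

sublocale irreducible_reflection_group \<subseteq> finite_reflection_group W
proof
  interpret G: group "GL :: (complex^'n^'n) monoid" by (rule group_GL)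
  show "finite W" by (rule fin_W)
  show one: "mat 1 \<in> W" using subgroup.one_closed[OF subgroup_W] by simp
  show mult: "g ** h \<in> W" if "g \<in> W" "h \<in> W" for g h
    using subgroup.m_closed[OF subgroup_W that] by simp
  show inv: "\<exists>h\<in>W. h ** g = mat 1 \<and> g ** h = mat 1" if "g \<in> W" for g
    using subgroup.m_inv_closed[OF subgroup_W that] subgroup.subset[OF subgroup_W] that
      G.l_inv[of g] G.r_inv[of g] by auto
  show reflI: "reflection g" if "g \<in> W" "vec.dim (fixed_space g) = CARD('n) - 1" for g
    using finite_order[OF that(1)] that(2) by (simp add: reflection_def)
  fix g P
  assume "g \<in> W" and P1: "P (mat 1)"
    and step: "\<And>g r. g \<in> W \<Longrightarrow> P g \<Longrightarrow> r \<in> W \<Longrightarrow> reflection r \<Longrightarrow> P (g ** r)"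
  obtain S where S: "\<And>r. r \<in> S \<Longrightarrow> reflection r" "W = generate GL S"
    using crg by (auto simp: complex_reflection_group_def)
  \<comment> \<open>Quantifying over all \<open>g\<close> makes the claim stable under products,
    which \<open>generate\<close> builds in any bracketing.\<close>
  have "h \<in> W \<and> (\<forall>g\<in>W. P g \<longrightarrow> P (g ** h))" if "h \<in> generate GL S" for h
    using that
  proof (induction rule: generate.induct)
    case one
    then show ?case using \<open>mat 1 \<in> W\<close> by simp
  next
    case (incl r)
    then show ?case using S step generate.incl[of r S GL] by blast
  next
    case (inv r)
    have r: "r \<in> W" "reflection r" using inv S generate.incl[of r S GL] by auto
    have iW: "inv\<^bsub>GL\<^esub> r \<in> W" using r subgroup.m_inv_closed[OF subgroup_W] by blast
    have i: "inv\<^bsub>GL\<^esub> r ** r = mat 1" "r ** inv\<^bsub>GL\<^esub> r = mat 1"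
      using r subgroup.subset[OF subgroup_W] G.l_inv[of r] G.r_inv[of r] by auto
    have "fixed_space (inv\<^bsub>GL\<^esub> r) = fixed_space r"
    proof -
      have "r *v v = v \<longleftrightarrow> inv\<^bsub>GL\<^esub> r *v v = v" for v
      proof
        assume "r *v v = v"
        then have "inv\<^bsub>GL\<^esub> r *v v = inv\<^bsub>GL\<^esub> r *v (r *v v)" by simp
        then show "inv\<^bsub>GL\<^esub> r *v v = v" by (simp only: matrix_vector_mul_assoc i matrix_vector_mul_lid)
      next
        assume "inv\<^bsub>GL\<^esub> r *v v = v"
        then have "r *v v = r *v (inv\<^bsub>GL\<^esub> r *v v)" by simp
        then show "r *v v = v" by (simp only: matrix_vector_mul_assoc i matrix_vector_mul_lid)
      qed
      then show ?thesis by (simp add: fixed_space_def)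
    qed
    then have "reflection (inv\<^bsub>GL\<^esub> r)" using r reflI[OF iW] by (simp add: reflection_def)
    then show ?case using iW step by blast
  next
    case (eng h1 h2)
    then show ?case by (auto simp: matrix_mul_assoc mult)
  qed
  then have "P (mat 1 ** g)" using \<open>g \<in> W\<close> S(2) one P1 by blast
  then show "P g" by simp
qed

text \<open>Discrete Fourier transform of the orbit of a nonzero vector \<open>v\<close>: for each
  \<open>k\<close>-th root of unity \<open>w m\<close>, the vector \<open>e m\<close> is zero or an
  eigenvector with eigenvalue \<open>1 / w m\<close>. The \<open>e m\<close> add up to
  \<open>k\<close> times \<open>v\<close>, so they cannot all vanish.\<close>

lemma eigenvector_finite_order:
  fixes z :: "complex^'n^'n"
  assumes "0 < k" "z [^]\<^bsub>GL\<^esub> (k::nat) = \<one>\<^bsub>GL\<^esub>"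
  obtains u c where "u \<noteq> 0" "z *v u = c *s u"
proof (rule ccontr)
  assume no: "\<not> thesis"
  define v :: "complex^'n" where "v = 1"
  define f where "f i = (z [^]\<^bsub>GL\<^esub> (i::nat)) *v v" for i
  interpret G: group "GL :: (complex^'n^'n) monoid" by (rule group_GL)
  have comm: "(z [^]\<^bsub>GL\<^esub> (i::nat)) ** z = z ** (z [^]\<^bsub>GL\<^esub> i)" for i
    by (induction i) (simp_all add: matrix_mul_assoc[symmetric])
  have f_Suc: "f (Suc i) = z *v f i" for i
    by (simp add: f_def comm matrix_vector_mul_assoc)
  have fk: "f k = f 0" by (simp add: f_def assms(2))
  define w where "w m = exp (2 * of_real pi * \<i> * of_nat m / of_nat k)" for m
  have w: "w m \<noteq> 0" "w m ^ k = 1" for m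
    using assms(1) by (simp_all add: w_def complex_root_unity)
  define e where "e m = (\<Sum>i<k. (w m) ^ i *s f i)" for m
  have e0: "e m = 0" for m
  proof (rule ccontr)
    assume "e m \<noteq> 0"
    have "w m *s (z *v e m) = (\<Sum>i<k. (w m) ^ Suc i *s f (Suc i))"
      by (simp add: e_def vec.sum vec.scale f_Suc vec.scale_sum_right cong: sum.cong)
    also have "\<dots> = (\<Sum>i<k. (w m) ^ i *s f i)"
      using sum.lessThan_Suc_shift[of "\<lambda>i. (w m) ^ i *s f i" k] fk w(2) by simp
    finally have "w m *s (z *v e m) = e m" by (simp add: e_def)
    then have "(1 / w m) *s (w m *s (z *v e m)) = (1 / w m) *s e m" by simp
    then have "z *v e m = (1 / w m) *s e m" using w(1) by simp
    with no that \<open>e m \<noteq> 0\<close> show False by blast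
  qed
  have sumw: "(\<Sum>m<k. (w m) ^ i) = (if i = 0 then of_nat k else 0)" if "i < k" for i
  proof (cases "i = 0")
    case False
    have wi: "(w m) ^ i = (w i) ^ m" for m
      by (simp add: w_def exp_of_nat_mult[symmetric] mult_ac)
    have "w i \<noteq> 1"
      using complex_root_unity_eq_1[of k i] assms(1) False that by (auto simp: w_def dest: dvd_imp_le)
    then have "(\<Sum>m<k. (w i) ^ m) = 0"
      using geometric_sum[of "w i" k] w(2)[of i] by simp
    then show ?thesis using False by (simp add: wi)
  qed simp
  have "0 = (\<Sum>m<k. e m)" by (simp add: e0)
  also have "\<dots> = (\<Sum>i<k. (\<Sum>m<k. (w m) ^ i) *s f i)"
    unfolding e_def by (subst sum.swap) (simp add: vec.scale_sum_left)
  also have "\<dots> = (\<Sum>i<k. if i = 0 then of_nat k *s f i else 0)"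
    by (intro sum.cong) (auto simp: sumw)
  also have "\<dots> = of_nat k *s v" using assms(1) by (simp add: f_def)
  finally have "of_nat k *s v = 0" by simp
  then show False using assms(1) by (simp add: v_def)
qed

section \<open>The free action on the complement, the center and the quotient by it\<close>

context irreducible_reflection_group
begin

abbreviation "X \<equiv> hyperplane_complement W"

text \<open>Steinberg's theorem in the form used from here on. The converse direction only needs
  that the identity is not a reflection.\<close>

lemma X_iff: "v \<in> X \<longleftrightarrow> (\<forall>g\<in>W. g *v v = v \<longrightarrow> g = mat 1)"
proof
  assume "v \<in> X"
  then have "\<And>r. r \<in> W \<Longrightarrow> reflection r \<Longrightarrow> r *v v \<noteq> v"
    by (auto simp: hyperplane_complement_def fixed_space_def)
  then show "\<forall>g\<in>W. g *v v = v \<longrightarrow> g = mat 1" using stabilizer_trivial by blast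
next
  assume "\<forall>g\<in>W. g *v v = v \<longrightarrow> g = mat 1"
  moreover have "\<not> reflection (mat 1 :: complex^'n^'n)"
  proof
    assume "reflection (mat 1 :: complex^'n^'n)"
    then have "vec.dim (UNIV :: (complex^'n) set) = CARD('n) - 1"
      by (simp add: reflection_def fixed_space_def)
    then have "CARD('n) = CARD('n) - 1" by (simp only: vec_dim_card)
    moreover have "0 < CARD('n)" by simp
    ultimately show False by linarith
  qed
  ultimately show "v \<in> X"
    by (auto simp: hyperplane_complement_def fixed_space_def)
qed

lemma W_free: "v \<in> X \<Longrightarrow> g \<in> W \<Longrightarrow> h \<in> W \<Longrightarrow> g *v v = h *v v \<Longrightarrow> g = h"
proof -
  assume v: "v \<in> X" and g: "g \<in> W" and h: "h \<in> W" and eq: "g *v v = h *v v"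
  obtain h' where h': "h' \<in> W" "h' ** h = mat 1" "h ** h' = mat 1" using inv[OF h] by blast
  have "(h' ** g) *v v = v"
    using eq by (metis h'(2) matrix_vector_mul_assoc matrix_vector_mul_lid)
  then have "h' ** g = mat 1" using v X_iff mult[OF h'(1) g] by blast
  then show "g = h" using h'(3) by (metis matrix_mul_assoc matrix_mul_lid matrix_mul_rid)
qed

lemma X_W: "v \<in> X \<Longrightarrow> g \<in> W \<Longrightarrow> g *v v \<in> X"
proof -
  assume v: "v \<in> X" and g: "g \<in> W"
  have "h = mat 1" if h: "h \<in> W" "h *v (g *v v) = g *v v" for h
  proof -
    have "h ** g = g"
      using W_free[OF v mult[OF h(1) g] g] h(2) by (simp add: matrix_vector_mul_assoc)
    then show ?thesis using inv[OF g] by (metis matrix_mul_assoc matrix_mul_rid)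
  qed
  then show ?thesis by (simp add: X_iff)
qed

lemma X_scale: "v \<in> X \<Longrightarrow> c \<noteq> 0 \<Longrightarrow> c *s v \<in> X"
  unfolding X_iff by (metis vec.scale vec.scale_cancel_left)

lemma W_nonzero: "g \<in> W \<Longrightarrow> g *v v = 0 \<Longrightarrow> v = 0"
  using inv by (metis matrix_vector_mul_assoc matrix_vector_mul_lid matrix_vector_mult_0_right)

lemma open_X: "open X"
proof -
  have "X = (\<Inter>r \<in> {r \<in> W. reflection r}. {v. r *v v \<noteq> v})"
    by (auto simp: hyperplane_complement_def fixed_space_def)
  also have "open \<dots>"
    using fin_W by (intro open_INT ballI open_Collect_neq continuous_intros) auto
  finally show ?thesis .
qed

text \<open>The complex line through \<open>a\<close> and \<open>b\<close> meets the hyperplanes in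
  finitely many points, and the complex plane minus a finite set is path connected.\<close>

lemma path_connected_X:
  assumes a: "a \<in> X" and b: "b \<in> X"
  obtains \<gamma> where "pathin (top_of_set X) \<gamma>" "\<gamma> 0 = a" "\<gamma> 1 = b"
proof -
  define l where "l t = a + t *s (b - a)" for t
  define B where "B = {t. l t \<notin> X}"
  have "finite {t. r *v l t = l t}" if r: "r \<in> W" "reflection r" for r
  proof -
    obtain \<alpha> d where \<alpha>: "\<And>v. r *v v = v \<longleftrightarrow> \<alpha> v = 0" "\<And>c v. \<alpha> (c *s v) = c * \<alpha> v"
        "\<And>u v. \<alpha> (u + v) = \<alpha> u + \<alpha> v"
      using reflection_root[OF r(2)] by metis
    have "\<alpha> a \<noteq> 0" using a r \<alpha>(1) by (auto simp: hyperplane_complement_def fixed_space_def)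
    \<comment> \<open>The form \<open>\<alpha>\<close> is affine in \<open>t\<close> along the line,
      with nonzero constant term. If its slope is 0 it has no zero, and the inclusion holds whatever
      the quotient by 0 is.\<close>
    have "{t. r *v l t = l t} \<subseteq> {- \<alpha> a / \<alpha> (b - a)}"
    proof
      fix t assume "t \<in> {t. r *v l t = l t}"
      then have "\<alpha> a + t * \<alpha> (b - a) = 0" by (simp only: \<alpha> l_def mem_Collect_eq)
      with \<open>\<alpha> a \<noteq> 0\<close> show "t \<in> {- \<alpha> a / \<alpha> (b - a)}"
        by (cases "\<alpha> (b - a) = 0") (auto simp: field_simps add_eq_0_iff2)
    qed
    then show ?thesis using finite_subset by blast
  qed
  moreover have "B = (\<Union>r \<in> {r \<in> W. reflection r}. {t. r *v l t = l t})"
    by (auto simp: B_def hyperplane_complement_def fixed_space_def)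
  ultimately have "finite B" using fin_W by simp
  then have "path_connected (- B)"
    by (intro path_connected_complement_countable countable_finite) auto
  moreover have "0 \<in> - B" "1 \<in> - B" using a b by (auto simp: B_def l_def)
  ultimately obtain p where p: "path p" "path_image p \<subseteq> - B" "pathstart p = 0" "pathfinish p = 1"
    unfolding path_connected_def by blast
  show thesis
  proof
    show "pathin (top_of_set X) (l \<circ> p)"
      unfolding pathin_canon_iff
    proof
      show "path (l \<circ> p)"
        unfolding path_def l_def vector_scalar_mult_def o_def
        using p(1) by (intro continuous_intros) (simp add: path_def)
      show "l \<circ> p \<in> {0..1} \<rightarrow> X" using p(2) by (auto simp: path_image_def B_def)
    qed
    show "(l \<circ> p) 0 = a" "(l \<circ> p) 1 = b"
      using p(3,4) by (auto simp: pathstart_def pathfinish_def l_def)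
  qed
qed

lemma in_W_center: "z \<in> W_center W \<longleftrightarrow> z \<in> W \<and> (\<forall>g\<in>W. z ** g = g ** z)"
  by (auto simp: W_center_def center_def)

lemma W_center_W: "z \<in> W_center W \<Longrightarrow> z \<in> W"
  unfolding in_W_center by (rule conjunct1)

text \<open>Schur's lemma: an eigenspace of a central element is stable under \<open>W\<close>,
  hence is the whole space.\<close>

lemma center_scalar:
  assumes z: "z \<in> W_center W" shows "\<exists>c. c \<noteq> 0 \<and> (\<forall>v. z *v v = c *s v)"
proof -
  have zW: "z \<in> W" by (rule W_center_W[OF z])
  obtain u c where u: "u \<noteq> 0" "z *v u = c *s u"
    using finite_order[OF zW] eigenvector_finite_order by metis
  let ?U = "{v. z *v v = c *s v}"
  have "vec.subspace ?U"
    unfolding vec.subspace_def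
    by (auto simp: matrix_vector_right_distrib vec.scale vec.scale_right_distrib mult.commute)
  moreover have "(*v) g ` ?U \<subseteq> ?U" if "g \<in> W" for g
  proof clarify
    fix v assume v: "z *v v = c *s v"
    have "z *v (g *v v) = g *v (z *v v)"
      using z that unfolding in_W_center matrix_vector_mul_assoc by metis
    then show "z *v (g *v v) = c *s (g *v v)" by (simp add: v vec.scale)
  qed
  ultimately have "?U = {0} \<or> ?U = UNIV"
    using irr[unfolded acts_irreducibly_def, THEN spec, of ?U] by blast
  then have all: "\<And>v. z *v v = c *s v" using u by blast
  moreover have "c \<noteq> 0"
    using W_nonzero[OF zW, of u] u by auto
  ultimately show ?thesis by blast
qed

lemma center_scalarE:
  assumes "z \<in> W_center W" obtains c where "c \<noteq> 0" "\<And>v. z *v v = c *s v"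
proof -
  from center_scalar[OF assms] obtain c where "c \<noteq> 0 \<and> (\<forall>v. z *v v = c *s v)" ..
  then show thesis by (intro that[of c]) simp_all
qed

lemma scalar_center:
  assumes "g \<in> W" "\<And>v. g *v v = c *s v" shows "g \<in> W_center W"
proof -
  have "g ** h = h ** g" for h
    by (simp add: matrix_eq assms(2) vec.scale flip: matrix_vector_mul_assoc)
  then show ?thesis using assms by (simp add: in_W_center)
qed

lemma subgroup_center: "subgroup (W_center W) GL"
proof -
  interpret G: group "GL :: (complex^'n^'n) monoid" by (rule group_GL)
  show ?thesis
  proof (rule G.subgroupI)
    show "W_center W \<subseteq> carrier GL"
      using subgroup.subset[OF subgroup_W] by (auto simp: in_W_center)
    show "W_center W \<noteq> {}" using one by (metis in_W_center empty_iff matrix_mul_lid matrix_mul_rid)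
    fix a b assume a: "a \<in> W_center W" and b: "b \<in> W_center W"
    obtain c where c: "\<And>v. a *v v = c *s v" by (rule center_scalarE[OF a]) (rule that)
    obtain d where d: "\<And>v. b *v v = d *s v" by (rule center_scalarE[OF b]) (rule that)
    show "a \<otimes>\<^bsub>GL\<^esub> b \<in> W_center W"
    proof (rule scalar_center)
      show "a \<otimes>\<^bsub>GL\<^esub> b \<in> W" using mult[OF W_center_W[OF a] W_center_W[OF b]] by simp
      show "(a \<otimes>\<^bsub>GL\<^esub> b) *v v = (c * d) *s v" for v
        by (simp only: GL_simps matrix_vector_mul_assoc[symmetric] c d vec.scale vec.scale_scale mult.commute)
    qed
  next
    fix a assume a: "a \<in> W_center W"
    obtain c where c: "c \<noteq> 0" "\<And>v. a *v v = c *s v" by (rule center_scalarE[OF a]) (rule that)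
    have aW: "a \<in> W" by (rule W_center_W[OF a])
    have iW: "inv\<^bsub>GL\<^esub> a \<in> W" using aW subgroup.m_inv_closed[OF subgroup_W] by blast
    have i: "a ** inv\<^bsub>GL\<^esub> a = mat 1"
      using aW subgroup.subset[OF subgroup_W] G.r_inv[of a] by auto
    have "inv\<^bsub>GL\<^esub> a *v v = (1 / c) *s v" for v
    proof -
      have "c *s (inv\<^bsub>GL\<^esub> a *v v) = v"
        using i by (metis c(2) matrix_vector_mul_assoc matrix_vector_mul_lid)
      then have "(1 / c) *s (c *s (inv\<^bsub>GL\<^esub> a *v v)) = (1 / c) *s v" by simp
      then show ?thesis using c(1) by simp
    qed
    with iW show "inv\<^bsub>GL\<^esub> a \<in> W_center W" by (rule scalar_center)
  qed
qed

abbreviation "d \<equiv> card (W_center W)"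

lemma fin_center: "finite (W_center W)"
  by (rule finite_subset[OF _ fin_W]) (use W_center_W in blast)

lemma d_pos: "0 < d"
  using fin_center subgroup.one_closed[OF subgroup_center] by (auto simp: card_gt_0_iff)

text \<open>The scalars of the center are \<open>d\<close> distinct numbers, all \<open>d\<close>-th
  roots of unity by Lagrange; there are only \<open>d\<close> such roots, so all of them
  occur.\<close>

lemma center_roots_of_unity:
  "(\<exists>z\<in>W_center W. \<forall>v. z *v v = c *s v) \<longleftrightarrow> c ^ d = 1"
proof -
  interpret G: group "GL :: (complex^'n^'n) monoid" by (rule group_GL)
  interpret Z: group "Z_group W" by (rule subgroup.subgroup_is_group[OF subgroup_center group_GL])
  let ?R = "{c::complex. c ^ d = 1}"
  obtain s where s: "\<And>z v. z \<in> W_center W \<Longrightarrow> z *v v = s z *s v"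
    using center_scalar by metis
  have unique: "a = b" if "\<forall>v::complex^'n. a *s v = b *s v" for a b
    using spec[OF that, of 1] by (simp add: Finite_Cartesian_Product.vec_eq_iff)
  have "s z ^ d = 1" if z: "z \<in> W_center W" for z
  proof -
    have pow: "(z [^]\<^bsub>GL\<^esub> k) *v v = s z ^ k *s v" for k :: nat and v
      by (induction k arbitrary: v) (simp_all add: s[OF z] vec.scale mult.commute flip: matrix_vector_mul_assoc)
    have "z [^]\<^bsub>Z_group W\<^esub> order (Z_group W) = \<one>\<^bsub>GL\<^esub>"
      using Z.pow_order_eq_1[of z] z by simp
    then have "z [^]\<^bsub>GL\<^esub> d = mat 1" by (simp add: order_def G.nat_pow_consistent[of z _ "W_center W"])
    then have "mat 1 *v v = s z ^ d *s v" for v :: "complex^'n" using pow[of d v] by (simp only:)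
    then have "\<forall>v::complex^'n. s z ^ d *s v = 1 *s v" by (metis matrix_vector_mul_lid vec.scale_one)
    then show ?thesis by (rule unique)
  qed
  then have "s ` W_center W \<subseteq> ?R" by blast
  moreover have "inj_on s (W_center W)"
    by (rule inj_onI) (metis matrix_eq s)
  then have "card (s ` W_center W) = card ?R"
    using card_roots_unity_eq[OF d_pos] by (simp add: card_image)
  moreover have "finite ?R" using card_roots_unity_eq[OF d_pos] d_pos card_gt_0_iff by metis
  ultimately have im: "s ` W_center W = ?R" by (metis card_subset_eq)
  show ?thesis
  proof
    assume "\<exists>z\<in>W_center W. \<forall>v. z *v v = c *s v"
    then obtain z where z: "z \<in> W_center W" "\<forall>v. z *v v = c *s v" by blast
    then have "\<forall>v::complex^'n. s z *s v = c *s v" using s[OF z(1)] by simp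
    then have "s z = c" by (rule unique)
    then show "c ^ d = 1" using imageI[OF z(1), of s] unfolding im by simp
  next
    assume "c ^ d = 1"
    then have "c \<in> s ` W_center W" unfolding im by simp
    then obtain z where z: "c = s z" "z \<in> W_center W" ..
    show "\<exists>z\<in>W_center W. \<forall>v. z *v v = c *s v"
      by (rule bexI[OF _ z(2)]) (simp only: s[OF z(2)] z(1) simp_thms)
  qed
qed

lemma normal_center: "W_center W \<lhd> W_group W"
proof -
  interpret WG: group "W_group W" by (rule group_W)
  have "subgroup (W_center W) (W_group W)"
    by (rule group.subgroup_incl[OF group_GL subgroup_center subgroup_W]) (auto simp: in_W_center)
  moreover have "W_center W #>\<^bsub>W_group W\<^esub> g = g <#\<^bsub>W_group W\<^esub> W_center W" if "g \<in> W" for g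
  proof -
    have "{z ** g |z. z \<in> W_center W} = {g ** z |z. z \<in> W_center W}"
      using that unfolding in_W_center by metis
    then show ?thesis by (auto simp: r_coset_def l_coset_def set_eq_iff)
  qed
  ultimately show ?thesis by (intro WG.normalI ballI) simp_all
qed

lemma group_hat_W: "group (hat_W W)"
  unfolding hat_W_def by (rule normal.factorgroup_is_group[OF normal_center])

lemma to_hat_W_hom: "to_hat_W W \<in> hom (W_group W) (hat_W W)"
proof -
  have "to_hat_W W = (\<lambda>g. W_center W #>\<^bsub>W_group W\<^esub> g)"
    by (simp only: to_hat_W_def fun_eq_iff simp_thms)
  then show ?thesis
    unfolding hat_W_def using normal.r_coset_hom_Mod[OF normal_center] by (simp only:)
qed

lemma to_hat_W_surj: "to_hat_W W ` W = carrier (hat_W W)"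
  by (auto simp: hat_W_def to_hat_W_def FactGroup_def RCOSETS_def)

lemma to_hat_W_one: "g \<in> W \<Longrightarrow> to_hat_W W g = \<one>\<^bsub>hat_W W\<^esub> \<longleftrightarrow> g \<in> W_center W"
proof -
  assume g: "g \<in> W"
  interpret N: normal "W_center W" "W_group W" by (rule normal_center)
  show ?thesis
    unfolding hat_W_def to_hat_W_def FactGroup_def
    using g N.coset_join1[OF _ _ N.subgroup_axioms, of g] N.coset_join2[OF _ N.subgroup_axioms, of g]
    by (simp only: monoid.simps partial_object.simps) auto
qed

end

section \<open>The four spaces\<close>

lemma topspace_quotient_topology: "topspace (quotient_topology Y f) = f ` topspace Y"
  using quotient_imp_surjective_map[OF quotient_map_quotient_topology] by metis

lemma continuous_map_quotient_topology: "continuous_map Y (quotient_topology Y f) f"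
  by (rule quotient_imp_continuous_map[OF quotient_map_quotient_topology])

lemma line_image:
  fixes g :: "complex^'n^'n"
  assumes "h ** g = mat 1" "g ** h = mat 1"
  shows "(*v) g ` line v = line (g *v v)"
proof -
  have hg: "h *v (g *v w) = w" "g *v (h *v w) = w" for w
    by (simp_all add: matrix_vector_mul_assoc assms)
  have z: "g *v v = 0 \<longleftrightarrow> v = 0" by (metis hg(1) matrix_vector_mult_0_right)
  show ?thesis
  proof (cases "v = 0")
    case True
    have "w \<in> range ((*v) g)" for w using hg(2)[of w] by (metis rangeI)
    then show ?thesis using True by (auto simp: line_def)
  next
    case False
    then have "(*v) g ` line v = (*v) g ` range (\<lambda>k. k *s v)"
      by (simp add: line_def vec.span_singleton)
    also have "\<dots> = range (\<lambda>k. k *s (g *v v))" by (simp add: image_image vec.scale)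
    also have "\<dots> = line (g *v v)" using False z by (simp add: line_def vec.span_singleton)
    finally show ?thesis .
  qed
qed

lemma line_scale: "c \<noteq> 0 \<Longrightarrow> line (c *s v) = line v"
proof -
  assume c: "c \<noteq> 0"
  have "range (\<lambda>k. k *s (c *s v)) = range (\<lambda>k. k *s v)"
  proof (intro equalityI subsetI)
    fix w assume "w \<in> range (\<lambda>k. k *s v)"
    then obtain k where "w = k *s v" ..
    then have "w = (k / c) *s (c *s v)" using c by simp
    then show "w \<in> range (\<lambda>k. k *s (c *s v))" by blast
  qed auto
  then show ?thesis using c by (simp add: line_def vec.span_singleton)
qed

lemma line_eq_iff:
  assumes "u \<noteq> 0" "v \<noteq> 0"
  shows "line u = line v \<longleftrightarrow> (\<exists>c. c \<noteq> 0 \<and> u = c *s v)"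
proof
  assume "line u = line v"
  moreover have "u \<in> line u" by (simp add: line_def vec.span_base)
  ultimately have "u \<in> range (\<lambda>k. k *s v)" using assms by (simp add: line_def vec.span_singleton)
  then obtain c where "u = c *s v" ..
  then show "\<exists>c. c \<noteq> 0 \<and> u = c *s v" using assms by (intro exI[of _ c]) auto
qed (auto simp: line_scale)

section \<open>Orbit spaces of vectors and of lines\<close>

context irreducible_reflection_group
begin

lemma W_orbit_image: "W_orbit W v = (\<lambda>g. g *v v) ` W"
  by (auto simp: W_orbit_def orbit_def)

lemma W_orbit_eq_iff: "W_orbit W u = W_orbit W v \<longleftrightarrow> (\<exists>g\<in>W. v = g *v u)"
proof
  assume "W_orbit W u = W_orbit W v"
  moreover have "v \<in> W_orbit W v" using one by (force simp: W_orbit_image)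
  ultimately show "\<exists>g\<in>W. v = g *v u" by (auto simp: W_orbit_image)
next
  assume "\<exists>g\<in>W. v = g *v u"
  then obtain g where g: "g \<in> W" "v = g *v u" by blast
  have "W_orbit W v = (\<lambda>h. h *v u) ` (\<lambda>h. h ** g) ` W"
    by (simp add: W_orbit_image g image_image matrix_vector_mul_assoc)
  also have "(\<lambda>h. h ** g) ` W = W"
    using bij_mult_right[OF g(1)] by (simp add: bij_betw_def)
  finally show "W_orbit W u = W_orbit W v" by (simp add: W_orbit_image)
qed

text \<open>Central elements multiply by nonzero scalars and preserve every line, so the union over
  the coset is a single line.\<close>

lemma act_on_lines_coset:
  assumes "g \<in> W" shows "act_on_lines (to_hat_W W g) (line v) = line (g *v v)"
proof -
  have "(*v) (z ** g) ` line v = line (g *v v)" if z: "z \<in> W_center W" for z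
  proof -
    obtain c where c: "c \<noteq> 0" "\<And>v. z *v v = c *s v" by (rule center_scalarE[OF z]) (rule that)
    obtain h where h: "h ** (z ** g) = mat 1" "(z ** g) ** h = mat 1"
      using inv[OF mult[OF W_center_W[OF z] assms]] by blast
    have "(*v) (z ** g) ` line v = line ((z ** g) *v v)" by (rule line_image[OF h])
    also have "(z ** g) *v v = c *s (g *v v)" by (simp add: c flip: matrix_vector_mul_assoc)
    finally show ?thesis using c(1) by (simp add: line_scale)
  qed
  moreover have "mat 1 \<in> W_center W" using subgroup.one_closed[OF subgroup_center] by simp
  moreover have "to_hat_W W g = (\<lambda>z. z ** g) ` W_center W"
    by (auto simp: to_hat_W_def r_coset_def)
  ultimately show ?thesis unfolding act_on_lines_def by auto
qed

lemma hat_W_orbit_line: "hat_W_orbit W (line v) = (\<lambda>g. line (g *v v)) ` W"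
proof -
  have "hat_W_orbit W (line v) = (\<lambda>C. act_on_lines C (line v)) ` carrier (hat_W W)"
    by (auto simp: hat_W_orbit_def orbit_def)
  also have "\<dots> = (\<lambda>g. act_on_lines (to_hat_W W g) (line v)) ` W"
    by (simp only: image_image flip: to_hat_W_surj)
  also have "\<dots> = (\<lambda>g. line (g *v v)) ` W" by (rule image_cong) (simp_all add: act_on_lines_coset)
  finally show ?thesis .
qed

lemma hat_W_orbit_W: "g \<in> W \<Longrightarrow> hat_W_orbit W (line (g *v v)) = hat_W_orbit W (line v)"
proof -
  assume g: "g \<in> W"
  have "hat_W_orbit W (line (g *v v)) = (\<lambda>h. line (h *v v)) ` (\<lambda>h. h ** g) ` W"
    by (simp add: hat_W_orbit_line image_image matrix_vector_mul_assoc)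
  also have "(\<lambda>h. h ** g) ` W = W"
    using bij_mult_right[OF g] by (simp add: bij_betw_def)
  finally show ?thesis by (simp add: hat_W_orbit_line)
qed

lemma hat_W_orbit_eq_iff:
  "hat_W_orbit W (line u) = hat_W_orbit W (line v) \<longleftrightarrow> (\<exists>g\<in>W. line v = line (g *v u))"
proof
  assume "hat_W_orbit W (line u) = hat_W_orbit W (line v)"
  moreover have "line v \<in> hat_W_orbit W (line v)" using one by (force simp: hat_W_orbit_line)
  ultimately have "line v \<in> hat_W_orbit W (line u)" by (simp only:)
  then show "\<exists>g\<in>W. line v = line (g *v u)" unfolding hat_W_orbit_line by (rule imageE) blast
next
  assume "\<exists>g\<in>W. line v = line (g *v u)"
  then show "hat_W_orbit W (line u) = hat_W_orbit W (line v)" using hat_W_orbit_W by metis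
qed

lemma orbit_proj_W_orbit: "orbit_proj W (W_orbit W v) = hat_W_orbit W (line v)"
proof -
  have "(\<Union>g\<in>W. hat_W_orbit W (line (g *v v))) = (\<Union>g\<in>W. hat_W_orbit W (line v))"
    by (rule SUP_cong) (simp_all add: hat_W_orbit_W)
  then show ?thesis using one by (auto simp: orbit_proj_def W_orbit_image)
qed

lemma topspace_X_mod_W: "topspace (X_mod_W W) = W_orbit W ` X"
  by (simp add: X_mod_W_def topspace_quotient_topology)

lemma continuous_W_orbit: "continuous_map (X_top W) (X_mod_W W) (W_orbit W)"
  unfolding X_mod_W_def by (rule continuous_map_quotient_topology)

lemma open_map_W_orbit: "open_map (X_top W) (X_mod_W W) (W_orbit W)"
  unfolding open_map_def
proof (intro allI impI)
  fix A assume A: "openin (X_top W) A"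
  then have oA: "open A" "A \<subseteq> X" using open_X by (auto simp: openin_open_eq)
  have "{v \<in> X. W_orbit W v \<in> W_orbit W ` A} = X \<inter> (\<Union>g\<in>W. (*v) g -` A)"
    by (auto simp: W_orbit_eq_iff image_iff)
  also have "open \<dots>"
    using open_X by (intro open_Int open_UN ballI open_vimage oA continuous_intros) auto
  finally have "openin (X_top W) {v \<in> X. W_orbit W v \<in> W_orbit W ` A}"
    using open_X by (auto simp: openin_open_eq)
  then show "openin (X_mod_W W) (W_orbit W ` A)"
    using oA(2) by (auto simp: X_mod_W_def openin_quotient_topology)
qed

lemma free_quotient_X: "free_quotient X (X_mod_W W) (W_orbit W) ((*v) ` W)"
proof
  show "W_orbit W ` X = topspace (X_mod_W W)" by (simp add: topspace_X_mod_W)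
  show "finite ((*v) ` W)" using fin_W by simp
  show "\<exists>\<psi>. homeomorphism X X \<phi> \<psi>" if "\<phi> \<in> (*v) ` W" for \<phi>
  proof -
    from that obtain g where g: "\<phi> = (*v) g" "g \<in> W" ..
    obtain h where h: "h \<in> W" "h ** g = mat 1" "g ** h = mat 1" using inv[OF g(2)] by blast
    have "homeomorphism X X ((*v) g) ((*v) h)"
      by (rule homeomorphismI)
         (auto simp: X_W g h matrix_vector_mul_assoc intro!: continuous_intros)
    then show ?thesis using g(1) by blast
  qed
  show "W_orbit W u = W_orbit W v \<longleftrightarrow> (\<exists>\<phi>\<in>(*v) ` W. v = \<phi> u)" for u v
    by (auto simp: W_orbit_eq_iff)
  show "\<phi> = \<psi>" if "\<phi> \<in> (*v) ` W" "\<psi> \<in> (*v) ` W" "v \<in> X" "\<phi> v = \<psi> v" for \<phi> \<psi> v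
    using that W_free by blast
qed (simp_all add: continuous_W_orbit open_map_W_orbit)

lemma topspace_hat_X: "topspace (hat_X W) = line ` (X - {0})"
  by (auto simp: hat_X_def projective_space_def topspace_quotient_topology)

text \<open>\<open>X - {0}\<close> is open and a union of punctured lines. For such a set the
  subspace topology of the quotient is the quotient topology of the subspace, so openness can be
  tested on vectors.\<close>

lemma openin_hat_X:
  "openin (hat_X W) S \<longleftrightarrow> S \<subseteq> line ` (X - {0}) \<and> open {v \<in> X - {0}. line v \<in> S}"
proof -
  have o: "open (X - {0})" using open_X by (intro open_Diff) auto
  have proj: "openin projective_space T \<longleftrightarrow> T \<subseteq> line ` (- {0}) \<and> open {v \<in> - {0::complex^'n}. line v \<in> T}" for T
  proof -
    have "open (- {0::complex^'n})" by auto
    then show ?thesis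
      unfolding projective_space_def openin_quotient_topology by (auto simp: openin_open_eq)
  qed
  show ?thesis
  proof
    assume "openin (hat_X W) S"
    then obtain T where T: "openin projective_space T" "S = T \<inter> line ` (X - {0})"
      by (auto simp: hat_X_def openin_subtopology)
    have "{v \<in> X - {0}. line v \<in> S} = (X - {0}) \<inter> {v \<in> - {0}. line v \<in> T}"
      using T(2) by auto
    then show "S \<subseteq> line ` (X - {0}) \<and> open {v \<in> X - {0}. line v \<in> S}"
      using T o by (auto simp: proj intro: open_Int)
  next
    assume S: "S \<subseteq> line ` (X - {0}) \<and> open {v \<in> X - {0}. line v \<in> S}"
    have "{v \<in> - {0}. line v \<in> S} = {v \<in> X - {0}. line v \<in> S}"
    proof (intro equalityI subsetI)
      fix v assume v: "v \<in> {v \<in> - {0}. line v \<in> S}"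
      then obtain u where u: "u \<in> X" "u \<noteq> 0" "line v = line u" using S by auto
      then obtain c where "c \<noteq> 0" "v = c *s u" using v by (auto simp: line_eq_iff)
      then show "v \<in> {v \<in> X - {0}. line v \<in> S}" using v u X_scale by auto
    qed auto
    then have "openin projective_space S" using S by (auto simp: proj)
    then show "openin (hat_X W) S"
      using S by (auto simp: hat_X_def openin_subtopology)
  qed
qed

lemma topspace_hat_X_mod: "topspace (hat_X_mod_hat_W W) = (\<lambda>v. hat_W_orbit W (line v)) ` (X - {0})"
  by (simp add: hat_X_mod_hat_W_def topspace_quotient_topology topspace_hat_X image_image)

lemma openin_hat_X_mod:
  "openin (hat_X_mod_hat_W W) S \<longleftrightarrow> S \<subseteq> (\<lambda>v. hat_W_orbit W (line v)) ` (X - {0}) \<and>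
     open {v \<in> X - {0}. hat_W_orbit W (line v) \<in> S}"
proof -
  have "{v \<in> X - {0}. line v \<in> {L \<in> line ` (X - {0}). hat_W_orbit W L \<in> S}} =
      {v \<in> X - {0}. hat_W_orbit W (line v) \<in> S}" by auto
  moreover have "{L \<in> line ` (X - {0}). hat_W_orbit W L \<in> S} \<subseteq> line ` (X - {0})" by blast
  ultimately show ?thesis
    unfolding hat_X_mod_hat_W_def openin_quotient_topology openin_hat_X topspace_hat_X image_image
    by (simp only: simp_thms)
qed

text \<open>Every element fixes 0, so freeness leaves only the identity; every line is then stable,
  and irreducibility makes it the whole space.\<close>

lemma trivial_case:
  assumes "0 \<in> X" shows "W = {mat 1}" "line (v :: complex^'n) = UNIV"
proof -
  have "g = mat 1" if "g \<in> W" for g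
    using assms[unfolded X_iff, rule_format, OF that] by simp
  then show W: "W = {mat 1}" using one by blast
  have "vec.span {v} = {0} \<or> vec.span {v} = UNIV"
    using irr[unfolded acts_irreducibly_def, THEN spec, of "vec.span {v}"] by (simp add: W)
  then show "line v = UNIV"
    using vec.span_base[of v "{v}"] by (auto simp: line_def)
qed

lemma continuous_line:
  assumes "x \<in> X" "x \<noteq> 0" shows "continuous_map (X_top W) (hat_X W) line"
proof (cases "0 \<in> X")
  case True
  have "UNIV \<in> line ` (X - {0})" using assms trivial_case(2)[OF True, of x] by (force simp: image_iff)
  then have "continuous_map (X_top W) (hat_X W) (\<lambda>_. UNIV)" by (simp add: topspace_hat_X)
  moreover have "line = (\<lambda>_::complex^'n. UNIV)" using trivial_case(2)[OF True] by blast
  ultimately show ?thesis by simp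
next
  case False
  then have "X - {0} = X" by auto
  then show ?thesis
    using open_X by (auto simp: continuous_map_def topspace_hat_X openin_hat_X openin_open_eq)
qed

lemma continuous_hat_W_orbit: "continuous_map (hat_X W) (hat_X_mod_hat_W W) (hat_W_orbit W)"
  unfolding hat_X_mod_hat_W_def by (rule continuous_map_quotient_topology)

lemma continuous_hat_W_orbit_line:
  assumes "x \<in> X" "x \<noteq> 0"
  shows "continuous_map (X_top W) (hat_X_mod_hat_W W) (\<lambda>v. hat_W_orbit W (line v))"
  using continuous_map_compose[OF continuous_line[OF assms] continuous_hat_W_orbit] by (simp add: o_def)

lemma continuous_orbit_proj:
  assumes "x \<in> X" "x \<noteq> 0"
  shows "continuous_map (X_mod_W W) (hat_X_mod_hat_W W) (orbit_proj W)"
proof -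
  have "orbit_proj W \<circ> W_orbit W = (\<lambda>v. hat_W_orbit W (line v))"
    by (simp add: fun_eq_iff orbit_proj_W_orbit)
  then have "continuous_map (X_top W) (hat_X_mod_hat_W W) (orbit_proj W \<circ> W_orbit W)"
    using continuous_hat_W_orbit_line[OF assms] by (simp only:)
  then show ?thesis
    using continuous_compose_quotient_map_eq[OF quotient_map_quotient_topology[of "X_top W" "W_orbit W"]]
    unfolding X_mod_W_def by blast
qed

end

section \<open>The slice on which a linear form equals one\<close>

text \<open>When \<open>l\<close> is a linear form vanishing on one of the reflecting hyperplanes, every line in
  the complement meets the affine hyperplane \<open>l = 1\<close> in exactly one point. This trivializes the
  bundle of nonzero vectors over the projectivized complement.\<close>

locale sliced_reflection_group = irreducible_reflection_group W for W :: "(complex^'n^'n) set" +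
  fixes l :: "complex^'n \<Rightarrow> complex" and x :: "complex^'n"
  assumes x_X: "x \<in> hyperplane_complement W"
    and l_cont: "continuous_on UNIV l"
    and l_scale: "l (c *s v) = c * l v"
    and l_nonzero: "v \<in> hyperplane_complement W \<Longrightarrow> l v \<noteq> 0"

text \<open>If 0 is missing from the complement, some reflection exists; its root form vanishes on
  its hyperplane only.\<close>

lemma (in irreducible_reflection_group) slice_exists:
  assumes "0 \<notin> X" "x \<in> X" obtains l where "sliced_reflection_group W l x"
proof -
  obtain r where r: "r \<in> W" "reflection r"
    using assms by (auto simp: hyperplane_complement_def)
  obtain \<alpha> where \<alpha>: "hpoly (Suc 0) \<alpha>" "\<And>v. r *v v = v \<longleftrightarrow> \<alpha> v = 0" "\<And>c v. \<alpha> (c *s v) = c * \<alpha> v"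
    using reflection_root[OF r(2)] by metis
  have "sliced_reflection_group W \<alpha> x"
  proof
    show "x \<in> X" by fact
    show "continuous_on UNIV \<alpha>" by (rule continuous_on_hpoly[OF \<alpha>(1)])
    show "\<alpha> v \<noteq> 0" if "v \<in> X" for v
      using that r \<alpha>(2) by (auto simp: hyperplane_complement_def fixed_space_def)
  qed (rule \<alpha>(3))
  then show thesis by (rule that)
qed

context sliced_reflection_group
begin

definition "Y = {v \<in> X. l v = 1}"

text \<open>For \<open>v\<close> in the complement, the point where the line of \<open>v\<close>
  meets the slice \<open>Y\<close>.\<close>

definition "nrm v = (1 / l v) *s v"

lemma zero_notin_X: "0 \<notin> X"
  using l_nonzero[of 0] l_scale[of 0 0] by auto

lemma X_minus_0: "X - {0} = X"
  using zero_notin_X by auto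

lemma X_nonzero: "v \<in> X \<Longrightarrow> v \<noteq> 0"
  using zero_notin_X by auto

lemma x_nonzero: "x \<noteq> 0"
  using X_nonzero[OF x_X] .

lemma Y_X: "v \<in> Y \<Longrightarrow> v \<in> X"
  by (simp add: Y_def)

lemma nrm_Y: "v \<in> X \<Longrightarrow> nrm v \<in> Y"
  unfolding Y_def nrm_def using l_nonzero X_scale by (auto simp: l_scale)

lemma nrm_id: "v \<in> Y \<Longrightarrow> nrm v = v"
  by (simp add: Y_def nrm_def)

lemma nrm_scale: "c \<noteq> 0 \<Longrightarrow> nrm (c *s v) = nrm v"
  by (cases "l v = 0") (simp_all add: nrm_def l_scale)

lemma scale_nrm: "v \<in> X \<Longrightarrow> l v *s nrm v = v"
  using l_nonzero by (simp add: nrm_def)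

lemma line_nrm: "v \<in> X \<Longrightarrow> line (nrm v) = line v"
  using l_nonzero by (simp add: nrm_def line_scale)

lemma line_eq_nrm: "u \<in> X \<Longrightarrow> v \<in> X \<Longrightarrow> line u = line v \<longleftrightarrow> nrm u = nrm v"
  by (metis X_nonzero line_eq_iff line_nrm nrm_scale)

lemma continuous_on_nrm: "continuous_on X nrm"
  unfolding nrm_def vector_scalar_mult_def
  using l_nonzero by (intro continuous_intros continuous_on_subset[OF l_cont]) auto

lemma openin_Y_preimage:
  assumes "openin (top_of_set Y) A" shows "open {v \<in> X. nrm v \<in> A}"
proof -
  have "openin (top_of_set X) (X \<inter> nrm -` A)"
    using continuous_on_nrm nrm_Y assms by (intro continuous_openin_preimage) auto
  moreover have "X \<inter> nrm -` A = {v \<in> X. nrm v \<in> A}" by auto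
  ultimately show ?thesis using open_X by (simp add: openin_open_eq)
qed

lemma continuous_from_Y: "continuous_map (X_top W) T f \<Longrightarrow> continuous_map (top_of_set Y) T f"
  by (rule continuous_map_from_subtopology_mono) (auto simp: Y_def)

text \<open>This makes the maps \<open>nrm (g *v v)\<close> of the slice compose like the elements
  \<open>g\<close> of \<open>W\<close>.\<close>

lemma nrm_W: "v \<in> X \<Longrightarrow> g \<in> W \<Longrightarrow> nrm (g *v nrm v) = nrm (g *v v)"
  using l_nonzero[of v] by (simp add: nrm_def[of v] vec.scale nrm_scale)

text \<open>The slice is homeomorphic to \<open>hat_X W\<close> through \<open>line\<close>. Viewing
  this as the quotient by a one-element set of maps gives access to path lifting.\<close>

lemma free_quotient_hat_X: "free_quotient Y (hat_X W) line {id}"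
proof
    show "continuous_map (top_of_set Y) (hat_X W) line"
      by (rule continuous_from_Y[OF continuous_line[OF x_X x_nonzero]])
    show "open_map (top_of_set Y) (hat_X W) line"
      unfolding open_map_def
    proof (intro allI impI)
      fix A assume A: "openin (top_of_set Y) A"
      then have AY: "A \<subseteq> Y" by (rule openin_imp_subset)
      have "{v \<in> X. line v \<in> line ` A} = {v \<in> X. nrm v \<in> A}"
      proof (intro equalityI subsetI)
        fix v assume "v \<in> {v \<in> X. line v \<in> line ` A}"
        then obtain a where a: "v \<in> X" "a \<in> A" "line v = line a" by auto
        then have "nrm v = a" using line_eq_nrm[of v a] AY Y_X nrm_id by (metis subsetD)
        then show "v \<in> {v \<in> X. nrm v \<in> A}" using a by simp
      next
        fix v assume "v \<in> {v \<in> X. nrm v \<in> A}"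
        then show "v \<in> {v \<in> X. line v \<in> line ` A}" using line_nrm by (metis (mono_tags, lifting) CollectD CollectI imageI)
      qed
      then show "openin (hat_X W) (line ` A)"
        using openin_Y_preimage[OF A] AY Y_X by (auto simp: openin_hat_X X_minus_0)
    qed
    show "line ` Y = topspace (hat_X W)"
    proof (intro equalityI subsetI)
      fix L assume "L \<in> topspace (hat_X W)"
      then obtain v where "v \<in> X" "L = line v" by (auto simp: topspace_hat_X)
      then show "L \<in> line ` Y" using nrm_Y line_nrm by blast
    qed (auto simp: topspace_hat_X X_minus_0 Y_X)
    show "\<exists>\<psi>. homeomorphism Y Y \<phi> \<psi>" if "\<phi> \<in> {id}" for \<phi>
      using that homeomorphism_ident[of Y] by (auto simp: id_def)
    show "line u = line v \<longleftrightarrow> (\<exists>\<phi>\<in>{id}. v = \<phi> u)" if "u \<in> Y" "v \<in> Y" for u v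
      using that line_eq_nrm[of u v] by (auto simp: Y_X nrm_id)
qed auto

text \<open>An eigenvector in the complement spans a line there that \<open>g\<close> preserves, and
  conversely. So the condition on regular elements says that \<open>hat_W W\<close> acts freely on
  the projectivized complement.\<close>

lemma regular_central_iff:
  "(\<forall>g. regular W g \<longrightarrow> g \<in> W_center W) \<longleftrightarrow>
   (\<forall>g\<in>W. \<forall>v\<in>X. line (g *v v) = line v \<longrightarrow> g \<in> W_center W)"
proof (intro iffI allI ballI impI)
  fix g v assume reg: "\<forall>g. regular W g \<longrightarrow> g \<in> W_center W"
    and g: "g \<in> W" "v \<in> X" "line (g *v v) = line v"
  then obtain c where "c \<noteq> 0" "g *v v = c *s v"
    using line_eq_iff[of "g *v v" v] X_nonzero X_W by blast
  then show "g \<in> W_center W" using reg g X_nonzero unfolding regular_def by blast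
next
  fix g assume all: "\<forall>g\<in>W. \<forall>v\<in>X. line (g *v v) = line v \<longrightarrow> g \<in> W_center W" and "regular W g"
  then obtain c v where "g \<in> W" "c \<noteq> 0" "v \<in> X" "g *v v = c *s v"
    unfolding regular_def by blast
  then show "g \<in> W_center W" using all line_scale by metis
qed

text \<open>Elements of \<open>W\<close> in one coset of the center induce the same map of the
  slice. If two induced maps agree at one point, then \<open>h' ** g\<close> preserves a line of the
  complement, is central by \<open>reg\<close>, and the maps agree everywhere.\<close>

lemma free_quotient_hat_X_mod:
  assumes reg: "\<forall>g. regular W g \<longrightarrow> g \<in> W_center W"
  shows "free_quotient Y (hat_X_mod_hat_W W) (\<lambda>v. hat_W_orbit W (line v))
           ((\<lambda>g v. nrm (g *v v)) ` W)"
proof -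
  let ?q = "\<lambda>v. hat_W_orbit W (line v)"
  have q_eq: "?q u = ?q v \<longleftrightarrow> (\<exists>g\<in>W. nrm v = nrm (g *v u))" if "u \<in> X" "v \<in> X" for u v
    using that by (auto simp: hat_W_orbit_eq_iff line_eq_nrm X_W)
  show ?thesis
  proof
    show "continuous_map (top_of_set Y) (hat_X_mod_hat_W W) ?q"
      by (rule continuous_from_Y[OF continuous_hat_W_orbit_line[OF x_X x_nonzero]])
    show "open_map (top_of_set Y) (hat_X_mod_hat_W W) ?q"
      unfolding open_map_def
    proof (intro allI impI)
      fix A assume A: "openin (top_of_set Y) A"
      then have AY: "A \<subseteq> Y" by (rule openin_imp_subset)
      have "{v \<in> X. ?q v \<in> ?q ` A} = X \<inter> (\<Union>g\<in>W. (*v) g -` {v \<in> X. nrm v \<in> A})"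
      proof (intro equalityI subsetI)
        fix v assume "v \<in> {v \<in> X. ?q v \<in> ?q ` A}"
        then obtain a where a: "v \<in> X" "a \<in> A" "?q v = ?q a" by auto
        then obtain g where g: "g \<in> W" "nrm a = nrm (g *v v)" using q_eq AY Y_X by blast
        then have "nrm (g *v v) \<in> A" using a AY nrm_id by auto
        then show "v \<in> X \<inter> (\<Union>g\<in>W. (*v) g -` {v \<in> X. nrm v \<in> A})"
          using a g X_W by auto
      next
        fix v assume "v \<in> X \<inter> (\<Union>g\<in>W. (*v) g -` {v \<in> X. nrm v \<in> A})"
        then obtain g where g: "v \<in> X" "g \<in> W" "nrm (g *v v) \<in> A" by auto
        have "?q v = ?q (nrm (g *v v))"
          using g by (simp add: line_nrm X_W hat_W_orbit_W)
        then show "v \<in> {v \<in> X. ?q v \<in> ?q ` A}" using g by blast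
      qed
      also have "open \<dots>"
        using open_X openin_Y_preimage[OF A]
        by (intro open_Int open_UN ballI open_vimage continuous_intros) auto
      finally show "openin (hat_X_mod_hat_W W) (?q ` A)"
        using AY Y_X by (auto simp: openin_hat_X_mod X_minus_0)
    qed
    show "?q ` Y = topspace (hat_X_mod_hat_W W)"
    proof (intro equalityI subsetI)
      fix L assume "L \<in> topspace (hat_X_mod_hat_W W)"
      then obtain v where "v \<in> X" "L = ?q v" by (auto simp: topspace_hat_X_mod)
      then have "nrm v \<in> Y" "L = ?q (nrm v)" using nrm_Y line_nrm by auto
      then show "L \<in> ?q ` Y" by blast
    qed (auto simp: topspace_hat_X_mod X_minus_0 Y_X)
    show "finite ((\<lambda>g v. nrm (g *v v)) ` W)" using fin_W by simp
    show "\<exists>\<psi>. homeomorphism Y Y \<phi> \<psi>" if "\<phi> \<in> (\<lambda>g v. nrm (g *v v)) ` W" for \<phi>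
    proof -
      from that obtain g where g: "\<phi> = (\<lambda>v. nrm (g *v v))" "g \<in> W" ..
      obtain h where h: "h \<in> W" "h ** g = mat 1" "g ** h = mat 1" using inv[OF g(2)] by blast
      have c: "continuous_on Y (\<lambda>v. nrm (g *v v))" if "g \<in> W" for g
        by (rule continuous_on_compose2[OF continuous_on_nrm])
           (use that X_W Y_X in \<open>auto intro!: continuous_intros\<close>)
      have "homeomorphism Y Y (\<lambda>v. nrm (g *v v)) (\<lambda>v. nrm (h *v v))"
        by (rule homeomorphismI)
           (use g h in \<open>auto simp: X_W Y_X nrm_Y c nrm_W matrix_vector_mul_assoc nrm_id\<close>)
      then show ?thesis using g(1) by blast
    qed
    show "?q u = ?q v \<longleftrightarrow> (\<exists>\<phi>\<in>(\<lambda>g v. nrm (g *v v)) ` W. v = \<phi> u)" if "u \<in> Y" "v \<in> Y" for u v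
      using that q_eq[of u v] by (auto simp: Y_X nrm_id)
    show "\<phi> = \<psi>" if \<phi>: "\<phi> \<in> (\<lambda>g v. nrm (g *v v)) ` W" and \<psi>: "\<psi> \<in> (\<lambda>g v. nrm (g *v v)) ` W"
      and v: "v \<in> Y" "\<phi> v = \<psi> v" for \<phi> \<psi> v
    proof -
      from \<phi> obtain g where g: "\<phi> = (\<lambda>v. nrm (g *v v))" "g \<in> W" ..
      from \<psi> obtain h where h: "\<psi> = (\<lambda>v. nrm (h *v v))" "h \<in> W" ..
      obtain h' where h': "h' \<in> W" "h' ** h = mat 1" "h ** h' = mat 1" using inv[OF h(2)] by blast
      have "nrm (h' *v nrm (g *v v)) = nrm (h' *v nrm (h *v v))" using v(2) g h by simp
      then have "nrm ((h' ** g) *v v) = nrm v"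
        using v(1) g h h' by (simp add: nrm_W X_W Y_X matrix_vector_mul_assoc)
      then have "line ((h' ** g) *v v) = line v"
        using v(1) g h' by (simp add: line_eq_nrm X_W Y_X mult)
      then have "h' ** g \<in> W_center W"
        using reg regular_central_iff v(1) Y_X mult[OF h'(1) g(2)] by blast
      then obtain c where c: "c \<noteq> 0" "\<And>v. (h' ** g) *v v = c *s v"
        by (rule center_scalarE) (rule that)
      have "g *v w = c *s (h *v w)" for w
      proof -
        have "g *v w = h *v ((h' ** g) *v w)"
          by (simp only: matrix_vector_mul_assoc matrix_mul_assoc h'(3) matrix_mul_lid)
        also have "\<dots> = c *s (h *v w)" by (simp add: c(2) vec.scale)
        finally show ?thesis .
      qed
      then show ?thesis using c(1) by (simp add: g h nrm_scale)
    qed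
  qed
qed

end

section \<open>Cyclic groups of twists\<close>

text \<open>\<open>t\<close> is a homomorphism from the integers. This replaces cyclic subgroups by
  explicit families of loops indexed by winding numbers.\<close>

lemma generate_int_hom:
  assumes "group G" and t: "\<And>k::int. t k \<in> carrier G" "\<And>j k. t (j + k) = t j \<otimes>\<^bsub>G\<^esub> t k"
  shows "generate G {t 1} = range t"
proof -
  interpret G: group G by fact
  have t0: "t 0 = \<one>\<^bsub>G\<^esub>"
    using t(2)[of 0 0] t(1)[of 0] G.l_cancel_one by simp
  have inv_t: "inv\<^bsub>G\<^esub> (t k) = t (- k)" for k
    using t(2)[of "- k" k] t0 t(1) by (intro G.inv_equality) auto
  have "subgroup (range t) G"
    by (rule G.subgroupI) (auto simp: t(1) inv_t simp flip: t(2))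
  then have "generate G {t 1} \<subseteq> range t"
    by (intro G.generate_subgroup_incl) auto
  moreover have nat: "t (int n) \<in> generate G {t 1}" for n
  proof (induction n)
    case 0
    show ?case using generate.one by (simp add: t0)
  next
    case (Suc n)
    have "t (int (Suc n)) = t (int n) \<otimes>\<^bsub>G\<^esub> t 1" by (simp add: t(2)[symmetric] add.commute)
    then show ?case using generate.eng[OF Suc generate.incl[of "t 1"]] by simp
  qed
  have "t k \<in> generate G {t 1}" for k
  proof (cases "0 \<le> k")
    case True
    then show ?thesis using nat[of "nat k"] by simp
  next
    case False
    have "inv\<^bsub>G\<^esub> (t (- k)) \<in> generate G {t 1}"
      using False nat[of "nat (- k)"] t(1) by (intro G.generate_m_inv_closed) auto
    then show ?thesis by (simp add: inv_t)
  qed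
  ultimately show ?thesis by blast
qed

text \<open>All these loops are images of paths in the real line, so adding winding numbers becomes
  a straight-line homotopy there.\<close>

lemma loop_class_periodic:
  fixes m :: "real \<Rightarrow> 'a"
  assumes m: "continuous_map euclidean Y m" and period: "\<And>r. m (r + 1) = m r"
  defines "t \<equiv> \<lambda>k::int. loop_class Y (m 0) (\<lambda>s. m (of_int k * s))"
  shows "(\<lambda>s. m (of_int k * s)) \<in> loops Y (m 0)"
    and "t (j + k) = t j \<otimes>\<^bsub>pi1 Y (m 0)\<^esub> t k"
proof -
  have pn: "m (r + of_nat n) = m r" for r n
    by (induction n) (use period in \<open>simp_all add: add.assoc[symmetric] add.commute[of 1]\<close>)
  have period': "m (r + of_int n) = m r" for r n
  proof (cases "0 \<le> n")
    case True
    then show ?thesis using pn[of r "nat n"] by simp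
  next
    case False
    then show ?thesis using pn[of "r + of_int n" "nat (- n)"] by simp
  qed
  have lp: "(\<lambda>s. m (of_int k * s)) \<in> loops Y (m 0)" for k
  proof -
    have "continuous_map (top_of_set {0..1}) Y (m \<circ> (\<lambda>s. of_int k * s))"
      by (rule continuous_map_compose[OF _ m]) (auto intro!: continuous_intros)
    then show ?thesis using period'[of 0 k] by (simp add: loops_def pathin_def o_def)
  qed
  then show "(\<lambda>s. m (of_int k * s)) \<in> loops Y (m 0)" .
  \<comment> \<open>Runs from 0 to \<open>j\<close> in the first half and on to \<open>j + k\<close>
    in the second; by periodicity the second half traces the loop of \<open>k\<close> from its
    start.\<close>
  define a where "a s = of_int j * min 1 (2 * s) + of_int k * max 0 (2 * s - 1)" for s :: real
  have a: "continuous_on {0..1} a"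
    unfolding a_def by (intro continuous_intros)
  have "(\<lambda>s. m (of_int (j + k) * s), join (\<lambda>s. m (of_int j * s)) (\<lambda>s. m (of_int k * s)))
      \<in> loop_homotopic Y (m 0)"
  proof (rule homotopic_through_convex[of UNIV Y m "\<lambda>s. of_int (j + k) * s" a])
    show "join (\<lambda>s. m (of_int j * s)) (\<lambda>s. m (of_int k * s)) s = m (a s)" for s
    proof (cases "s \<le> 1/2")
      case True
      then have "min 1 (2 * s) = 2 * s" "max 0 (2 * s - 1) = 0" by auto
      then show ?thesis using True by (simp add: join_def a_def)
    next
      case False
      then have "min 1 (2 * s) = 1" "max 0 (2 * s - 1) = 2 * s - 1" by auto
      then show ?thesis
        using False period'[of "of_int k * (2 * s - 1)" j] by (simp add: join_def a_def add.commute)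
    qed
    show "m (of_int (j + k) * 1) = m 0" using period'[of 0 "j + k"] by simp
  qed (use m a in \<open>auto simp: a_def intro!: continuous_intros\<close>)
  then show "t (j + k) = t j \<otimes>\<^bsub>pi1 Y (m 0)\<^esub> t k"
    unfolding t_def mult_pi1[OF lp lp] by (rule loop_class_eqI)
qed

text \<open>Elements of \<open>H\<close> are pulled back along \<open>f\<close> by a choice
  \<open>s\<close>; by the inclusion of kernels, \<open>h (s y)\<close> does not depend on
  it.\<close>

lemma hom_factor:
  assumes "group G" "group H" "group K" and f: "f \<in> hom G H" "f ` carrier G = carrier H"
    and h: "h \<in> hom G K" and ker: "kernel G H f \<subseteq> kernel G K h"
  obtains \<phi> where "\<phi> \<in> hom H K" "\<And>a. a \<in> carrier G \<Longrightarrow> \<phi> (f a) = h a"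
proof -
  interpret G: group G by fact
  interpret H: group H by fact
  interpret K: group K by fact
  interpret f: group_hom G H f using f by unfold_locales
  interpret h: group_hom G K h using h by unfold_locales
  have eq: "h a = h b" if ab: "a \<in> carrier G" "b \<in> carrier G" "f a = f b" for a b
  proof -
    have "a \<otimes>\<^bsub>G\<^esub> inv\<^bsub>G\<^esub> b \<in> kernel G H f" using ab by (simp add: kernel_def)
    then have "h (a \<otimes>\<^bsub>G\<^esub> inv\<^bsub>G\<^esub> b) = \<one>\<^bsub>K\<^esub>"
      using ker unfolding kernel_def by blast
    then have 1: "h a \<otimes>\<^bsub>K\<^esub> inv\<^bsub>K\<^esub> (h b) = \<one>\<^bsub>K\<^esub>" using ab by simp
    have "h a = (h a \<otimes>\<^bsub>K\<^esub> inv\<^bsub>K\<^esub> (h b)) \<otimes>\<^bsub>K\<^esub> h b" using ab by (simp add: K.m_assoc)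
    also have "\<dots> = h b" unfolding 1 using ab by simp
    finally show ?thesis .
  qed
  define s where "s y = (SOME a. a \<in> carrier G \<and> f a = y)" for y
  have s: "s y \<in> carrier G \<and> f (s y) = y" if "y \<in> carrier H" for y
  proof -
    have "\<exists>a. a \<in> carrier G \<and> f a = y" using that unfolding f(2)[symmetric] by blast
    then show ?thesis unfolding s_def by (rule someI_ex)
  qed
  show thesis
  proof
    show *: "h (s (f a)) = h a" if "a \<in> carrier G" for a
      by (rule eq) (use s[of "f a"] that in simp_all)
    show "(\<lambda>y. h (s y)) \<in> hom H K"
    proof (rule homI)
      show "h (s y) \<in> carrier K" if "y \<in> carrier H" for y using s[OF that] by auto
      show "h (s (y \<otimes>\<^bsub>H\<^esub> z)) = h (s y) \<otimes>\<^bsub>K\<^esub> h (s z)" if "y \<in> carrier H" "z \<in> carrier H" for y z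
        using *[of "s y \<otimes>\<^bsub>G\<^esub> s z"] s[OF that(1)] s[OF that(2)] by simp
    qed
  qed
qed

section \<open>Braids\<close>

locale pointed_reflection_group = irreducible_reflection_group W for W :: "(complex^'n^'n) set" +
  fixes x :: "complex^'n"
  assumes x_X: "x \<in> hyperplane_complement W" and x_nonzero: "x \<noteq> 0"
begin

interpretation XW: free_quotient X "X_mod_W W" "W_orbit W" "(*v) ` W"
  by (rule free_quotient_X)

abbreviation "hat_orbit v \<equiv> hat_W_orbit W (line v)"

lemmas cont_line = continuous_line[OF x_X x_nonzero]
lemmas cont_hat = continuous_hat_W_orbit_line[OF x_X x_nonzero]
lemmas cont_proj = continuous_orbit_proj[OF x_X x_nonzero]

lemma group_P: "group (pure_braid_group W x)"
  unfolding pure_braid_group_def by (rule group_pi1) (simp add: x_X)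

lemma group_B: "group (braid_group W x)"
  unfolding braid_group_def by (rule group_pi1) (simp add: topspace_X_mod_W x_X)

lemma group_hat_P: "group (hat_pure_braid_group W x)"
  unfolding hat_pure_braid_group_def by (rule group_pi1) (simp add: topspace_hat_X x_X x_nonzero)

lemma group_hat_B: "group (hat_braid_group W x)"
  unfolding hat_braid_group_def
  by (rule group_pi1) (use x_X x_nonzero in \<open>auto simp: topspace_hat_X_mod\<close>)

text \<open>A braid is represented by a path in the complement from the base point to one of its
  translates.\<close>

definition "braid_path \<gamma> g \<longleftrightarrow> g \<in> W \<and> pathin (top_of_set X) \<gamma> \<and> \<gamma> 0 = x \<and> \<gamma> 1 = g *v x"

definition "braid \<gamma> = loop_class (X_mod_W W) (W_orbit W x) (W_orbit W \<circ> \<gamma>)"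

lemma braid_path_loop:
  assumes "braid_path \<gamma> g" shows "W_orbit W \<circ> \<gamma> \<in> loops (X_mod_W W) (W_orbit W x)"
proof -
  have "W_orbit W (g *v x) = W_orbit W x"
    using assms W_orbit_eq_iff[of x "g *v x"] unfolding braid_path_def by metis
  then show ?thesis
    using assms pathin_compose[OF _ continuous_W_orbit] by (auto simp: braid_path_def loops_def)
qed

lemma braid_carrier: "braid_path \<gamma> g \<Longrightarrow> braid \<gamma> \<in> carrier (braid_group W x)"
  unfolding braid_group_def braid_def by (rule loop_class_carrier[OF braid_path_loop])

lemma braid_cong:
  assumes "p \<in> loops (X_mod_W W) (W_orbit W x)" "\<And>t. t \<in> {0..1} \<Longrightarrow> W_orbit W (\<gamma> t) = p t"
  shows "loop_class (X_mod_W W) (W_orbit W x) p = braid \<gamma>"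
  unfolding braid_def using assms by (intro loop_class_eqI loop_homotopic_cong) auto

lemma braid_exists:
  assumes "b \<in> carrier (braid_group W x)"
  obtains \<gamma> g where "braid_path \<gamma> g" "b = braid \<gamma>"
proof -
  from assms obtain p where p: "p \<in> loops (X_mod_W W) (W_orbit W x)"
      "b = loop_class (X_mod_W W) (W_orbit W x) p"
    unfolding braid_group_def in_carrier_pi1 by blast
  have "pathin (X_mod_W W) p" "W_orbit W x = p 0" using p(1) by (auto simp: loops_def)
  from XW.path_lift[OF this(1) x_X this(2)]
  obtain \<gamma> where \<gamma>: "pathin (top_of_set X) \<gamma>" "\<gamma> 0 = x" "\<And>t. t \<in> {0..1} \<Longrightarrow> W_orbit W (\<gamma> t) = p t"
    by metis
  have "W_orbit W x = W_orbit W (\<gamma> 1)" using \<gamma>(3)[of 1] p(1) by (simp add: loops_def)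
  then obtain g where "g \<in> W" "\<gamma> 1 = g *v x" unfolding W_orbit_eq_iff by blast
  then have "braid_path \<gamma> g" using \<gamma> by (simp add: braid_path_def)
  moreover have "b = braid \<gamma>" unfolding p(2) by (rule braid_cong[OF p(1) \<gamma>(3)])
  ultimately show thesis by (rule that)
qed

text \<open>Lifts of homotopic loops end at the same point, and freeness recovers the group element
  from it. So the description in \<open>B_to_W\<close> determines its element uniquely.\<close>

lemma braid_eq_end:
  assumes "braid_path \<gamma> g" "braid_path \<gamma>' g'" "braid \<gamma> = braid \<gamma>'"
  shows "g = g'"
proof -
  have hom: "(W_orbit W \<circ> \<gamma>, W_orbit W \<circ> \<gamma>') \<in> loop_homotopic (X_mod_W W) (W_orbit W x)"
    using assms braid_path_loop by (simp add: loop_class_eq[symmetric] braid_def)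
  have "\<gamma>' 1 = \<gamma> 1"
    by (rule XW.homotopy_lift[OF _ _ _ hom, of \<gamma> \<gamma>'])
       (use assms in \<open>auto simp: braid_path_def\<close>)
  then show ?thesis using assms W_free[OF x_X] by (metis braid_path_def)
qed

lemma B_to_W_braid:
  assumes "braid_path \<gamma> g" shows "B_to_W W x (braid \<gamma>) = g"
  unfolding B_to_W_def
proof (rule the_equality)
  show "g \<in> W \<and> (\<exists>\<gamma>'. pathin (X_top W) \<gamma>' \<and> \<gamma>' 0 = x \<and> \<gamma>' 1 = g *v x \<and> W_orbit W \<circ> \<gamma>' \<in> braid \<gamma>)"
    using assms self_in_loop_class[OF braid_path_loop[OF assms]]
    unfolding braid_path_def braid_def by blast
  fix g'
  assume "g' \<in> W \<and> (\<exists>\<gamma>'. pathin (X_top W) \<gamma>' \<and> \<gamma>' 0 = x \<and> \<gamma>' 1 = g' *v x \<and> W_orbit W \<circ> \<gamma>' \<in> braid \<gamma>)"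
  then obtain \<gamma>' where \<gamma>': "braid_path \<gamma>' g'" "W_orbit W \<circ> \<gamma>' \<in> braid \<gamma>"
    unfolding braid_path_def by blast
  then have "braid \<gamma> = braid \<gamma>'"
    unfolding braid_def by (intro loop_class_eqI) simp
  then show "g' = g" using braid_eq_end[OF \<gamma>'(1) assms] by simp
qed

lemma pathin_W: "pathin (top_of_set X) \<gamma> \<Longrightarrow> g \<in> W \<Longrightarrow> pathin (top_of_set X) (\<lambda>t. g *v \<gamma> t)"
  using continuous_map_compose[of "top_of_set {0..1}" "top_of_set X" \<gamma> "top_of_set X" "(*v) g"] X_W
  by (auto simp: pathin_def o_def intro!: continuous_intros)

text \<open>The lift of the second braid that starts at \<open>g *v x\<close> is the translate by
  \<open>g\<close> of the one that starts at \<open>x\<close>; this produces \<open>g ** h\<close>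
  in the same order as the loops.\<close>

lemma braid_path_join:
  assumes "braid_path \<gamma> g" "braid_path \<delta> h"
  shows "braid_path (join \<gamma> (\<lambda>t. g *v \<delta> t)) (g ** h)"
proof -
  have g: "g \<in> W" "pathin (top_of_set X) \<gamma>" "\<gamma> 0 = x" "\<gamma> 1 = g *v x"
    and h: "h \<in> W" "pathin (top_of_set X) \<delta>" "\<delta> 0 = x" "\<delta> 1 = h *v x"
    using assms by (auto simp: braid_path_def)
  have "pathin (top_of_set X) (join \<gamma> (\<lambda>t. g *v \<delta> t))"
    by (rule pathin_join[OF g(2) pathin_W[OF h(2) g(1)]]) (simp add: g h)
  then show ?thesis
    by (simp add: braid_path_def mult g h join_def matrix_vector_mul_assoc)
qed

lemma braid_join:
  assumes "braid_path \<gamma> g" "braid_path \<delta> h"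
  shows "braid \<gamma> \<otimes>\<^bsub>braid_group W x\<^esub> braid \<delta> = braid (join \<gamma> (\<lambda>t. g *v \<delta> t))"
proof -
  have "W_orbit W (g *v v) = W_orbit W v" for v
    using W_orbit_eq_iff[of v "g *v v"] assms(1) unfolding braid_path_def by metis
  then have "join (W_orbit W \<circ> \<gamma>) (W_orbit W \<circ> \<delta>) = W_orbit W \<circ> join \<gamma> (\<lambda>t. g *v \<delta> t)"
    by (auto simp: join_def fun_eq_iff)
  then show ?thesis
    unfolding braid_group_def braid_def using assms by (simp add: mult_pi1 braid_path_loop)
qed

lemma B_to_W_hom: "B_to_W W x \<in> hom (braid_group W x) (W_group W)"
proof (rule homI)
  fix b assume "b \<in> carrier (braid_group W x)"
  then obtain \<gamma> g where "braid_path \<gamma> g" "b = braid \<gamma>" by (rule braid_exists)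
  then show "B_to_W W x b \<in> carrier (W_group W)" by (simp add: B_to_W_braid) (simp add: braid_path_def)
next
  fix a b assume "a \<in> carrier (braid_group W x)" "b \<in> carrier (braid_group W x)"
  then obtain \<gamma> g \<delta> h where "braid_path \<gamma> g" "a = braid \<gamma>" "braid_path \<delta> h" "b = braid \<delta>"
    by (metis braid_exists)
  then show "B_to_W W x (a \<otimes>\<^bsub>braid_group W x\<^esub> b) = B_to_W W x a \<otimes>\<^bsub>W_group W\<^esub> B_to_W W x b"
    by (simp add: braid_join B_to_W_braid B_to_W_braid[OF braid_path_join])
qed

lemma P_to_B_class: "p \<in> loops (X_top W) x \<Longrightarrow> P_to_B W x (loop_class (X_top W) x p) = braid p"
  unfolding P_to_B_def braid_def by (rule pi1_map_class[OF continuous_W_orbit refl])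

lemma P_to_B_hom: "P_to_B W x \<in> hom (pure_braid_group W x) (braid_group W x)"
  unfolding P_to_B_def pure_braid_group_def braid_group_def
  by (rule pi1_map_hom[OF continuous_W_orbit refl])

lemma B_to_hat_B_hom: "B_to_hat_B W x \<in> hom (braid_group W x) (hat_braid_group W x)"
  unfolding B_to_hat_B_def braid_group_def hat_braid_group_def
  by (rule pi1_map_hom[OF cont_proj]) (simp add: orbit_proj_W_orbit)

lemma P_to_hat_P_hom: "P_to_hat_P W x \<in> hom (pure_braid_group W x) (hat_pure_braid_group W x)"
  unfolding P_to_hat_P_def pure_braid_group_def hat_pure_braid_group_def
  by (rule pi1_map_hom[OF cont_line refl])

lemma hat_P_to_hat_B_hom:
  "hat_P_to_hat_B W x \<in> hom (hat_pure_braid_group W x) (hat_braid_group W x)"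
  unfolding hat_P_to_hat_B_def hat_pure_braid_group_def hat_braid_group_def
  by (rule pi1_map_hom[OF continuous_hat_W_orbit refl])

lemma B_to_hat_B_braid:
  assumes "braid_path \<gamma> g"
  shows "B_to_hat_B W x (braid \<gamma>) =
    loop_class (hat_X_mod_hat_W W) (hat_orbit x) (\<lambda>t. hat_orbit (\<gamma> t))"
proof -
  have "B_to_hat_B W x (braid \<gamma>) =
      loop_class (hat_X_mod_hat_W W) (hat_orbit x) (orbit_proj W \<circ> (W_orbit W \<circ> \<gamma>))"
    unfolding B_to_hat_B_def braid_def
    by (rule pi1_map_class[OF cont_proj _ braid_path_loop[OF assms]]) (simp add: orbit_proj_W_orbit)
  then show ?thesis by (simp add: o_def orbit_proj_W_orbit)
qed

lemma hat_loop:
  assumes "braid_path \<gamma> g"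
  shows "(\<lambda>t. hat_orbit (\<gamma> t)) \<in> loops (hat_X_mod_hat_W W) (hat_orbit x)"
proof -
  have "orbit_proj W \<circ> (W_orbit W \<circ> \<gamma>) \<in> loops (hat_X_mod_hat_W W) (hat_orbit x)"
    by (rule loops_compose[OF cont_proj _ braid_path_loop[OF assms]]) (simp add: orbit_proj_W_orbit)
  then show ?thesis by (simp add: o_def orbit_proj_W_orbit)
qed

lemma lower_left_square:
  assumes "p \<in> carrier (pure_braid_group W x)"
  shows "hat_P_to_hat_B W x (P_to_hat_P W x p) = B_to_hat_B W x (P_to_B W x p)"
proof -
  from assms obtain \<gamma> where \<gamma>: "\<gamma> \<in> loops (X_top W) x" "p = loop_class (X_top W) x \<gamma>"
    unfolding pure_braid_group_def in_carrier_pi1 by blast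
  have bp: "braid_path \<gamma> (mat 1)" using \<gamma>(1) one by (simp add: braid_path_def loops_def)
  have "P_to_hat_P W x p = loop_class (hat_X W) (line x) (line \<circ> \<gamma>)"
    unfolding P_to_hat_P_def \<gamma>(2) by (rule pi1_map_class[OF cont_line refl \<gamma>(1)])
  moreover have "line \<circ> \<gamma> \<in> loops (hat_X W) (line x)"
    by (rule loops_compose[OF cont_line refl \<gamma>(1)])
  ultimately have "hat_P_to_hat_B W x (P_to_hat_P W x p) =
      loop_class (hat_X_mod_hat_W W) (hat_orbit x) (hat_W_orbit W \<circ> (line \<circ> \<gamma>))"
    unfolding hat_P_to_hat_B_def by (simp add: pi1_map_class[OF continuous_hat_W_orbit refl])
  then show ?thesis by (simp add: \<gamma>(2) P_to_B_class[OF \<gamma>(1)] B_to_hat_B_braid[OF bp] o_def)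
qed

text \<open>Covering theory for the free action: injectivity by lifting homotopies, surjectivity by
  path connectedness of the complement, and the kernel consists of the braids with closed
  lift.\<close>

lemma second_row_exact:
  "short_exact (pure_braid_group W x) (braid_group W x) (W_group W) (P_to_B W x) (B_to_W W x)"
proof -
  have P: "\<exists>\<gamma>\<in>loops (X_top W) x. p = loop_class (X_top W) x \<gamma>" if "p \<in> carrier (pure_braid_group W x)" for p
    using that unfolding pure_braid_group_def in_carrier_pi1 .
  have bp: "braid_path \<gamma> (mat 1)" if "\<gamma> \<in> loops (X_top W) x" for \<gamma>
    using that one by (simp add: braid_path_def loops_def)
  have "inj_on (P_to_B W x) (carrier (pure_braid_group W x))"
  proof (rule inj_onI)
    fix p q assume pq: "p \<in> carrier (pure_braid_group W x)" "q \<in> carrier (pure_braid_group W x)"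
      "P_to_B W x p = P_to_B W x q"
    obtain \<gamma> \<delta> where \<gamma>: "\<gamma> \<in> loops (X_top W) x" "p = loop_class (X_top W) x \<gamma>"
      and \<delta>: "\<delta> \<in> loops (X_top W) x" "q = loop_class (X_top W) x \<delta>"
      using P[OF pq(1)] P[OF pq(2)] by blast
    have "braid \<gamma> = braid \<delta>" using pq(3) \<gamma> \<delta> by (simp add: P_to_B_class)
    then have hom: "(W_orbit W \<circ> \<gamma>, W_orbit W \<circ> \<delta>) \<in> loop_homotopic (X_mod_W W) (W_orbit W x)"
      using braid_path_loop[OF bp] \<gamma>(1) \<delta>(1) by (simp add: loop_class_eq[symmetric] braid_def)
    have "(\<gamma>, \<delta>) \<in> loop_homotopic (X_top W) x"
    proof (rule XW.homotopy_lift[OF _ _ _ hom, of \<gamma> \<delta>])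
      fix h assume h: "continuous_map (top_of_set ({0..1::real} \<times> {0..1})) (top_of_set X) h"
        "\<And>t. t \<in> {0..1} \<Longrightarrow> h (0, t) = \<gamma> t" "\<And>t. t \<in> {0..1} \<Longrightarrow> h (1, t) = \<delta> t"
        "\<And>s. s \<in> {0..1} \<Longrightarrow> h (s, 0) = \<gamma> 0" "\<And>s. s \<in> {0..1} \<Longrightarrow> h (s, 1) = \<gamma> 1"
      show "(\<gamma>, \<delta>) \<in> loop_homotopic (X_top W) x"
        by (rule loop_homotopicI[OF h(1,2,3)]) (use h(4,5) \<gamma>(1) in \<open>auto simp: loops_def\<close>)
    qed (use \<gamma>(1) \<delta>(1) in \<open>auto simp: loops_def\<close>)
    then show "p = q" unfolding \<gamma>(2) \<delta>(2) by (rule loop_class_eqI)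
  qed
  moreover have "B_to_W W x ` carrier (braid_group W x) = carrier (W_group W)"
  proof
    show "B_to_W W x ` carrier (braid_group W x) \<subseteq> carrier (W_group W)"
      using B_to_W_hom by (auto simp: hom_def)
    show "carrier (W_group W) \<subseteq> B_to_W W x ` carrier (braid_group W x)"
    proof
      fix g assume "g \<in> carrier (W_group W)"
      then have g: "g \<in> W" by simp
      obtain \<gamma> where "pathin (top_of_set X) \<gamma>" "\<gamma> 0 = x" "\<gamma> 1 = g *v x"
        using path_connected_X[OF x_X X_W[OF x_X g]] by metis
      then have "braid_path \<gamma> g" using g by (simp add: braid_path_def)
      then show "g \<in> B_to_W W x ` carrier (braid_group W x)"
        using B_to_W_braid braid_carrier by (metis imageI)
    qed
  qed
  moreover have "P_to_B W x ` carrier (pure_braid_group W x) = kernel (braid_group W x) (W_group W) (B_to_W W x)"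
  proof
    show "P_to_B W x ` carrier (pure_braid_group W x) \<subseteq> kernel (braid_group W x) (W_group W) (B_to_W W x)"
    proof
      fix b assume "b \<in> P_to_B W x ` carrier (pure_braid_group W x)"
      then obtain p where p: "p \<in> carrier (pure_braid_group W x)" "b = P_to_B W x p" by blast
      obtain \<gamma> where \<gamma>: "\<gamma> \<in> loops (X_top W) x" "p = loop_class (X_top W) x \<gamma>" using P[OF p(1)] ..
      then have "b = braid \<gamma>" using p(2) by (simp add: P_to_B_class)
      then show "b \<in> kernel (braid_group W x) (W_group W) (B_to_W W x)"
        using bp[OF \<gamma>(1)] by (simp add: kernel_def braid_carrier B_to_W_braid)
    qed
    show "kernel (braid_group W x) (W_group W) (B_to_W W x) \<subseteq> P_to_B W x ` carrier (pure_braid_group W x)"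
    proof
      fix b assume b: "b \<in> kernel (braid_group W x) (W_group W) (B_to_W W x)"
      then have "b \<in> carrier (braid_group W x)" by (simp add: kernel_def)
      then obtain \<gamma> g where \<gamma>: "braid_path \<gamma> g" "b = braid \<gamma>" by (rule braid_exists)
      then have "g = mat 1" using b by (simp add: kernel_def B_to_W_braid)
      then have "\<gamma> \<in> loops (X_top W) x" using \<gamma>(1) by (simp add: braid_path_def loops_def)
      then show "b \<in> P_to_B W x ` carrier (pure_braid_group W x)"
        using P_to_B_class \<gamma>(2) unfolding pure_braid_group_def by (metis imageI loop_class_carrier)
    qed
  qed
  ultimately show ?thesis
    using group_P group_B group_W P_to_B_hom B_to_W_hom by (simp add: short_exact_def mon_def epi_def)
qed

lemma third_column_exact: "short_exact (Z_group W) (W_group W) (hat_W W) id (to_hat_W W)"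
proof -
  have "id \<in> mon (Z_group W) (W_group W)"
    by (auto simp: mon_def hom_def W_center_W)
  moreover have "id ` carrier (Z_group W) = kernel (W_group W) (hat_W W) (to_hat_W W)"
    using to_hat_W_one W_center_W by (auto simp: kernel_def)
  ultimately show ?thesis
    using subgroup.subgroup_is_group[OF subgroup_center group_GL] group_W group_hat_W
      to_hat_W_hom to_hat_W_surj by (simp add: short_exact_def epi_def)
qed

end

section \<open>Twists by scalars: the powers of \<pi> and \<beta>\<close>

context pointed_reflection_group
begin

definition "unit r = exp (2 * \<i> * of_real pi * of_real r)" for r :: real

lemma unit_add: "unit (r + s) = unit r * unit s"
  by (simp add: unit_def distrib_left exp_add)

lemma unit_eq_1: "unit r = 1 \<longleftrightarrow> (\<exists>n::int. r = of_int n)"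
  unfolding unit_def exp_eq_1 by auto

lemma unit_nonzero: "unit r \<noteq> 0"
  by (simp add: unit_def)

lemma unit_0 [simp]: "unit 0 = 1"
  by (simp add: unit_def)

lemma unit_power: "unit r ^ n = unit (of_nat n * r)"
  by (induction n) (simp_all add: algebra_simps flip: unit_add)

lemma continuous_unit: "continuous_on S (\<lambda>s. unit s *s x)"
  unfolding unit_def vector_scalar_mult_def by (intro continuous_intros)

lemma unit_X: "unit r *s x \<in> X"
  by (rule X_scale[OF x_X unit_nonzero])

text \<open>Lift of the loop that winds \<open>k\<close> times as far as \<beta>. Thus
  \<open>twist k\<close> is the \<open>k\<close>-th power of \<beta>, and likewise
  \<open>pure_twist k\<close> is that of \<pi>, negative exponents included.\<close>

definition "twist_path k = (\<lambda>s::real. unit (of_int k * s / of_nat d) *s x)"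

definition "twist k = braid (twist_path k)"

definition "pure_twist k = loop_class (X_top W) x (\<lambda>s::real. unit (of_int k * s) *s x)"

lemma central_unit:
  obtains z where "z \<in> W_center W" "\<And>v. z *v v = unit (of_int k / of_nat d) *s v"
proof -
  have "unit (of_int k / of_nat d) ^ d = 1"
    using d_pos unit_eq_1[of "of_int k"] by (simp add: unit_power)
  then obtain z where "z \<in> W_center W" "\<forall>v. z *v v = unit (of_int k / of_nat d) *s v"
    unfolding center_roots_of_unity[symmetric] by (elim bexE) (rule that)
  then show thesis by (intro that[of z]) simp_all
qed

lemma twist_braid_path:
  assumes "z \<in> W_center W" "\<And>v. z *v v = unit (of_int k / of_nat d) *s v"
  shows "braid_path (twist_path k) z"
proof -
  have "continuous_on {0..1} (twist_path k)"
    unfolding twist_path_def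
    by (rule continuous_on_compose2[OF continuous_unit[of UNIV]]) (use d_pos in \<open>auto intro!: continuous_intros\<close>)
  then show ?thesis
    using assms W_center_W unit_X by (auto simp: braid_path_def pathin_def twist_path_def)
qed

lemma W_orbit_unit_period: "W_orbit W (unit ((r + 1) / of_nat d) *s x) = W_orbit W (unit (r / of_nat d) *s x)"
proof -
  obtain z where z: "z \<in> W_center W" "\<And>v. z *v v = unit (of_int 1 / of_nat d) *s v"
    by (rule central_unit) (rule that)
  have "unit ((r + 1) / of_nat d) *s x = z *v (unit (r / of_nat d) *s x)"
    by (simp add: z(2) add_divide_distrib unit_add mult.commute)
  then show ?thesis
    using W_orbit_eq_iff[of "unit (r / of_nat d) *s x" "unit ((r + 1) / of_nat d) *s x"] W_center_W[OF z(1)] by metis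
qed

lemma continuous_unit_X: "continuous_map euclidean (X_top W) (\<lambda>r. unit r *s x)"
  using continuous_unit[of UNIV] unit_X by (auto simp: continuous_map_in_subtopology)

lemma twist_carrier: "twist k \<in> carrier (braid_group W x)"
  and twist_add: "twist (j + k) = twist j \<otimes>\<^bsub>braid_group W x\<^esub> twist k"
proof -
  let ?m = "\<lambda>r::real. W_orbit W (unit (r / of_nat d) *s x)"
  have "continuous_map euclidean euclidean (\<lambda>r::real. r / of_nat d)"
    using d_pos by (auto intro!: continuous_intros)
  from continuous_map_compose[OF continuous_map_compose[OF this continuous_unit_X] continuous_W_orbit]
  have m: "continuous_map euclidean (X_mod_W W) ?m" by (simp add: o_def)
  have eq: "twist k = loop_class (X_mod_W W) (?m 0) (\<lambda>s. ?m (of_int k * s))" for k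
    by (simp add: twist_def braid_def twist_path_def o_def)
  have m0: "braid_group W x = pi1 (X_mod_W W) (?m 0)" by (simp add: braid_group_def)
  show "twist k \<in> carrier (braid_group W x)"
    unfolding eq m0 by (rule loop_class_carrier[OF loop_class_periodic(1)[OF m W_orbit_unit_period]])
  show "twist (j + k) = twist j \<otimes>\<^bsub>braid_group W x\<^esub> twist k"
    unfolding eq m0 by (rule loop_class_periodic(2)[OF m W_orbit_unit_period])
qed

lemma pure_twist_loop: "(\<lambda>s::real. unit (of_int k * s) *s x) \<in> loops (X_top W) x"
  and pure_twist_carrier: "pure_twist k \<in> carrier (pure_braid_group W x)"
  and pure_twist_add: "pure_twist (j + k) = pure_twist j \<otimes>\<^bsub>pure_braid_group W x\<^esub> pure_twist k"
proof -
  let ?m = "\<lambda>r::real. unit r *s x"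
  have m0: "?m 0 = x" by simp
  have period: "?m (r + 1) = ?m r" for r
    using unit_eq_1[of 1] by (simp add: unit_add)
  note per = loop_class_periodic[OF continuous_unit_X period, unfolded m0]
  show "(\<lambda>s::real. unit (of_int k * s) *s x) \<in> loops (X_top W) x" by (rule per(1))
  then show "pure_twist k \<in> carrier (pure_braid_group W x)"
    unfolding pure_twist_def pure_braid_group_def by (rule loop_class_carrier)
  show "pure_twist (j + k) = pure_twist j \<otimes>\<^bsub>pure_braid_group W x\<^esub> pure_twist k"
    unfolding pure_twist_def pure_braid_group_def by (rule per(2))
qed

lemma carrier_beta_group: "carrier (beta_group W x) = range twist"
proof -
  have "beta_elt W x = twist 1"
    by (simp add: beta_elt_def twist_def braid_def twist_path_def unit_def o_def)
  then show ?thesis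
    using generate_int_hom[of "braid_group W x" twist, OF group_B twist_carrier twist_add]
    by (simp add: beta_group_def)
qed

lemma carrier_pi_group: "carrier (pi_group W x) = range pure_twist"
proof -
  have "pi_elt W x = pure_twist 1"
    by (simp add: pi_elt_def pure_twist_def unit_def)
  then show ?thesis
    using generate_int_hom[of "pure_braid_group W x" pure_twist, OF group_P pure_twist_carrier pure_twist_add]
    by (simp add: pi_group_def)
qed

lemma group_beta: "group (beta_group W x)"
proof -
  interpret B: group "braid_group W x" by (rule group_B)
  have "beta_elt W x = twist 1"
    by (simp add: beta_elt_def twist_def braid_def twist_path_def unit_def o_def)
  then show ?thesis
    unfolding beta_group_def
    by (intro subgroup.subgroup_is_group[OF B.generate_is_subgroup group_B]) (simp add: twist_carrier)
qed

lemma group_pi: "group (pi_group W x)"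
proof -
  interpret P: group "pure_braid_group W x" by (rule group_P)
  have "pi_elt W x = pure_twist 1"
    by (simp add: pi_elt_def pure_twist_def unit_def)
  then show ?thesis
    unfolding pi_group_def
    by (intro subgroup.subgroup_is_group[OF P.generate_is_subgroup group_P]) (simp add: pure_twist_carrier)
qed

lemma beta_group_simps [simp]:
  "mult (beta_group W x) = mult (braid_group W x)" "one (beta_group W x) = one (braid_group W x)"
  by (simp_all add: beta_group_def)

lemma pi_group_simps [simp]:
  "mult (pi_group W x) = mult (pure_braid_group W x)" "one (pi_group W x) = one (pure_braid_group W x)"
  by (simp_all add: pi_group_def)

lemma P_to_B_pure_twist: "P_to_B W x (pure_twist k) = twist (int d * k)"
  using d_pos unfolding pure_twist_def P_to_B_class[OF pure_twist_loop] twist_def twist_path_def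
  by (simp add: mult.assoc)

lemma B_to_W_twist:
  assumes "z \<in> W_center W" "\<And>v. z *v v = unit (of_int k / of_nat d) *s v"
  shows "B_to_W W x (twist k) = z"
  unfolding twist_def by (rule B_to_W_braid[OF twist_braid_path[OF assms]])

lemma B_to_W_twist_center: "B_to_W W x (twist k) \<in> W_center W"
  by (rule central_unit[of k]) (simp add: B_to_W_twist)

lemma B_to_W_twist_one: "B_to_W W x (twist k) = mat 1 \<longleftrightarrow> int d dvd k"
proof -
  obtain z where z: "z \<in> W_center W" "\<And>v. z *v v = unit (of_int k / of_nat d) *s v"
    by (rule central_unit) (rule that)
  have "z = mat 1 \<longleftrightarrow> unit (of_int k / of_nat d) = 1"
  proof
    assume "z = mat 1"
    then have "unit (of_int k / of_nat d) *s x = 1 *s x" using z(2)[of x] by simp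
    then show "unit (of_int k / of_nat d) = 1" using x_nonzero by (simp only: vec.scale_cancel_right simp_thms)
  next
    assume "unit (of_int k / of_nat d) = 1"
    then show "z = mat 1" by (simp add: matrix_eq z(2))
  qed
  also have "\<dots> \<longleftrightarrow> (\<exists>n::int. of_int k = of_nat d * (of_int n :: real))"
    using d_pos by (auto simp: unit_eq_1 field_simps)
  also have "\<dots> \<longleftrightarrow> int d dvd k"
  proof -
    have "of_int k = of_nat d * (of_int n :: real) \<longleftrightarrow> k = int d * n" for n
      using of_int_eq_iff[of k "int d * n", where ?'a = real] by simp
    then show ?thesis by (simp add: dvd_def)
  qed
  finally show ?thesis using B_to_W_twist[OF z] by simp
qed

lemma B_to_W_twist_surj:
  assumes "z \<in> W_center W" obtains k where "B_to_W W x (twist k) = z"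
proof -
  obtain c where c: "\<And>v. z *v v = c *s v" by (rule center_scalarE[OF assms]) (rule that)
  have "c ^ d = 1" using center_roots_of_unity[of c] assms c by blast
  then obtain j where "c = exp (2 * of_real pi * \<i> * of_nat j / of_nat d)"
    using complex_roots_unity[of d] d_pos by auto
  then have "c = unit (of_int (int j) / of_nat d)"
    by (simp add: unit_def mult_ac)
  then have "B_to_W W x (twist (int j)) = z" using B_to_W_twist[OF assms] c by simp
  then show thesis by (rule that)
qed

text \<open>On exponents the two maps are multiplication by \<open>d\<close> and reduction modulo
  \<open>d\<close>; injectivity is inherited from the second row.\<close>

lemma first_row_exact:
  "short_exact (pi_group W x) (beta_group W x) (Z_group W) (P_to_B W x) (B_to_W W x)"
proof -
  note row2 = second_row_exact[unfolded short_exact_def mon_def epi_def]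
  have "P_to_B W x \<in> mon (pi_group W x) (beta_group W x)"
    using P_to_B_hom row2 pure_twist_carrier
    by (auto simp: mon_def hom_def carrier_pi_group carrier_beta_group P_to_B_pure_twist Pi_iff
        intro: inj_on_subset)
  moreover have "B_to_W W x \<in> epi (beta_group W x) (Z_group W)"
  proof -
    have "B_to_W W x ` range twist = W_center W"
      using B_to_W_twist_center B_to_W_twist_surj by (auto simp: image_iff) metis
    then show ?thesis
      using B_to_W_hom twist_carrier B_to_W_twist_center
      by (auto simp: epi_def hom_def carrier_beta_group Pi_iff)
  qed
  moreover have "P_to_B W x ` range pure_twist = {b \<in> range twist. B_to_W W x b = mat 1}"
    by (auto simp: P_to_B_pure_twist B_to_W_twist_one image_iff elim!: dvdE)
  ultimately show ?thesis
    using group_pi group_beta subgroup.subgroup_is_group[OF subgroup_center group_GL]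
    by (simp add: short_exact_def kernel_def carrier_pi_group carrier_beta_group)
qed

lemma hat_B_twist: "B_to_hat_B W x (twist k) = \<one>\<^bsub>hat_braid_group W x\<^esub>"
proof -
  obtain z where z: "z \<in> W_center W" "\<And>v. z *v v = unit (of_int k / of_nat d) *s v"
    by (rule central_unit) (rule that)
  have "hat_orbit (twist_path k t) = hat_orbit x" for t
    by (simp add: twist_path_def line_scale unit_nonzero)
  then show ?thesis
    unfolding twist_def B_to_hat_B_braid[OF twist_braid_path[OF z]]
    by (simp add: hat_braid_group_def one_pi1)
qed

lemma id_mon_beta: "id \<in> mon (beta_group W x) (braid_group W x)"
  by (auto simp: mon_def hom_def carrier_beta_group twist_carrier)

lemma second_column_exactI:
  assumes surj: "carrier (hat_braid_group W x) \<subseteq> B_to_hat_B W x ` carrier (braid_group W x)"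
    and ker: "kernel (braid_group W x) (hat_braid_group W x) (B_to_hat_B W x) \<subseteq> range twist"
  shows "second_column_exact W x"
proof -
  have "B_to_hat_B W x ` carrier (braid_group W x) = carrier (hat_braid_group W x)"
    using surj B_to_hat_B_hom by (auto simp: hom_def Pi_iff)
  moreover have "range twist = kernel (braid_group W x) (hat_braid_group W x) (B_to_hat_B W x)"
    using ker by (auto simp: kernel_def twist_carrier hat_B_twist)
  ultimately show ?thesis
    unfolding second_column_exact_def short_exact_def
    using group_beta group_B group_hat_B id_mon_beta B_to_hat_B_hom
    by (simp add: carrier_beta_group epi_def)
qed

section \<open>From the second column to the completed diagram and back\<close>

lemma morphism_exists:
  assumes "second_column_exact W x" shows "\<exists>\<phi>. completes_diagram W x \<phi>"
proof -
  note col = assms[unfolded second_column_exact_def short_exact_def epi_def carrier_beta_group]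
  have h: "to_hat_W W \<circ> B_to_W W x \<in> hom (braid_group W x) (hat_W W)"
    by (rule hom_compose[OF B_to_W_hom to_hat_W_hom])
  \<comment> \<open>By exactness the kernel consists of twists, and twists project to central
    elements of \<open>W\<close>.\<close>
  have ker: "kernel (braid_group W x) (hat_braid_group W x) (B_to_hat_B W x)
      \<subseteq> kernel (braid_group W x) (hat_W W) (to_hat_W W \<circ> B_to_W W x)"
  proof
    fix b assume "b \<in> kernel (braid_group W x) (hat_braid_group W x) (B_to_hat_B W x)"
    then have "b \<in> range twist" using col by simp
    then obtain k where b: "b = twist k" ..
    have "to_hat_W W (B_to_W W x b) = \<one>\<^bsub>hat_W W\<^esub>"
      using B_to_W_twist_center[of k] W_center_W by (simp add: b to_hat_W_one)
    then show "b \<in> kernel (braid_group W x) (hat_W W) (to_hat_W W \<circ> B_to_W W x)"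
      by (simp add: kernel_def b twist_carrier)
  qed
  have surj: "B_to_hat_B W x ` carrier (braid_group W x) = carrier (hat_braid_group W x)"
    using col by simp
  obtain \<phi> where "\<phi> \<in> hom (hat_braid_group W x) (hat_W W)"
    "\<And>b. b \<in> carrier (braid_group W x) \<Longrightarrow> \<phi> (B_to_hat_B W x b) = (to_hat_W W \<circ> B_to_W W x) b"
    by (rule hom_factor[OF group_B group_hat_B group_hat_W B_to_hat_B_hom surj h ker]) (rule that)
  then have "completes_diagram W x \<phi>"
    using lower_left_square by (simp add: completes_diagram_def)
  then show ?thesis by (rule exI[of "completes_diagram W x" \<phi>])
qed

text \<open>A regular element \<open>g\<close> with eigenvector \<open>v\<close> is the image of the braid that follows a path to
  \<open>v\<close>, multiplies by scalars until \<open>g v\<close>, and returns along the translated path. This braid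
  becomes trivial in the quotient of projective space.\<close>

lemma regular_central:
  assumes \<phi>: "completes_diagram W x \<phi>" and "regular W g"
  shows "g \<in> W_center W"
proof -
  obtain \<zeta> v where g: "g \<in> W" and v: "\<zeta> \<noteq> 0" "v \<in> X" "g *v v = \<zeta> *s v"
    using assms(2) unfolding regular_def by blast
  obtain \<eta> where \<eta>: "pathin (top_of_set X) \<eta>" "\<eta> 0 = x" "\<eta> 1 = v"
    using path_connected_X[OF x_X v(2)] by metis
  \<comment> \<open>A path of scalars from 1 to \<open>\<zeta>\<close>; it keeps
    \<open>\<sigma>\<close> in the line of \<open>v\<close> and away from 0.\<close>
  define \<sigma> where "\<sigma> t = exp (of_real t * Ln \<zeta>) *s v" for t
  have \<sigma>: "pathin (top_of_set X) \<sigma>" "\<sigma> 0 = v" "\<sigma> 1 = g *v v"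
  proof -
    have "continuous_on {0..1} \<sigma>"
      unfolding \<sigma>_def vector_scalar_mult_def by (intro continuous_intros)
    then show "pathin (top_of_set X) \<sigma>" using X_scale[OF v(2)] by (auto simp: pathin_def \<sigma>_def)
    show "\<sigma> 0 = v" "\<sigma> 1 = g *v v" using v by (simp_all add: \<sigma>_def)
  qed
  define \<rho> where "\<rho> = (\<lambda>t. g *v \<eta> (1 - t))"
  have "pathin (top_of_set X) (\<eta> \<circ> (\<lambda>t. 1 - t))"
    unfolding pathin_def
    by (rule continuous_map_compose[OF _ \<eta>(1)[unfolded pathin_def]]) (auto intro!: continuous_intros)
  then have \<rho>: "pathin (top_of_set X) \<rho>" "\<rho> 0 = g *v v" "\<rho> 1 = g *v x"
    using pathin_W[OF _ g] \<eta> unfolding \<rho>_def o_def by simp_all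
  define \<gamma> where "\<gamma> = join (join \<eta> \<sigma>) \<rho>"
  have \<gamma>: "braid_path \<gamma> g"
    using pathin_join[OF pathin_join[OF \<eta>(1) \<sigma>(1)] \<rho>(1)] \<eta> \<sigma> \<rho> g
    by (simp add: braid_path_def \<gamma>_def join_def)
  \<comment> \<open>Position on \<open>\<eta>\<close> of the image of \<open>\<gamma>\<close> in the
    projective orbit space: forward up to time 1/4, at rest at the end point until 1/2, and back to
    the start at time 1.\<close>
  define a where "a t = min (min 1 (4 * t)) (2 - 2 * t)" for t :: real
  have hat: "hat_orbit (\<sigma> t) = hat_orbit v" "hat_orbit (g *v w) = hat_orbit w" for t w
    by (simp_all add: \<sigma>_def line_scale hat_W_orbit_W g)
  have eq: "hat_orbit (\<gamma> t) = hat_orbit (\<eta> (a t))" if "t \<in> {0..1}" for t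
  proof -
    consider "t \<le> 1/4" | "1/4 < t" "t \<le> 1/2" | "1/2 < t" by linarith
    then show ?thesis
    proof cases
      case 1
      then have "a t = 4 * t" by (simp add: a_def)
      then show ?thesis using 1 by (simp add: \<gamma>_def join_def)
    next
      case 2
      then have "a t = 1" by (simp add: a_def)
      moreover have "\<gamma> t = \<sigma> (2 * (2 * t) - 1)" using 2 by (simp add: \<gamma>_def join_def)
      ultimately show ?thesis using \<eta>(3) by (simp add: hat)
    next
      case 3
      then have "a t = 1 - (2 * t - 1)" by (simp add: a_def)
      moreover have "\<gamma> t = g *v \<eta> (1 - (2 * t - 1))" using 3 by (simp add: \<gamma>_def join_def \<rho>_def)
      ultimately show ?thesis by (simp only: hat)
    qed
  qed
  have \<eta>_hat: "continuous_map (top_of_set {0..1}) (hat_X_mod_hat_W W) (\<lambda>t. hat_orbit (\<eta> t))"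
    using continuous_map_compose[OF \<eta>(1)[unfolded pathin_def] cont_hat] by (simp only: o_def)
  \<comment> \<open>The image path goes out along \<open>\<eta>\<close> and returns, so contracting
    the parameter \<open>a\<close> to 0 is a null homotopy.\<close>
  have "((\<lambda>t. hat_orbit (\<gamma> t)), (\<lambda>_. hat_orbit x)) \<in> loop_homotopic (hat_X_mod_hat_W W) (hat_orbit x)"
  proof (rule homotopic_through_convex[OF \<eta>_hat, of a "\<lambda>_. 0"])
    show "continuous_on {0..1} a" unfolding a_def by (intro continuous_intros)
    show "hat_orbit (\<gamma> t) = hat_orbit (\<eta> (a t))" if "t \<in> {0..1}" for t by (rule eq[OF that])
  qed (auto simp: a_def \<eta>)
  then have "B_to_hat_B W x (braid \<gamma>) = \<one>\<^bsub>hat_braid_group W x\<^esub>"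
    unfolding B_to_hat_B_braid[OF \<gamma>] hat_braid_group_def one_pi1 by (rule loop_class_eqI)
  then have "to_hat_W W g = \<phi> \<one>\<^bsub>hat_braid_group W x\<^esub>"
    using \<phi> braid_carrier[OF \<gamma>] B_to_W_braid[OF \<gamma>] unfolding completes_diagram_def by metis
  also have "\<dots> = \<one>\<^bsub>hat_W W\<^esub>"
    using \<phi> hom_one[OF _ group_hat_B group_hat_W] unfolding completes_diagram_def by blast
  finally show ?thesis using to_hat_W_one[OF g] by simp
qed

text \<open>A diagram chase from the first two rows and the second and third columns; the remaining
  topological input is the surjectivity \<open>surj\<close>.\<close>

lemma rows_columns_exact:
  assumes col2: "second_column_exact W x" and \<phi>: "completes_diagram W x \<phi>"
    and surj: "carrier (hat_pure_braid_group W x) \<subseteq> P_to_hat_P W x ` carrier (pure_braid_group W x)"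
  shows "rows_exact W x \<phi> \<and> columns_exact W x"
proof -
  let ?P = "pure_braid_group W x" and ?B = "braid_group W x"
  let ?hP = "hat_pure_braid_group W x" and ?hB = "hat_braid_group W x"
  interpret B: group_hom ?B "W_group W" "B_to_W W x"
    by (intro group_hom.intro group_hom_axioms.intro group_B group_W B_to_W_hom)
  interpret PB: group_hom ?P ?B "P_to_B W x"
    by (intro group_hom.intro group_hom_axioms.intro group_P group_B P_to_B_hom)
  interpret BB: group_hom ?B ?hB "B_to_hat_B W x"
    by (intro group_hom.intro group_hom_axioms.intro group_B group_hat_B B_to_hat_B_hom)
  note row2 = second_row_exact[unfolded short_exact_def mon_def epi_def]
  note col = col2[unfolded second_column_exact_def short_exact_def epi_def carrier_beta_group]
  have kerBB: "b \<in> range twist" if "b \<in> carrier ?B" "B_to_hat_B W x b = \<one>\<^bsub>?hB\<^esub>" for b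
    using col that by (auto simp: kernel_def)
  have \<phi>_hom: "\<phi> \<in> hom ?hB (hat_W W)"
    and \<phi>_eq: "\<And>b. b \<in> carrier ?B \<Longrightarrow> \<phi> (B_to_hat_B W x b) = to_hat_W W (B_to_W W x b)"
    using \<phi> by (auto simp: completes_diagram_def)
  have BW_P: "B_to_W W x (P_to_B W x p) = mat 1" if "p \<in> carrier ?P" for p
    using row2 that by (auto simp: kernel_def)
  have inj_P: "p = q" if "p \<in> carrier ?P" "q \<in> carrier ?P" "P_to_B W x p = P_to_B W x q" for p q
    using row2 that by (auto simp: inj_on_def)
  have surjP: "P_to_hat_P W x ` carrier ?P = carrier ?hP"
    using surj P_to_hat_P_hom by (auto simp: hom_def Pi_iff)
  \<comment> \<open>A pure braid that dies in the projective orbit space is a power of \<beta>;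
    being pure, its exponent is a multiple of \<open>d\<close>, so it is a power of \<pi>. This
    gives both the kernel in the first column and injectivity in the third row.\<close>
  have pure: "p \<in> range pure_twist"
    if p: "p \<in> carrier ?P" "B_to_hat_B W x (P_to_B W x p) = \<one>\<^bsub>?hB\<^esub>" for p
  proof -
    have "P_to_B W x p \<in> range twist" using kerBB p by simp
    then obtain k where k: "P_to_B W x p = twist k" ..
    then have "int d dvd k" using BW_P[OF p(1)] B_to_W_twist_one by metis
    then obtain j where "k = int d * j" ..
    then have "P_to_B W x p = P_to_B W x (pure_twist j)" by (simp add: k P_to_B_pure_twist)
    then have "p = pure_twist j" using inj_P p(1) pure_twist_carrier by blast
    then show ?thesis by blast
  qed
  have hP_twist: "P_to_hat_P W x (pure_twist k) = \<one>\<^bsub>?hP\<^esub>" for k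
  proof -
    have "P_to_hat_P W x (pure_twist k) =
        loop_class (hat_X W) (line x) (line \<circ> (\<lambda>s::real. unit (of_int k * s) *s x))"
      unfolding P_to_hat_P_def pure_twist_def by (rule pi1_map_class[OF cont_line refl pure_twist_loop])
    also have "line \<circ> (\<lambda>s::real. unit (of_int k * s) *s x) = (\<lambda>_. line x)"
      by (simp add: fun_eq_iff line_scale unit_nonzero)
    finally show ?thesis by (simp add: hat_pure_braid_group_def one_pi1)
  qed
  have hatP_one: "P_to_hat_P W x p = \<one>\<^bsub>?hP\<^esub>"
    if "p \<in> carrier ?P" "hat_P_to_hat_B W x (P_to_hat_P W x p) = \<one>\<^bsub>?hB\<^esub>" for p
    using pure[OF that(1)] that(2) lower_left_square[OF that(1)] hP_twist by auto
  have col1: "short_exact (pi_group W x) ?P ?hP id (P_to_hat_P W x)"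
  proof -
    have "id \<in> mon (pi_group W x) ?P"
      by (auto simp: mon_def hom_def carrier_pi_group pure_twist_carrier)
    moreover have "range pure_twist = kernel ?P ?hP (P_to_hat_P W x)"
    proof
      show "range pure_twist \<subseteq> kernel ?P ?hP (P_to_hat_P W x)"
        by (auto simp: kernel_def pure_twist_carrier hP_twist)
      show "kernel ?P ?hP (P_to_hat_P W x) \<subseteq> range pure_twist"
      proof
        fix p assume "p \<in> kernel ?P ?hP (P_to_hat_P W x)"
        then have p: "p \<in> carrier ?P" "P_to_hat_P W x p = \<one>\<^bsub>?hP\<^esub>" by (auto simp: kernel_def)
        have "B_to_hat_B W x (P_to_B W x p) = \<one>\<^bsub>?hB\<^esub>"
          using lower_left_square[OF p(1)] p(2) hom_one[OF hat_P_to_hat_B_hom group_hat_P group_hat_B] by simp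
        then show "p \<in> range pure_twist" using pure p(1) by blast
      qed
    qed
    ultimately show ?thesis
      using group_pi group_P group_hat_P P_to_hat_P_hom surjP
      by (simp add: short_exact_def epi_def carrier_pi_group)
  qed
  have row3: "short_exact ?hP ?hB (hat_W W) (hat_P_to_hat_B W x) \<phi>"
  proof -
    have "hat_P_to_hat_B W x \<in> mon ?hP ?hB"
      unfolding mon_iff_hom_one[OF group_hat_P group_hat_B]
    proof (intro conjI allI impI)
      fix a assume a: "a \<in> carrier ?hP \<and> hat_P_to_hat_B W x a = \<one>\<^bsub>?hB\<^esub>"
      then have "a \<in> P_to_hat_P W x ` carrier ?P" by (simp only: surjP)
      then obtain p where p: "p \<in> carrier ?P" "a = P_to_hat_P W x p"
        by (elim imageE) (rule that, assumption, simp)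
      then show "a = \<one>\<^bsub>?hP\<^esub>" using hatP_one[OF p(1)] a by simp
    qed (rule hat_P_to_hat_B_hom)
    moreover have "\<phi> ` carrier ?hB = carrier (hat_W W)"
    proof -
      have "\<phi> ` carrier ?hB = (\<lambda>b. \<phi> (B_to_hat_B W x b)) ` carrier ?B"
        using col by (simp add: image_image[symmetric])
      also have "\<dots> = to_hat_W W ` (B_to_W W x ` carrier ?B)"
        unfolding image_image by (rule image_cong[OF refl \<phi>_eq])
      also have "\<dots> = carrier (hat_W W)" using row2 to_hat_W_surj by simp
      finally show ?thesis .
    qed
    moreover have "hat_P_to_hat_B W x ` carrier ?hP = kernel ?hB (hat_W W) \<phi>"
    proof
      show "hat_P_to_hat_B W x ` carrier ?hP \<subseteq> kernel ?hB (hat_W W) \<phi>"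
      proof
        fix y assume "y \<in> hat_P_to_hat_B W x ` carrier ?hP"
        then have "y \<in> hat_P_to_hat_B W x ` P_to_hat_P W x ` carrier ?P" by (simp only: surjP)
        then obtain p where p: "p \<in> carrier ?P" "y = hat_P_to_hat_B W x (P_to_hat_P W x p)"
          by (elim imageE) (rule that, assumption, simp)
        then have y: "y = B_to_hat_B W x (P_to_B W x p)" using lower_left_square by simp
        have "\<phi> y = to_hat_W W (mat 1)" unfolding y using \<phi>_eq BW_P p(1) by simp
        also have "\<dots> = \<one>\<^bsub>hat_W W\<^esub>" using hom_one[OF to_hat_W_hom group_W group_hat_W] by simp
        finally show "y \<in> kernel ?hB (hat_W W) \<phi>" using y p(1) by (simp add: kernel_def)
      qed
      show "kernel ?hB (hat_W W) \<phi> \<subseteq> hat_P_to_hat_B W x ` carrier ?hP"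
      proof
        fix y assume y: "y \<in> kernel ?hB (hat_W W) \<phi>"
        then have "y \<in> B_to_hat_B W x ` carrier ?B" using col by (simp add: kernel_def)
        then obtain b where b: "b \<in> carrier ?B" "y = B_to_hat_B W x b" by blast
        have "B_to_W W x b \<in> W" using B.hom_closed[OF b(1)] by simp
        moreover have "to_hat_W W (B_to_W W x b) = \<one>\<^bsub>hat_W W\<^esub>"
          using y b \<phi>_eq by (simp add: kernel_def)
        ultimately have "B_to_W W x b \<in> W_center W" by (simp add: to_hat_W_one)
        then obtain k where k: "B_to_W W x (twist k) = B_to_W W x b" by (rule B_to_W_twist_surj)
        \<comment> \<open>Dividing by a twist with the same image in \<open>W\<close> makes the
          braid pure without changing its image in the projective orbit space.\<close>
        let ?b = "b \<otimes>\<^bsub>?B\<^esub> inv\<^bsub>?B\<^esub> (twist k)"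
        have bc: "?b \<in> carrier ?B" using b(1) twist_carrier by simp
        have "B_to_W W x ?b = \<one>\<^bsub>W_group W\<^esub>"
          using b(1) twist_carrier[of k] k B.H.r_inv[of "B_to_W W x b"] B.hom_closed[OF b(1)]
          by (simp only: B.hom_mult B.hom_inv B.G.inv_closed)
        then have "?b \<in> P_to_B W x ` carrier ?P" using row2 bc by (simp add: kernel_def)
        then obtain p where p: "p \<in> carrier ?P" "P_to_B W x p = ?b" by blast
        have "B_to_hat_B W x ?b = y"
          using b twist_carrier[of k] by (simp add: hat_B_twist)
        then have "y = hat_P_to_hat_B W x (P_to_hat_P W x p)"
          using lower_left_square[OF p(1)] p(2) by simp
        then show "y \<in> hat_P_to_hat_B W x ` carrier ?hP" using p(1) surjP by blast
      qed
    qed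
    ultimately show ?thesis
      using group_hat_P group_hat_B group_hat_W \<phi>_hom by (simp add: short_exact_def epi_def)
  qed
  show ?thesis
    using first_row_exact second_row_exact row3 col1 col2 third_column_exact
    by (simp add: rows_exact_def columns_exact_def)
qed

end

sublocale sliced_reflection_group \<subseteq> pointed_reflection_group W x
  by unfold_locales (simp_all add: x_X x_nonzero)

section \<open>Lifting loops and homotopies from the projective spaces to the slice\<close>

context sliced_reflection_group
begin

lemma scale_path:
  assumes \<mu>: "continuous_on {0..1} \<mu>" "\<And>t. t \<in> {0..1} \<Longrightarrow> \<mu> t \<noteq> 0"
    and \<gamma>: "pathin (top_of_set Y) \<gamma>"
  shows "pathin (top_of_set X) (\<lambda>t. \<mu> t *s \<gamma> t)"
proof -
  have "continuous_on {0..1} \<gamma>" "\<And>t. t \<in> {0..1} \<Longrightarrow> \<gamma> t \<in> X"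
    using \<gamma> Y_X by (auto simp: pathin_def Pi_iff)
  moreover from this(1) have "continuous_on {0..1} (\<lambda>t. \<mu> t *s \<gamma> t)"
    unfolding vector_scalar_mult_def by (intro continuous_intros \<mu>(1))
  ultimately show ?thesis using \<mu>(2) X_scale by (auto simp: pathin_def)
qed

lemma nrm_path: "pathin (top_of_set X) \<gamma> \<Longrightarrow> pathin (top_of_set Y) (\<lambda>t. nrm (\<gamma> t))"
  using continuous_on_compose2[OF continuous_on_nrm, of "{0..1}" \<gamma>] nrm_Y
  by (auto simp: pathin_def)

text \<open>A loop of lines lifts to a closed path in the slice, since the slice meets each line
  once; the constant factor \<open>l x\<close> moves it to the base point \<open>x\<close>.\<close>

lemma hat_P_surjective:
  "carrier (hat_pure_braid_group W x) \<subseteq> P_to_hat_P W x ` carrier (pure_braid_group W x)"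
proof
  interpret Q: free_quotient Y "hat_X W" line "{id}" by (rule free_quotient_hat_X)
  fix a assume "a \<in> carrier (hat_pure_braid_group W x)"
  then obtain p where p: "p \<in> loops (hat_X W) (line x)" "a = loop_class (hat_X W) (line x) p"
    unfolding hat_pure_braid_group_def in_carrier_pi1 by blast
  have "pathin (hat_X W) p" "line (nrm x) = p 0" using p(1) by (auto simp: loops_def line_nrm x_X)
  from Q.path_lift[OF this(1) nrm_Y[OF x_X] this(2)]
  obtain \<gamma> where \<gamma>: "pathin (top_of_set Y) \<gamma>" "\<gamma> 0 = nrm x" "\<And>t. t \<in> {0..1} \<Longrightarrow> line (\<gamma> t) = p t"
    by metis
  have "\<gamma> 1 \<in> Y" using path_finish_in_topspace[OF \<gamma>(1)] by simp
  moreover have "line (nrm x) = line (\<gamma> 1)" using \<gamma>(3)[of 1] p(1) by (simp add: loops_def line_nrm x_X)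
  ultimately have "\<gamma> 1 = nrm x" using Q.fib[OF nrm_Y[OF x_X]] by simp
  moreover have "pathin (top_of_set X) (\<lambda>t. l x *s \<gamma> t)"
    by (rule scale_path[OF _ _ \<gamma>(1)]) (auto simp: l_nonzero x_X)
  ultimately have \<delta>: "(\<lambda>t. l x *s \<gamma> t) \<in> loops (X_top W) x"
    using \<gamma>(2) by (simp add: loops_def scale_nrm x_X)
  have "(p, line \<circ> (\<lambda>t. l x *s \<gamma> t)) \<in> loop_homotopic (hat_X W) (line x)"
    by (rule loop_homotopic_cong[OF p(1)]) (simp add: line_scale l_nonzero x_X \<gamma>(3))
  then have "a = P_to_hat_P W x (loop_class (X_top W) x (\<lambda>t. l x *s \<gamma> t))"
    unfolding p(2) P_to_hat_P_def pi1_map_class[OF cont_line refl \<delta>] by (rule loop_class_eqI)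
  then show "a \<in> P_to_hat_P W x ` carrier (pure_braid_group W x)"
    using \<delta> unfolding pure_braid_group_def by blast
qed

text \<open>The lift to the slice ends on the line of some \<open>g *v x\<close>. A varying scalar
  factor turns it into a path from \<open>x\<close> to \<open>g *v x\<close>, which represents a
  braid.\<close>

lemma hat_B_surjective:
  assumes reg: "\<forall>g. regular W g \<longrightarrow> g \<in> W_center W"
  shows "carrier (hat_braid_group W x) \<subseteq> B_to_hat_B W x ` carrier (braid_group W x)"
proof
  interpret Q: free_quotient Y "hat_X_mod_hat_W W" "\<lambda>v. hat_W_orbit W (line v)" "(\<lambda>g v. nrm (g *v v)) ` W"
    by (rule free_quotient_hat_X_mod[OF reg])
  fix b assume "b \<in> carrier (hat_braid_group W x)"
  then obtain p where p: "p \<in> loops (hat_X_mod_hat_W W) (hat_orbit x)"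
      "b = loop_class (hat_X_mod_hat_W W) (hat_orbit x) p"
    unfolding hat_braid_group_def in_carrier_pi1 by blast
  have "pathin (hat_X_mod_hat_W W) p" "hat_orbit (nrm x) = p 0"
    using p(1) by (auto simp: loops_def line_nrm x_X)
  from Q.path_lift[OF this(1) nrm_Y[OF x_X] this(2)]
  obtain \<gamma> where \<gamma>: "pathin (top_of_set Y) \<gamma>" "\<gamma> 0 = nrm x" "\<And>t. t \<in> {0..1} \<Longrightarrow> hat_orbit (\<gamma> t) = p t"
    by metis
  have "\<gamma> 1 \<in> Y" using path_finish_in_topspace[OF \<gamma>(1)] by simp
  moreover have "hat_orbit (nrm x) = hat_orbit (\<gamma> 1)"
    using \<gamma>(3)[of 1] p(1) by (simp add: loops_def line_nrm x_X)
  ultimately obtain g where g: "g \<in> W" "\<gamma> 1 = nrm (g *v nrm x)"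
    using Q.fib[OF nrm_Y[OF x_X], of "\<gamma> 1"] by auto
  \<comment> \<open>A path of nonzero scalars from \<open>l x\<close> to \<open>l (g *v x)\<close>,
    the factors by which \<open>x\<close> and \<open>g *v x\<close> differ from their points in the
    slice.\<close>
  define \<mu> where "\<mu> t = l x * exp (of_real t * Ln (l (g *v x) / l x))" for t
  have nz: "l x \<noteq> 0" "l (g *v x) \<noteq> 0" using l_nonzero X_W[OF x_X g(1)] x_X by auto
  have \<mu>: "\<mu> t \<noteq> 0" "\<mu> 0 = l x" "\<mu> 1 = l (g *v x)" for t
    using nz by (simp_all add: \<mu>_def)
  have "continuous_on {0..1} \<mu>" unfolding \<mu>_def by (intro continuous_intros)
  then have "pathin (top_of_set X) (\<lambda>t. \<mu> t *s \<gamma> t)" by (rule scale_path[OF _ \<mu>(1) \<gamma>(1)])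
  moreover have "\<mu> 0 *s \<gamma> 0 = x" by (simp add: \<mu> \<gamma>(2) scale_nrm x_X)
  moreover have "\<mu> 1 *s \<gamma> 1 = g *v x"
    by (simp add: \<mu> g(2) nrm_W[OF x_X g(1)] scale_nrm X_W[OF x_X g(1)])
  ultimately have bp: "braid_path (\<lambda>t. \<mu> t *s \<gamma> t) g"
    using g(1) by (simp add: braid_path_def)
  have "(p, \<lambda>t. hat_orbit (\<mu> t *s \<gamma> t)) \<in> loop_homotopic (hat_X_mod_hat_W W) (hat_orbit x)"
    by (rule loop_homotopic_cong[OF p(1)]) (simp add: line_scale \<mu>(1) \<gamma>(3))
  then have "b = B_to_hat_B W x (braid (\<lambda>t. \<mu> t *s \<gamma> t))"
    unfolding p(2) B_to_hat_B_braid[OF bp] by (rule loop_class_eqI)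
  then show "b \<in> B_to_hat_B W x ` carrier (braid_group W x)"
    using braid_carrier[OF bp] by blast
qed

text \<open>A null homotopy of the image of a braid lifts to the slice. It deforms the braid to one that
  moves inside a single line, which is a power of the twist.\<close>

lemma hat_B_kernel:
  assumes reg: "\<forall>g. regular W g \<longrightarrow> g \<in> W_center W"
    and bp: "braid_path \<gamma> g" and one: "B_to_hat_B W x (braid \<gamma>) = \<one>\<^bsub>hat_braid_group W x\<^esub>"
  shows "braid \<gamma> \<in> range twist"
proof -
  interpret Q: free_quotient Y "hat_X_mod_hat_W W" "\<lambda>v. hat_W_orbit W (line v)" "(\<lambda>g v. nrm (g *v v)) ` W"
    by (rule free_quotient_hat_X_mod[OF reg])
  have \<gamma>: "g \<in> W" "pathin (top_of_set X) \<gamma>" "\<gamma> 0 = x" "\<gamma> 1 = g *v x"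
    using bp by (auto simp: braid_path_def)
  have \<gamma>X: "\<gamma> t \<in> X" if "t \<in> {0..1}" for t
    using path_image_subset_topspace[OF \<gamma>(2)] that by auto
  have \<gamma>c: "continuous_on {0..1} \<gamma>" using \<gamma>(2) by (auto simp: pathin_def)
  have hom: "(\<lambda>t. hat_orbit (\<gamma> t), \<lambda>_. hat_orbit x) \<in> loop_homotopic (hat_X_mod_hat_W W) (hat_orbit x)"
  proof -
    have "(\<lambda>_. hat_orbit x) \<in> loops (hat_X_mod_hat_W W) (hat_orbit x)"
      by (rule loops_const) (use x_X x_nonzero in \<open>auto simp: topspace_hat_X_mod\<close>)
    then show ?thesis
      using one hat_loop[OF bp]
      by (simp add: B_to_hat_B_braid[OF bp] hat_braid_group_def one_pi1 loop_class_eq)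
  qed
  have const: "pathin (top_of_set Y) (\<lambda>_. nrm x)" by (simp add: nrm_Y x_X)
  have start: "nrm x = nrm (\<gamma> 0)" by (simp add: \<gamma>)
  \<comment> \<open>The lifts being compared are the projection of \<open>\<gamma>\<close> to the
    slice and a constant path. Equality of their end points makes \<open>x\<close> an eigenvector of
    \<open>g\<close>, so that \<open>g\<close> is regular and hence central.\<close>
  have "\<exists>h. continuous_map (top_of_set ({0..1::real} \<times> {0..1})) (top_of_set Y) h \<and>
      (\<forall>t\<in>{0..1}. h (0, t) = nrm (\<gamma> t)) \<and> (\<forall>t\<in>{0..1}. h (1, t) = nrm x) \<and>
      (\<forall>s\<in>{0..1}. h (s, 0) = nrm x) \<and> (\<forall>s\<in>{0..1}. h (s, 1) = nrm (g *v x)) \<and> nrm x = nrm (g *v x)"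
  proof (rule Q.homotopy_lift[OF nrm_path[OF \<gamma>(2)] const start hom])
    show "hat_orbit (nrm (\<gamma> t)) = hat_orbit (\<gamma> t)" if "t \<in> {0..1}" for t
      by (simp add: line_nrm \<gamma>X[OF that])
    show "hat_orbit (nrm x) = hat_orbit x" by (simp add: line_nrm x_X)
    fix h assume "continuous_map (top_of_set ({0..1::real} \<times> {0..1})) (top_of_set Y) h"
      "\<And>t. t \<in> {0..1} \<Longrightarrow> h (0, t) = nrm (\<gamma> t)" "\<And>t. t \<in> {0..1} \<Longrightarrow> h (1, t) = nrm x"
      "\<And>s. s \<in> {0..1} \<Longrightarrow> h (s, 0) = nrm (\<gamma> 0)" "\<And>s. s \<in> {0..1} \<Longrightarrow> h (s, 1) = nrm (\<gamma> 1)"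
      "nrm x = nrm (\<gamma> 1)"
    then show ?thesis by (intro exI[of _ h]) (simp add: \<gamma>)
  qed
  then obtain h where h: "continuous_map (top_of_set ({0..1::real} \<times> {0..1})) (top_of_set Y) h"
    and h0: "\<forall>t\<in>{0..1}. h (0, t) = nrm (\<gamma> t)" and h1: "\<forall>t\<in>{0..1}. h (1, t) = nrm x"
    and hs0: "\<forall>s\<in>{0..1}. h (s, 0) = nrm x" and hs1: "\<forall>s\<in>{0..1}. h (s, 1) = nrm (g *v x)"
    and nrm_g: "nrm x = nrm (g *v x)"
    by (elim exE conjE) (rule that)
  have gX: "g *v x \<in> X" by (rule X_W[OF x_X \<gamma>(1)])
  have lx: "l x \<noteq> 0" "l (g *v x) \<noteq> 0" using l_nonzero x_X gX by auto
  define c where "c = l (g *v x) / l x"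
  have c0: "c \<noteq> 0" using lx by (simp add: c_def)
  have gx: "g *v x = c *s x"
  proof -
    have "g *v x = l (g *v x) *s nrm x" using scale_nrm[OF gX] nrm_g by simp
    then show ?thesis by (simp add: nrm_def c_def)
  qed
  have "regular W g"
    unfolding regular_def using \<gamma>(1) c0 gx x_X x_nonzero by blast
  then have gc: "g \<in> W_center W" using reg by blast
  have cd: "c ^ d = 1"
  proof -
    obtain c' where c': "\<And>v. g *v v = c' *s v" by (rule center_scalarE[OF gc]) (rule that)
    then have "c' *s x = c *s x" using gx by simp
    then have "c' = c" using x_nonzero by (simp only: vec.scale_cancel_right simp_thms)
    then show ?thesis using center_roots_of_unity[of c] gc c' by blast
  qed
  have step1: "(W_orbit W \<circ> \<gamma>, \<lambda>t. W_orbit W ((l (\<gamma> t) / l x) *s x)) \<in> loop_homotopic (X_mod_W W) (W_orbit W x)"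
  proof (rule loop_homotopicI)
    \<comment> \<open>The lifted homotopy is rescaled by \<open>l (\<gamma> t)\<close>, which undoes
      the projection at \<open>s = 0\<close> and leaves a motion in the line of \<open>x\<close> at
      \<open>s = 1\<close>.\<close>
    let ?K = "\<lambda>z. l (\<gamma> (snd z)) *s h z"
    have hc: "continuous_on ({0..1::real} \<times> {0..1}) h" "\<And>z. z \<in> {0..1} \<times> {0..1} \<Longrightarrow> h z \<in> Y"
      using h by auto
    have "continuous_on ({0..1::real} \<times> {0..1}) (\<lambda>z. \<gamma> (snd z))"
      by (rule continuous_on_compose2[OF \<gamma>c]) (auto intro!: continuous_intros)
    then have "continuous_on ({0..1::real} \<times> {0..1}) (\<lambda>z. l (\<gamma> (snd z)))"
      by (rule continuous_on_compose2[OF l_cont]) simp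
    then have "continuous_on ({0..1::real} \<times> {0..1}) ?K"
      unfolding vector_scalar_mult_def by (intro continuous_intros hc(1))
    moreover have "?K z \<in> X" if "z \<in> {0..1} \<times> {0..1}" for z
      using that by (intro X_scale Y_X hc(2) l_nonzero \<gamma>X) auto
    ultimately have "continuous_map (top_of_set ({0..1::real} \<times> {0..1})) (X_top W) ?K" by auto
    from continuous_map_compose[OF this continuous_W_orbit]
    show "continuous_map (top_of_set ({0..1::real} \<times> {0..1})) (X_mod_W W) (\<lambda>z. W_orbit W (?K z))"
      by (simp only: o_def)
    show "W_orbit W (?K (0, t)) = (W_orbit W \<circ> \<gamma>) t" if "t \<in> {0..1}" for t
      using h0 that scale_nrm[OF \<gamma>X[OF that]] by simp
    show "W_orbit W (?K (1, t)) = W_orbit W ((l (\<gamma> t) / l x) *s x)" if "t \<in> {0..1}" for t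
      using h1 that by (simp add: nrm_def)
    show "W_orbit W (?K (s, 0)) = W_orbit W x" if "s \<in> {0..1}" for s
      using hs0 that by (simp add: \<gamma> scale_nrm x_X)
    have "W_orbit W (g *v x) = W_orbit W x" using W_orbit_eq_iff[of x "g *v x"] \<gamma>(1) by metis
    then show "W_orbit W (?K (s, 1)) = W_orbit W x" if "s \<in> {0..1}" for s
      using hs1 that by (simp add: \<gamma> scale_nrm gX)
  qed
  have "continuous_on {0..1} (\<lambda>t. l (\<gamma> t) / l x)"
    using lx by (intro continuous_intros continuous_on_compose2[OF l_cont \<gamma>c]) auto
  moreover have "contractible {0..1::real}" by (rule convex_imp_contractible) simp
  ultimately obtain f where f: "continuous_on {0..1} f" "\<And>t. t \<in> {0..1} \<Longrightarrow> l (\<gamma> t) / l x = exp (f t)"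
    by (rule continuous_logarithm_on_contractible) (use l_nonzero \<gamma>X lx in auto)
  \<comment> \<open>The logarithm of the remaining scalar motion, normalized to start at 0.\<close>
  define F where "F t = f t - f 0" for t
  have f0: "exp (f 0) = 1" using f(2)[of 0] lx by (simp add: \<gamma>)
  have F: "l (\<gamma> t) / l x = exp (F t)" if "t \<in> {0..1}" for t
    using f(2)[OF that] f0 by (simp add: F_def exp_diff)
  have "exp (F 1) = c" using F[of 1] by (simp add: \<gamma> c_def)
  \<comment> \<open>The end scalar \<open>c\<close> is a \<open>d\<close>-th root of unity, so
    \<open>F\<close> ends at an integer multiple of the logarithm covered by \<beta>; this integer
    \<open>n\<close> is the exponent of the twist.\<close>
  then have "exp (of_nat d * F 1) = 1" using cd by (simp add: exp_of_nat_mult)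
  then obtain n :: int where "Re (of_nat d * F 1) = 0" "Im (of_nat d * F 1) = of_int (2 * n) * pi"
    unfolding exp_eq_1 by blast
  then have "F 1 = 2 * \<i> * of_real pi * of_real (of_int n * 1 / of_nat d)"
    using d_pos by (simp add: complex_eq_iff field_simps)
  note F1 = this
  have "(\<lambda>t. W_orbit W ((l (\<gamma> t) / l x) *s x), W_orbit W \<circ> twist_path n) \<in> loop_homotopic (X_mod_W W) (W_orbit W x)"
  proof (rule homotopic_through_convex[where K = UNIV and m = "\<lambda>z. W_orbit W (exp z *s x)" and a = F
        and b = "\<lambda>s. 2 * \<i> * of_real pi * of_real (of_int n * s / of_nat d)"])
    have "continuous_on UNIV (\<lambda>z. exp z *s x)"
      unfolding vector_scalar_mult_def by (intro continuous_intros)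
    then have "continuous_map euclidean (X_top W) (\<lambda>z. exp z *s x)"
      using X_scale[OF x_X] by (auto simp: continuous_map_in_subtopology)
    from continuous_map_compose[OF this continuous_W_orbit]
    show "continuous_map (top_of_set UNIV) (X_mod_W W) (\<lambda>z. W_orbit W (exp z *s x))" by (simp add: o_def)
    show "continuous_on {0..1} F" unfolding F_def by (intro continuous_intros f(1))
    show "continuous_on {0..1} (\<lambda>s. 2 * \<i> * of_real pi * of_real (of_int n * s / of_nat d))"
      using d_pos by (intro continuous_intros) auto
    show "F 0 = 2 * \<i> * of_real pi * of_real (of_int n * 0 / of_nat d)" by (simp add: F_def)
    show "F 1 = 2 * \<i> * of_real pi * of_real (of_int n * 1 / of_nat d)" by (rule F1)
    show "W_orbit W ((l (\<gamma> t) / l x) *s x) = W_orbit W (exp (F t) *s x)" if "t \<in> {0..1}" for t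
      by (simp only: F[OF that])
    show "(W_orbit W \<circ> twist_path n) t = W_orbit W (exp (2 * \<i> * of_real pi * of_real (of_int n * t / of_nat d)) *s x)" for t
      by (simp add: twist_path_def unit_def)
    show "W_orbit W (exp (F 0) *s x) = W_orbit W x" by (simp add: F_def)
    have "W_orbit W (g *v x) = W_orbit W x" using W_orbit_eq_iff[of x "g *v x"] \<gamma>(1) by metis
    then show "W_orbit W (exp (F 1) *s x) = W_orbit W x" using \<open>exp (F 1) = c\<close> gx by simp
  qed simp_all
  then have "loop_class (X_mod_W W) (W_orbit W x) (\<lambda>t. W_orbit W ((l (\<gamma> t) / l x) *s x)) = twist n"
    unfolding twist_def braid_def by (rule loop_class_eqI)
  then have "braid \<gamma> = twist n"
    using loop_class_eqI[OF step1] by (simp add: braid_def)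
  then show ?thesis by blast
qed

lemma second_column_exact_sliced:
  assumes "\<forall>g. regular W g \<longrightarrow> g \<in> W_center W" shows "second_column_exact W x"
proof (rule second_column_exactI[OF hat_B_surjective[OF assms]])
  show "kernel (braid_group W x) (hat_braid_group W x) (B_to_hat_B W x) \<subseteq> range twist"
  proof
    fix b assume b: "b \<in> kernel (braid_group W x) (hat_braid_group W x) (B_to_hat_B W x)"
    then have "b \<in> carrier (braid_group W x)" by (simp add: kernel_def)
    then obtain \<gamma> g where "braid_path \<gamma> g" "b = braid \<gamma>" by (rule braid_exists)
    then show "b \<in> range twist" using hat_B_kernel[OF assms] b by (simp add: kernel_def)
  qed
qed

end

section \<open>The trivial group\<close>

context pointed_reflection_group
begin

text \<open>The projective spaces are single points, so their fundamental groups are trivial, while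
  the complement is the whole space, where every braid contracts along straight lines. Hence all
  groups involved in these claims reduce to the class of \<open>twist 0\<close> and the
  identity.\<close>

lemma trivial_W:
  assumes "0 \<in> X"
  shows "second_column_exact W x"
    and "carrier (hat_pure_braid_group W x) \<subseteq> P_to_hat_P W x ` carrier (pure_braid_group W x)"
proof -
  have lineU: "line v = UNIV" for v :: "complex^'n" by (rule trivial_case(2)[OF assms])
  have XU: "X = UNIV" using X_iff trivial_case(1)[OF assms] by auto
  have "topspace (hat_X_mod_hat_W W) = {hat_orbit x}" "topspace (hat_X W) = {line x}"
    using x_X x_nonzero by (auto simp: topspace_hat_X_mod topspace_hat_X lineU)
  note one_point = this[THEN pi1_one_point]
  show "second_column_exact W x"
  proof (rule second_column_exactI)
    show "carrier (hat_braid_group W x) \<subseteq> B_to_hat_B W x ` carrier (braid_group W x)"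
      using one_point(1) hat_B_twist[of 0] twist_carrier[of 0] unfolding hat_braid_group_def
      by (metis empty_subsetI image_eqI insert_subset)
    show "kernel (braid_group W x) (hat_braid_group W x) (B_to_hat_B W x) \<subseteq> range twist"
    proof
      fix b assume "b \<in> kernel (braid_group W x) (hat_braid_group W x) (B_to_hat_B W x)"
      then have "b \<in> carrier (braid_group W x)" by (simp add: kernel_def)
      then obtain \<gamma> g where \<gamma>: "braid_path \<gamma> g" "b = braid \<gamma>" by (rule braid_exists)
      have "g \<in> W" using \<gamma>(1) unfolding braid_path_def by (rule conjunct1)
      then have "g = mat 1" unfolding trivial_case(1)[OF assms] by simp
      then have ends: "\<gamma> 0 = x" "\<gamma> 1 = x" and \<gamma>c: "continuous_on {0..1} \<gamma>"
        using \<gamma>(1) by (auto simp: braid_path_def pathin_def)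
      have "(W_orbit W \<circ> \<gamma>, W_orbit W \<circ> twist_path 0) \<in> loop_homotopic (X_mod_W W) (W_orbit W x)"
        by (rule homotopic_through_convex[where K = UNIV and m = "W_orbit W" and a = \<gamma> and b = "\<lambda>_. x"])
           (use continuous_W_orbit ends \<gamma>c in \<open>simp_all add: XU twist_path_def\<close>)
      then have "b = twist 0" unfolding \<gamma>(2) twist_def braid_def by (rule loop_class_eqI)
      then show "b \<in> range twist" by blast
    qed
  qed
  have "P_to_hat_P W x \<one>\<^bsub>pure_braid_group W x\<^esub> = \<one>\<^bsub>hat_pure_braid_group W x\<^esub>"
    by (rule hom_one[OF P_to_hat_P_hom group_P group_hat_P])
  moreover have "\<one>\<^bsub>pure_braid_group W x\<^esub> \<in> carrier (pure_braid_group W x)"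
    by (rule monoid.one_closed[OF group.is_monoid[OF group_P]])
  ultimately show "carrier (hat_pure_braid_group W x) \<subseteq> P_to_hat_P W x ` carrier (pure_braid_group W x)"
    using one_point(2) unfolding hat_pure_braid_group_def
    by (metis empty_subsetI image_eqI insert_subset)
qed

lemma regular_central_imp:
  "(\<forall>g. regular W g \<longrightarrow> g \<in> W_center W) \<Longrightarrow> second_column_exact W x"
  and hat_P_onto: "carrier (hat_pure_braid_group W x) \<subseteq> P_to_hat_P W x ` carrier (pure_braid_group W x)"
proof -
  show "second_column_exact W x" if "\<forall>g. regular W g \<longrightarrow> g \<in> W_center W"
  proof (cases "0 \<in> X")
    case False
    then obtain l where "sliced_reflection_group W l x" by (rule slice_exists[OF _ x_X])
    then show ?thesis using that by (rule sliced_reflection_group.second_column_exact_sliced)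
  qed (rule trivial_W)
  show "carrier (hat_pure_braid_group W x) \<subseteq> P_to_hat_P W x ` carrier (pure_braid_group W x)"
  proof (cases "0 \<in> X")
    case False
    then obtain l where "sliced_reflection_group W l x" by (rule slice_exists[OF _ x_X])
    then show ?thesis by (rule sliced_reflection_group.hat_P_surjective)
  qed (rule trivial_W)
qed

end

theorem proposition2p11:
  fixes W :: "(complex^'n^'n) set" and x :: "complex^'n"
  assumes "complex_reflection_group W"
    and "acts_irreducibly W"
    and "x \<in> hyperplane_complement W"
    and "x \<noteq> 0"
  shows "((\<forall>g. regular W g \<longrightarrow> g \<in> W_center W) \<longleftrightarrow> second_column_exact W x) \<and>
    (second_column_exact W x \<longleftrightarrow> (\<exists>\<phi>. completes_diagram W x \<phi>)) \<and>
    ((\<forall>g. regular W g \<longrightarrow> g \<in> W_center W) \<longrightarrow>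
       (\<forall>\<phi>. completes_diagram W x \<phi> \<longrightarrow> rows_exact W x \<phi> \<and> columns_exact W x))"
proof -
  interpret pointed_reflection_group W x
    by unfold_locales (fact assms)+
  have "completes_diagram W x \<phi> \<Longrightarrow> rows_exact W x \<phi> \<and> columns_exact W x"
    if "\<forall>g. regular W g \<longrightarrow> g \<in> W_center W" for \<phi>
    by (rule rows_columns_exact[OF regular_central_imp[OF that] _ hat_P_onto])
  \<comment> \<open>The three implications form a cycle: regular elements central, second column
    exact, morphism exists, regular elements central.\<close>
  then show ?thesis
    using regular_central_imp morphism_exists regular_central by metis
qed

end
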